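(* Let $M$ be a simple matroid which is graphic or cographic, and let $c$ be a $2$-uniform $(r(M)+1)$-colouring of $M$. Then $(M,c)$ has a short rainbow circuit $4$-tuple, i.e. rainbow circuits $C_1,\dots,C_4$ of $M$ (not necessarily distinct) with $\sum_{i=1}^4|C_i|\le 2r(M)+4$ such that no element of $E(M)$ lies in more than two of them (counted with multiplicity).
   Context: A $k$-colouring of a matroid $M$ is a function $c:E(M)\to[k]=\{1,\dots,k\}$; it is $2$-uniform if every colour class $c^{-1}(s)$ has exactly two elements. A rainbow circuit is a circuit on which $c$ is injective. *)

theory Defs
  imports Main "HOL-Library.FuncSet"
begin

section \<open>Matroids\<close>

record 'a pre_matroid =
  ground :: "'a set"
  indeps :: "'a set set"

locale matroid =
  fixes M :: "'a pre_matroid"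
  assumes finite_ground: "finite (ground M)"
    and indep_subset_ground: "I \<in> indeps M \<Longrightarrow> I \<subseteq> ground M"
    and indep_empty: "{} \<in> indeps M"
    and indep_subset: "I \<in> indeps M \<Longrightarrow> J \<subseteq> I \<Longrightarrow> J \<in> indeps M"
    and indep_augment: "I \<in> indeps M \<Longrightarrow> J \<in> indeps M \<Longrightarrow> card I < card J \<Longrightarrow>
      \<exists>x \<in> J - I. insert x I \<in> indeps M"

definition circuit :: "'a pre_matroid \<Rightarrow> 'a set \<Rightarrow> bool" where
  "circuit M C \<longleftrightarrow> C \<subseteq> ground M \<and> C \<notin> indeps M \<and> (\<forall>D. D \<subset> C \<longrightarrow> D \<in> indeps M)"

definition basis :: "'a pre_matroid \<Rightarrow> 'a set \<Rightarrow> bool" where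
  "basis M B \<longleftrightarrow> B \<in> indeps M \<and> (\<forall>I \<in> indeps M. B \<subseteq> I \<longrightarrow> I = B)"

definition rank_of :: "'a pre_matroid \<Rightarrow> 'a set \<Rightarrow> nat" where
  "rank_of M X = Max (card ` {I \<in> indeps M. I \<subseteq> X})"

definition matroid_rank :: "'a pre_matroid \<Rightarrow> nat" where
  "matroid_rank M = rank_of M (ground M)"

definition loop :: "'a pre_matroid \<Rightarrow> 'a \<Rightarrow> bool" where
  "loop M e \<longleftrightarrow> circuit M {e}"

definition parallel :: "'a pre_matroid \<Rightarrow> 'a \<Rightarrow> 'a \<Rightarrow> bool" where
  "parallel M e f \<longleftrightarrow> e \<noteq> f \<and> circuit M {e, f}"

definition simple_matroid :: "'a pre_matroid \<Rightarrow> bool" where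
  "simple_matroid M \<longleftrightarrow> (\<nexists>e. loop M e) \<and> (\<nexists>e f. parallel M e f)"

text \<open>The bases of the dual are the complements of the bases, so its independent sets are the
  sets of elements avoiding some basis.\<close>

definition dual :: "'a pre_matroid \<Rightarrow> 'a pre_matroid" where
  "dual M = \<lparr> ground = ground M,
              indeps = {I. \<exists>B. basis M B \<and> I \<subseteq> ground M - B} \<rparr>"

definition isomorphic :: "'a pre_matroid \<Rightarrow> 'b pre_matroid \<Rightarrow> bool" where
  "isomorphic M N \<longleftrightarrow> (\<exists>f. bij_betw f (ground M) (ground N) \<and>
     (\<forall>I. I \<subseteq> ground M \<longrightarrow> (I \<in> indeps M \<longleftrightarrow> f ` I \<in> indeps N)))"

section \<open>Graphic and cographic matroids\<close>

text \<open>Finite undirected graphs; loops (one end) and parallel edges are allowed.\<close>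

record ('v, 'e) pre_multigraph =
  vertices :: "'v set"
  edges :: "'e set"
  ends :: "'e \<Rightarrow> 'v set"

locale multigraph =
  fixes G :: "('v, 'e) pre_multigraph"
  assumes finite_vertices: "finite (vertices G)"
    and finite_edges: "finite (edges G)"
    and ends_subset: "e \<in> edges G \<Longrightarrow> ends G e \<subseteq> vertices G"
    and card_ends: "e \<in> edges G \<Longrightarrow> card (ends G e) = 1 \<or> card (ends G e) = 2"

text \<open>Edge sets of cycles. A loop is a cycle of length 1, a pair of parallel edges one of length 2
  (this is the only length for which distinctness of the edges is not implied by that of the
  vertices).\<close>

definition cycle_edges :: "('v, 'e) pre_multigraph \<Rightarrow> 'e set \<Rightarrow> bool" where
  "cycle_edges G C \<longleftrightarrow> (\<exists>vs es. es \<noteq> [] \<and> length vs = length es \<and> distinct vs \<and> distinct es \<and>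
     set es = C \<and> C \<subseteq> edges G \<and>
     (\<forall>i < length es. ends G (es ! i) = {vs ! i, vs ! (Suc i mod length es)}))"

definition cycle_matroid :: "('v, 'e) pre_multigraph \<Rightarrow> 'e pre_matroid" where
  "cycle_matroid G = \<lparr> ground = edges G,
                       indeps = {I. I \<subseteq> edges G \<and> (\<nexists>C. cycle_edges G C \<and> C \<subseteq> I)} \<rparr>"

text \<open>A finite graph can be relabelled to have natural numbers as vertices and edges, so fixing
  these types loses no generality.\<close>

definition graphic :: "'a pre_matroid \<Rightarrow> bool" where
  "graphic M \<longleftrightarrow> (\<exists>G :: (nat, nat) pre_multigraph. multigraph G \<and> isomorphic M (cycle_matroid G))"

definition cographic :: "'a pre_matroid \<Rightarrow> bool" where
  "cographic M \<longleftrightarrow> graphic (dual M)"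

section \<open>Colourings and rainbow circuits\<close>

definition colouring :: "'a pre_matroid \<Rightarrow> nat \<Rightarrow> ('a \<Rightarrow> nat) \<Rightarrow> bool" where
  "colouring M k c \<longleftrightarrow> c \<in> ground M \<rightarrow> {1..k}"

definition two_uniform :: "'a pre_matroid \<Rightarrow> nat \<Rightarrow> ('a \<Rightarrow> nat) \<Rightarrow> bool" where
  "two_uniform M k c \<longleftrightarrow> (\<forall>s \<in> {1..k}. card {e \<in> ground M. c e = s} = 2)"

definition rainbow_circuit :: "'a pre_matroid \<Rightarrow> ('a \<Rightarrow> nat) \<Rightarrow> 'a set \<Rightarrow> bool" where
  "rainbow_circuit M c C \<longleftrightarrow> circuit M C \<and> inj_on c C"

definition short_rainbow_circuit_4_tuple ::
  "'a pre_matroid \<Rightarrow> ('a \<Rightarrow> nat) \<Rightarrow> (nat \<Rightarrow> 'a set) \<Rightarrow> bool" where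
  "short_rainbow_circuit_4_tuple M c C \<longleftrightarrow>
     (\<forall>i \<in> {1..4}. rainbow_circuit M c (C i)) \<and>
     (\<Sum>i = 1..4. card (C i)) \<le> 2 * matroid_rank M + 4 \<and>
     (\<forall>e \<in> ground M. card {i \<in> {1..4}. e \<in> C i} \<le> 2)"

end

theory Submission
  imports Defs
begin

text \<open>
  Work in the cycle space over the two-element field: a nonempty edge set all of whose degrees are
  even contains a cycle, and a set with at least as many edges as vertices contains such a set.

  Graphic case. A representing graph with as few vertices as possible is connected, so it has at
  most as many vertices as there are colours.

  Suppose some rainbow edge set has a cycle space of dimension at least two, and let \<open>S\<close> be a smallest
  one. Unless it contains two disjoint cycles, \<open>S\<close> is a theta graph; its three cycles cover it twice.
  Choosing for each colour an edge outside \<open>S\<close> gives as many edges as vertices, hence a fourth cycle.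
  If no edge of it joins two vertices of \<open>S\<close>, its length is at most twice the number of vertices
  missed by \<open>S\<close>, and the four lengths add up as required. By minimality of \<open>S\<close> at most two edges of
  the fourth cycle are chords of \<open>S\<close>, and each of them either shortens one of the three cycles by one or splits one of
  them into two rainbow cycles.

  Otherwise deleting any vertex must destroy a colour, so every vertex is the centre of a colour
  class, and the classes form a digraph with all outdegrees two in which directed cycles are
  rainbow. By a theorem of Thomassen it has two directed cycles with at most one common vertex; each
  is taken twice.

  Cographic case. Merge the vertices of the graph of the dual as long as both edges of some colour
  join the same two blocks. Then each colour class lies in at most one vertex cut, there are at
  least two more blocks than colours, and the cuts have average size less than four. Take the cuts
  of four rainbow blocks, or twice those of two nonadjacent ones.
\<close>

section \<open>Digraphs of minimum outdegree two\<close>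

text \<open>The accounting leaves no slack and shapes everything. Put \<open>m = r(M)+1\<close>, so
  that the allowed total is 2m+2. A theta graph \<open>S\<close> has one edge more than vertices and
  its three cycles have total length 2|S|. Two edges at each missed vertex bring the sum to 2|V|+2,
  already all of 2m+2 if |V| = m. Hence every chord of \<open>S\<close> in the fourth cycle must be
  paid for by an edge saved elsewhere. The obstacle is that a cycle through a chord is rainbow only
  if it avoids the other edge of that colour, so a chord may allow only one of its two shortcuts. In
  the digraph case, vertex sets with at most one common vertex carry cycles of total length at most
  |V|+1, and doubling gives 2m+2 again.

  In the cographic case the dual has rank |E| - r(M) = r(M)+2, so its connected graph has r(M)+3
  vertices, two more than there are colours. Merging preserves this surplus of two. With N blocks
  the cuts then have total size at most 4N-8, while simplicity makes each at least 3; so only N-8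
  edges are available above the minimum, however the blocks are selected.\<close>

definition out_bd :: "('v \<Rightarrow> 'v set) \<Rightarrow> 'v set \<Rightarrow> 'v set" where
  "out_bd N X = (\<Union>x\<in>X. N x) - X"

text \<open>The union of the two boundaries on the left lies in the union of those on the right, and
  likewise for the intersections.\<close>

lemma out_bd_submodular:
  assumes "finite (out_bd N X)" "finite (out_bd N Y)"
  shows "card (out_bd N (X \<inter> Y)) + card (out_bd N (X \<union> Y)) \<le> card (out_bd N X) + card (out_bd N Y)"
proof -
  let ?P = "out_bd N (X \<inter> Y)" and ?Q = "out_bd N (X \<union> Y)"
  have 1: "?P \<union> ?Q \<subseteq> out_bd N X \<union> out_bd N Y" and 2: "?P \<inter> ?Q \<subseteq> out_bd N X \<inter> out_bd N Y"
    by (auto simp: out_bd_def)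
  have fin: "finite ?P" "finite ?Q"
    using 1 assms finite_subset[of "?P \<union> ?Q"] by auto
  have "card ?P + card ?Q = card (?P \<union> ?Q) + card (?P \<inter> ?Q)"
    using fin by (rule card_Un_Int)
  also have "\<dots> \<le> card (out_bd N X \<union> out_bd N Y) + card (out_bd N X \<inter> out_bd N Y)"
    using 1 2 assms by (intro add_mono card_mono) auto
  also have "\<dots> = card (out_bd N X) + card (out_bd N Y)"
    using card_Un_Int[OF assms] by simp
  finally show ?thesis .
qed

text \<open>This is Menger's theorem for two paths from \<open>y\<close> back to \<open>y\<close>, with sets in which every vertex has
  an out-neighbour in place of paths. Delete arcs as long as the cut condition survives; by
  submodularity every vertex that is neither \<open>y\<close> nor an in-neighbour of \<open>y\<close> is left with at most one
  out-neighbour, so that the paths are determined by their starting points.\<close>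

lemma two_closed_sets_meeting_in_point:
  fixes N :: "'v \<Rightarrow> 'v set"
  assumes fin: "finite W" and N: "\<And>x. x \<in> W \<Longrightarrow> N x \<subseteq> W" and y: "y \<in> W" "y \<notin> N y"
    and cut: "\<And>X. y \<in> X \<Longrightarrow> X \<subseteq> W \<Longrightarrow> (\<forall>x\<in>X. y \<notin> N x) \<Longrightarrow> 2 \<le> card (out_bd N X)"
  shows "\<exists>K1 K2. K1 \<subseteq> W \<and> K2 \<subseteq> W \<and> K1 \<inter> K2 = {y} \<and>
    (\<forall>x\<in>K1. N x \<inter> K1 \<noteq> {}) \<and> (\<forall>x\<in>K2. N x \<inter> K2 \<noteq> {})"
proof -
  \<comment> \<open>A path back to \<open>y\<close> may stop as soon as it reaches the set
    \<open>T\<close> of in-neighbours of \<open>y\<close>.\<close>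
  define T where "T = {x\<in>W. y \<in> N x}"
  define P where "P = (\<lambda>N'. (\<forall>x. N' x \<subseteq> N x) \<and>
    (\<forall>X. y \<in> X \<longrightarrow> X \<subseteq> W - T \<longrightarrow> 2 \<le> card (out_bd N' X)))"
  have "P N" unfolding P_def
  proof (intro conjI allI impI)
    fix X assume X: "y \<in> X" "X \<subseteq> W - T"
    show "2 \<le> card (out_bd N X)" by (rule cut) (use X in \<open>auto simp: T_def\<close>)
  qed simp
  then obtain N' where PN': "P N'" and min: "\<And>N''. P N'' \<Longrightarrow> (\<Sum>x\<in>W. card (N' x)) \<le> (\<Sum>x\<in>W. card (N'' x))"
    using ex_has_least_nat[of P N "\<lambda>N'. \<Sum>x\<in>W. card (N' x)"] by blast
  have N'N: "N' x \<subseteq> N x" for x using PN' by (auto simp: P_def)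
  have cut': "2 \<le> card (out_bd N' X)" if "y \<in> X" "X \<subseteq> W - T" for X using PN' that by (auto simp: P_def)
  have finN: "finite (N' x)" if "x \<in> W" for x
    using N[OF that] N'N[of x] fin by (meson finite_subset)
  have finbd: "finite (out_bd N' X)" if "X \<subseteq> W" for X
    using that finN fin finite_subset[OF that fin] by (auto simp: out_bd_def)
  \<comment> \<open>By minimality each remaining arc from \<open>x\<close> to \<open>u\<close> is
    critical for some \<open>X\<close> with exactly two boundary vertices, one of them
    \<open>u\<close>, which is reached from \<open>X\<close> only through \<open>x\<close>.\<close>
  have tight: "\<exists>X. y \<in> X \<and> x \<in> X \<and> X \<subseteq> W - T \<and> u \<notin> X \<and> card (out_bd N' X) = 2 \<and> (\<forall>x'\<in>X - {x}. u \<notin> N' x')"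
    if x: "x \<in> W" and u: "u \<in> N' x" for x u
  proof -
    define N'' where "N'' = N'(x := N' x - {u})"
    have "(\<Sum>x\<in>W. card (N'' x)) < (\<Sum>x\<in>W. card (N' x))"
    proof (rule sum_strict_mono_ex1[OF fin])
      show "\<forall>z\<in>W. card (N'' z) \<le> card (N' z)" using finN by (auto simp: N''_def card_Diff1_le)
      show "\<exists>z\<in>W. card (N'' z) < card (N' z)"
        using x u finN[OF x] by (intro bexI[of _ x]) (auto simp: N''_def intro: card_Diff1_less simp del: card_Diff_insert)
    qed
    then have "\<not> P N''" using min[of N''] by linarith
    moreover have "N'' z \<subseteq> N z" for z using N'N[of z] by (auto simp: N''_def)
    ultimately obtain X where X: "y \<in> X" "X \<subseteq> W - T" "\<not> 2 \<le> card (out_bd N'' X)" by (auto simp: P_def)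
    have sub: "out_bd N'' X \<subseteq> out_bd N' X" by (auto simp: out_bd_def N''_def split: if_splits)
    have sup: "out_bd N' X \<subseteq> insert u (out_bd N'' X)" by (auto simp: out_bd_def N''_def)
    have ge: "2 \<le> card (out_bd N' X)" using cut' X by blast
    have fX: "finite (out_bd N' X)" using finbd X by blast
    have fX'': "finite (out_bd N'' X)" using sub fX finite_subset by blast
    have uX: "u \<in> out_bd N' X" "u \<notin> out_bd N'' X"
    proof -
      have ne: "out_bd N' X \<noteq> out_bd N'' X" using X(3) ge by auto
      then show "u \<in> out_bd N' X" "u \<notin> out_bd N'' X" using sub sup by auto
    qed
    have "card (out_bd N' X) \<le> Suc (card (out_bd N'' X))"
      using card_mono[OF _ sup] fX'' uX by simp
    then have c2: "card (out_bd N' X) = 2" using ge X(3) by linarith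
    have "x \<in> X"
    proof (rule ccontr)
      assume "x \<notin> X" then have "out_bd N'' X = out_bd N' X" by (auto simp: out_bd_def N''_def)
      then show False using uX by simp
    qed
    moreover have "\<forall>x'\<in>X - {x}. u \<notin> N' x'" using uX by (auto simp: out_bd_def N''_def)
    ultimately show ?thesis using X c2 uX by (auto simp: out_bd_def)
  qed
  \<comment> \<open>By submodularity the critical sets of two arcs at \<open>x\<close> intersect in
    a set whose boundary is just \<open>{u1, u2}\<close>. Only \<open>x\<close> reaches these two,
    so removing \<open>x\<close> leaves a boundary inside \<open>{x}\<close>, against the cut
    condition.\<close>
  have single: "u1 = u2" if x: "x \<in> W" "x \<noteq> y" and u: "u1 \<in> N' x" "u2 \<in> N' x" for x u1 u2
  proof (rule ccontr)
    assume ne: "u1 \<noteq> u2"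
    obtain X1 where X1: "y \<in> X1" "x \<in> X1" "X1 \<subseteq> W - T" "u1 \<notin> X1" "card (out_bd N' X1) = 2" "\<forall>x'\<in>X1 - {x}. u1 \<notin> N' x'"
      using tight[OF x(1) u(1)] by blast
    obtain X2 where X2: "y \<in> X2" "x \<in> X2" "X2 \<subseteq> W - T" "u2 \<notin> X2" "card (out_bd N' X2) = 2" "\<forall>x'\<in>X2 - {x}. u2 \<notin> N' x'"
      using tight[OF x(1) u(2)] by blast
    let ?X = "X1 \<inter> X2"
    have fb: "finite (out_bd N' X1)" "finite (out_bd N' X2)" "finite (out_bd N' ?X)"
      using X1(3) X2(3) by (auto intro!: finbd)
    have "2 \<le> card (out_bd N' (X1 \<union> X2))" using cut'[of "X1 \<union> X2"] X1(1,3) X2(3) by auto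
    then have le: "card (out_bd N' ?X) \<le> 2"
      using out_bd_submodular[OF fb(1,2)] X1(5) X2(5) by linarith
    have sub: "{u1, u2} \<subseteq> out_bd N' ?X" using X1 X2 u by (auto simp: out_bd_def)
    have eq: "out_bd N' ?X = {u1, u2}"
      using card_seteq[OF fb(3) sub] le ne by auto
    have "out_bd N' (?X - {x}) \<subseteq> {x}"
    proof
      fix v assume v: "v \<in> out_bd N' (?X - {x})"
      then obtain x' where x': "x' \<in> ?X - {x}" "v \<in> N' x'" by (auto simp: out_bd_def)
      have "v \<noteq> u1" "v \<noteq> u2" using x' X1(6) X2(6) by auto
      then have "v \<notin> out_bd N' ?X" using eq by auto
      then have "v \<in> ?X" using x' by (auto simp: out_bd_def)
      then show "v \<in> {x}" using v by (auto simp: out_bd_def)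
    qed
    then have "card (out_bd N' (?X - {x})) \<le> 1" using card_mono[of "{x}"] by fastforce
    moreover have "2 \<le> card (out_bd N' (?X - {x}))" using cut'[of "?X - {x}"] X1(1,3) X2(1) x(2) by auto
    ultimately show False by linarith
  qed
  \<comment> \<open>The remaining arcs form a functional graph. \<open>B t\<close> is the set of
    vertices whose unique walk ends at \<open>t\<close>, and these basins are pairwise
    disjoint.\<close>
  define r where "r = {(x, x'). x \<in> W - T \<and> x \<noteq> y \<and> x' \<in> N' x}"
  have sv: "single_valued r" using single by (auto simp: single_valued_def r_def)
  define B where "B t = {x. (x, t) \<in> r\<^sup>*}" for t
  define F where "F = (\<Union>t\<in>T. B t)"
  have T_end: "t' = t" if "t' \<in> T" "(t', t) \<in> r\<^sup>*" for t t'
    using that by (auto elim: converse_rtranclE simp: r_def)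
  have disj: "t = t'" if "t \<in> T" "t' \<in> T" "x \<in> B t" "x \<in> B t'" for t t' x
    using that single_valued_confluent[OF sv] T_end unfolding B_def by blast
  have yF: "y \<notin> F"
    using y by (auto simp: F_def B_def T_def r_def elim: converse_rtranclE)
  have BW: "B t \<subseteq> W" if "t \<in> T" for t
    using that by (auto simp: B_def r_def T_def elim: converse_rtranclE)
  have TF: "T \<subseteq> F" by (auto simp: F_def B_def)
  have step: "\<exists>x'\<in>B t. x' \<in> N' x" "x \<notin> T" "x \<noteq> y" "N' x \<subseteq> B t" if "x \<in> B t" "x \<noteq> t" for x t
  proof -
    obtain x' where x': "(x, x') \<in> r" "(x', t) \<in> r\<^sup>*" using \<open>x \<in> B t\<close> \<open>x \<noteq> t\<close> by (auto simp: B_def elim: converse_rtranclE)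
    then show "\<exists>x'\<in>B t. x' \<in> N' x" "x \<notin> T" "x \<noteq> y" by (auto simp: B_def r_def)
    then show "N' x \<subseteq> B t" using x' single[of x] by (auto simp: r_def B_def)
  qed
  have outF: "N' x \<inter> F = {}" if "x \<in> W - F" "x \<noteq> y" for x
  proof (rule ccontr)
    assume "N' x \<inter> F \<noteq> {}"
    then obtain x' t where "x' \<in> N' x" "t \<in> T" "(x', t) \<in> r\<^sup>*" by (auto simp: F_def B_def)
    moreover have "x \<notin> T" using that TF by auto
    ultimately have "(x, t) \<in> r\<^sup>*" using that by (auto simp: r_def intro: converse_rtrancl_into_rtrancl)
    then show False using that \<open>t \<in> T\<close> by (auto simp: F_def B_def)
  qed
  have N'W: "N' x \<subseteq> W" if "x \<in> W" for x using N[OF that] N'N[of x] by blast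
  \<comment> \<open>If no arc of \<open>y\<close> entered a basin, the complement of all basins
    would have empty boundary.\<close>
  have "\<exists>a\<in>N' y. \<exists>t\<in>T. a \<in> B t"
  proof (rule ccontr)
    assume no: "\<not> ?thesis"
    have "N' x \<subseteq> W - F" if x: "x \<in> W - F" for x
    proof (cases "x = y")
      case True then show ?thesis using no N'W[of x] x by (auto simp: F_def)
    next
      case False then show ?thesis using outF[OF x] N'W[of x] x by auto
    qed
    then have "out_bd N' (W - F) = {}" unfolding out_bd_def by blast
    then show False using cut'[of "W - F"] y yF TF by auto
  qed
  then obtain a t where a: "a \<in> N' y" "t \<in> T" "a \<in> B t" by blast
  have "\<exists>b\<in>N' y. \<exists>t'\<in>T. b \<in> B t' \<and> t' \<noteq> t"
  proof (rule ccontr)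
    assume no: "\<not> ?thesis"
    \<comment> \<open>If the arcs of \<open>y\<close> entered only the basin of \<open>t\<close>,
      then \<open>t\<close> alone would separate this set from \<open>T\<close>.\<close>
    let ?X = "(W - F) \<union> (B t - {t})"
    have "out_bd N' ?X \<subseteq> {t}"
    proof
      fix v assume v: "v \<in> out_bd N' ?X"
      then obtain x where x: "x \<in> ?X" "v \<in> N' x" "v \<notin> ?X" by (auto simp: out_bd_def)
      show "v \<in> {t}"
      proof (cases "x \<in> B t - {t}")
        case True then show ?thesis using step(4)[of x t] x by auto
      next
        case False
        then have xF: "x \<in> W - F" using x by auto
        show ?thesis
        proof (cases "x = y")
          case True
          have "v \<in> W" using N'W x xF by blast
          then have "v \<in> F" using x by auto
          then show ?thesis using no x True by (auto simp: F_def)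
        next
          case False then show ?thesis using outF[OF xF] N'W xF x by blast
        qed
      qed
    qed
    then have "card (out_bd N' ?X) \<le> 1" using card_mono[of "{t}"] by fastforce
    moreover have "?X \<subseteq> W - T" using BW[OF a(2)] TF step(2) by auto
    moreover have "y \<in> ?X" using y yF by auto
    ultimately show False using cut'[of ?X] by linarith
  qed
  then obtain b t' where b: "b \<in> N' y" "t' \<in> T" "b \<in> B t'" "t' \<noteq> t" by blast
  have good: "\<forall>x\<in>insert y (B t). N x \<inter> insert y (B t) \<noteq> {}" if "t \<in> T" "a \<in> N' y" "a \<in> B t" for t a
  proof
    fix x assume "x \<in> insert y (B t)"
    then consider "x = y" | "x = t" | "x \<in> B t" "x \<noteq> t" by auto
    then show "N x \<inter> insert y (B t) \<noteq> {}"
    proof cases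
      case 1 then show ?thesis using that N'N[of y] by auto
    next
      case 2 then show ?thesis using that by (auto simp: T_def)
    next
      case 3 then show ?thesis using step(1)[of x t] N'N[of x] by auto
    qed
  qed
  have "insert y (B t) \<inter> insert y (B t') = {y}" using disj a b by blast
  then show ?thesis
    using good[OF a(2,1,3)] good[OF b(2,1,3)] BW[OF a(2)] BW[OF b(2)] y by (intro exI[of _ "insert y (B t)"] exI[of _ "insert y (B t')"]) auto
qed

text \<open>Thomassen's theorem on directed cycles meeting in at most one vertex. If the previous lemma does
  not apply, some vertex \<open>s\<close> separates some \<open>z\<close> from itself. For a smallest region \<open>W\<close> reached from \<open>z\<close>
  before \<open>s\<close>, redirect to \<open>z\<close> the arcs from \<open>W\<close> to \<open>s\<close>: an out-neighbour \<open>y \<noteq> s\<close> of \<open>z\<close> is not separated from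
  itself in the resulting digraph, and at most one of the two sets found there contains \<open>z\<close> and has
  to be extended by a path from \<open>s\<close> to \<open>z\<close> outside \<open>W\<close>.\<close>

lemma almost_disjoint_closed_sets:
  fixes N :: "'v \<Rightarrow> 'v set"
  assumes fin: "finite V" and ne: "V \<noteq> {}" and N: "\<And>x. x \<in> V \<Longrightarrow> N x \<subseteq> V - {x}"
    and two: "\<And>x. x \<in> V \<Longrightarrow> 2 \<le> card (N x)"
  shows "\<exists>K1 K2. K1 \<subseteq> V \<and> K2 \<subseteq> V \<and> K1 \<noteq> {} \<and> K2 \<noteq> {} \<and> card (K1 \<inter> K2) \<le> 1 \<and>
    (\<forall>x\<in>K1. N x \<inter> K1 \<noteq> {}) \<and> (\<forall>x\<in>K2. N x \<inter> K2 \<noteq> {})"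
proof -
  \<comment> \<open>A smallest nonempty set closed under out-neighbours is strongly connected;
    \<open>closedD\<close> is the form in which this is used.\<close>
  define cl where "cl = (\<lambda>U. U \<subseteq> V \<and> U \<noteq> {} \<and> (\<forall>x\<in>U. N x \<subseteq> U))"
  have "cl V" using ne N by (auto simp: cl_def)
  then obtain U where U: "cl U" and Umin: "\<And>U'. cl U' \<Longrightarrow> card U \<le> card U'"
    using ex_has_least_nat[of cl V card] by blast
  have UV: "U \<subseteq> V" and Une: "U \<noteq> {}" and UN: "\<And>x. x \<in> U \<Longrightarrow> N x \<subseteq> U" using U by (auto simp: cl_def)
  have finU: "finite U" using UV fin finite_subset by blast
  have closedD: "X = U" if "X \<subseteq> U" "X \<noteq> {}" "\<forall>x\<in>X. N x \<subseteq> X" for X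
    using Umin[of X] that UV card_seteq[OF finU that(1)] by (auto simp: cl_def)
  have noloop: "x \<notin> N x" if "x \<in> U" for x using N UV that by blast
  have two': "\<exists>u\<in>N x. u \<noteq> a" if "x \<in> U" for x a
  proof (rule ccontr)
    assume "\<not> ?thesis" then have "N x \<subseteq> {a}" by auto
    then have "card (N x) \<le> 1" using card_mono[of "{a}"] by fastforce
    then show False using two[of x] that UV by force
  qed
  \<comment> \<open>This says that \<open>s\<close> separates \<open>y\<close> from itself: from
    \<open>y\<close> one stays in \<open>W\<close> until reaching \<open>s\<close>, and no arc from
    \<open>W\<close> returns to \<open>y\<close>.\<close>
  define Obs where "Obs y s W \<longleftrightarrow> y \<in> W \<and> W \<subseteq> U \<and> s \<in> U - W \<and> (\<forall>x\<in>W. N x \<subseteq> insert s W - {y})" for y s W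
  show ?thesis
  proof (cases "\<exists>y s W. Obs y s W")
    case False
    obtain y where y: "y \<in> U" using Une by blast
    have cut: "2 \<le> card (out_bd N X)" if X: "y \<in> X" "X \<subseteq> U" "\<forall>x\<in>X. y \<notin> N x" for X
    proof (rule ccontr)
      assume "\<not> ?thesis"
      moreover have "finite (out_bd N X)" using UN X(2) by (intro finite_subset[OF _ finU]) (auto simp: out_bd_def)
      ultimately consider "out_bd N X = {}" | s where "out_bd N X = {s}"
        by (metis One_nat_def card_1_singletonE card_0_eq less_2_cases not_le)
      then show False
      proof cases
        case 1
        then have "X = U" using X by (intro closedD) (auto simp: out_bd_def)
        then have sub: "\<forall>x\<in>U - {y}. N x \<subseteq> U - {y}" using X UN by auto
        have "U - {y} \<noteq> {}" using two'[OF y, of y] UN[OF y] by auto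
        then have "U - {y} = U" using sub by (intro closedD) auto
        then show False using y by auto
      next
        case 2
        then have "s \<in> U" using UN X(2) by (auto simp: out_bd_def)
        then have "Obs y s X" using 2 X by (auto simp: Obs_def out_bd_def)
        then show False using False by blast
      qed
    qed
    obtain K1 K2 where K: "K1 \<subseteq> U" "K2 \<subseteq> U" "K1 \<inter> K2 = {y}" "\<forall>x\<in>K1. N x \<inter> K1 \<noteq> {}" "\<forall>x\<in>K2. N x \<inter> K2 \<noteq> {}"
      using two_closed_sets_meeting_in_point[OF finU UN y noloop[OF y] cut] by blast
    then have "K1 \<noteq> {}" "K2 \<noteq> {}" by auto
    then show ?thesis using K UV by (intro exI[of _ K1] exI[of _ K2]) auto
  next
    case True
    define P where "P W \<longleftrightarrow> (\<exists>y s. Obs y s W)" for W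
    have "\<exists>W. P W" using True by (auto simp: P_def)
    then obtain W where W: "P W" "\<And>X. P X \<Longrightarrow> card W \<le> card X"
      using ex_has_least_nat[of P _ card] by blast
    obtain z s where zsW: "Obs z s W" using W(1) by (auto simp: P_def)
    have Wmin: "card W \<le> card X" if "Obs y' s' X" for y' s' X
      using W(2)[of X] that by (auto simp: P_def)
    have z: "z \<in> W" "W \<subseteq> U" "s \<in> U" "s \<notin> W" and WN: "\<And>x. x \<in> W \<Longrightarrow> N x \<subseteq> insert s W - {z}" 
      using zsW by (auto simp: Obs_def)
    have finW: "finite W" using z finU finite_subset by blast
    obtain y where y: "y \<in> N z" "y \<noteq> s" using two'[of z s] z by auto
    then have yW: "y \<in> W" "y \<noteq> z" using WN[OF z(1)] by auto
    define N1 where "N1 x = (if s \<in> N x then insert z (N x - {s}) else N x)" for x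
    have N1W: "N1 x \<subseteq> W" if "x \<in> W" for x using WN[OF that] z by (auto simp: N1_def)
    have yN1: "y \<in> N1 x \<longleftrightarrow> y \<in> N x" for x using y yW by (auto simp: N1_def)
    have yy: "y \<notin> N1 y" using noloop[of y] yW z yN1 by blast
    have smaller: "\<not> Obs y s' X" if "X \<subseteq> W" "z \<notin> X" for s' X
    proof
      assume "Obs y s' X"
      then have "card W \<le> card X" by (rule Wmin)
      then have "X = W" using card_seteq[OF finW that(1)] by simp
      then show False using that z by auto
    qed
    have cut: "2 \<le> card (out_bd N1 X)" if X: "y \<in> X" "X \<subseteq> W" "\<forall>x\<in>X. y \<notin> N1 x" for X
    proof (rule ccontr)
      assume "\<not> ?thesis"
      moreover have "finite (out_bd N1 X)" using N1W X(2) by (intro finite_subset[OF _ finW]) (auto simp: out_bd_def)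
      ultimately consider "out_bd N1 X = {}" | s1 where "out_bd N1 X = {s1}"
        by (metis One_nat_def card_1_singletonE card_0_eq less_2_cases not_le)
      \<comment> \<open>The arc from \<open>z\<close> to \<open>y\<close> survives the redirection,
        so \<open>z\<close> cannot lie in a set without arcs to \<open>y\<close>.\<close>
      moreover have zX: "z \<notin> X" using X y yN1 by auto
      ultimately show False
      proof cases
        case 1
        have "N x \<subseteq> X" if "x \<in> X" for x
        proof -
          have "N1 x \<subseteq> X" using 1 that by (auto simp: out_bd_def)
          then show ?thesis using zX by (auto simp: N1_def split: if_splits)
        qed
        then have "X = U" using X z by (intro closedD) auto
        then show False using zX z by auto
      next
        case (2 s1)
        have sub: "N1 x \<subseteq> insert s1 X" if "x \<in> X" for x using 2 that by (auto simp: out_bd_def)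
        have s1: "s1 \<in> W" "s1 \<notin> X" using 2 N1W X(2) by (auto simp: out_bd_def)
        show False
        proof (cases "s1 = z")
          \<comment> \<open>No original arc from \<open>W\<close> enters \<open>z\<close>; whatever
            leaves \<open>X\<close> for \<open>z\<close> here was redirected and really goes to
            \<open>s\<close>.\<close>
          case True
          have "N x \<subseteq> insert s X - {y}" if x: "x \<in> X" for x
          proof -
            have "z \<notin> N x" "y \<notin> N x" using WN[of x] X x yN1 by auto
            then show ?thesis using sub[OF x] True by (auto simp: N1_def split: if_splits)
          qed
          then have "Obs y s X" using X z s1 by (auto simp: Obs_def)
          then show False using smaller[OF X(2) zX] by blast
        next
          case False
          have "N x \<subseteq> insert s1 X - {y}" if "x \<in> X" for x
            using sub[OF that] X that False yN1 zX by (auto simp: N1_def split: if_splits)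
          then have "Obs y s1 X" using X z s1 by (auto simp: Obs_def)
          then show False using smaller[OF X(2) zX] by blast
        qed
      qed
    qed
    obtain K1 K2 where K: "K1 \<subseteq> W" "K2 \<subseteq> W" "K1 \<inter> K2 = {y}" "\<forall>x\<in>K1. N1 x \<inter> K1 \<noteq> {}" "\<forall>x\<in>K2. N1 x \<inter> K2 \<noteq> {}"
      using two_closed_sets_meeting_in_point[OF finW N1W yW(1) yy cut] by blast
    define r where "r = {(q, q'). q \<in> U - W \<and> q' \<in> N q}"
    define Q where "Q = {q \<in> U - W. (q, z) \<in> r\<^sup>*}"
    have Qstep: "N q \<inter> insert z Q \<noteq> {}" if "q \<in> Q" for q
    proof -
      have "q \<noteq> z" "(q, z) \<in> r\<^sup>*" using that z by (auto simp: Q_def)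
      then obtain q' where q': "(q, q') \<in> r" "(q', z) \<in> r\<^sup>*" by (auto elim: converse_rtranclE)
      have "q' = z \<or> q' \<in> U - W" using q'(2) by (auto elim: converse_rtranclE simp: r_def)
      then show ?thesis using q' by (auto simp: Q_def r_def)
    qed
    have Qin: "x \<in> Q" if "x \<in> U - W" "u \<in> N x" "u = z \<or> u \<in> Q" for x u
      using that by (auto simp: Q_def r_def intro: converse_rtrancl_into_rtrancl)
    have sQ: "s \<in> Q"
    proof (rule ccontr)
      assume nsQ: "s \<notin> Q"
      \<comment> \<open>If \<open>s\<close> could not reach \<open>z\<close> outside
        \<open>W\<close>, this set would be closed: arcs leaving \<open>W\<close> end in
        \<open>s\<close>, and a vertex outside \<open>W\<close> with an arc to \<open>Q\<close> or
        \<open>z\<close> would itself belong to \<open>Q\<close>.\<close>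
      let ?C = "U - Q - {z}"
      have "N x \<subseteq> ?C" if x: "x \<in> ?C" for x
      proof (cases "x \<in> W")
        case True then show ?thesis using WN[OF True] nsQ z by (auto simp: Q_def)
      next
        case False
        then show ?thesis using Qin[of x] x UN[of x] by blast
      qed
      moreover have "s \<in> ?C" using nsQ z by auto
      ultimately have "?C = U" by (intro closedD) auto
      then show False using z by auto
    qed
    define L where "L K = (if z \<in> K then K \<union> Q else K)" for K
    have L: "\<forall>x\<in>L K. N x \<inter> L K \<noteq> {}" if K: "K \<subseteq> W" "\<forall>x\<in>K. N1 x \<inter> K \<noteq> {}" for K
    proof
      fix x assume x: "x \<in> L K"
      show "N x \<inter> L K \<noteq> {}"
      proof (cases "x \<in> K")
        case True
        then obtain u where u: "u \<in> N1 x" "u \<in> K" using K by blast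
        show ?thesis using u sQ K z by (auto simp: N1_def L_def split: if_splits)
      next
        case False
        then have "z \<in> K" "x \<in> Q" using x by (auto simp: L_def split: if_splits)
        then show ?thesis using Qstep[of x] by (auto simp: L_def)
      qed
    qed
    \<comment> \<open>Since \<open>y\<close> differs from \<open>z\<close>, at most one of the two
      sets contains \<open>z\<close> and receives \<open>Q\<close>, which is disjoint from
      \<open>W\<close>.\<close>
    have "L K1 \<inter> L K2 = {y}" using K yW by (auto simp: L_def Q_def)
    moreover have "L K1 \<subseteq> V" "L K2 \<subseteq> V" using K z UV by (auto simp: L_def Q_def)
    moreover have "y \<in> L K1" "y \<in> L K2" using K by (auto simp: L_def)
    ultimately show ?thesis using L[OF K(1,4)] L[OF K(2,5)]
      by (intro exI[of _ "L K1"] exI[of _ "L K2"]) auto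
  qed
qed

section \<open>Even edge sets\<close>

text \<open>A loop lies in no cut, so a single loop is an even set, in accordance with its being a
  cycle. No edge set is fixed here; uses intersect with one.\<close>

definition cut :: "('e \<Rightarrow> 'v set) \<Rightarrow> 'v set \<Rightarrow> 'e set" where
  "cut en X = {e. en e \<inter> X \<noteq> {} \<and> \<not> en e \<subseteq> X}"

definition even_set :: "('e \<Rightarrow> 'v set) \<Rightarrow> 'e set \<Rightarrow> bool" where
  "even_set en T \<longleftrightarrow> finite T \<and> (\<forall>v. even (card (T \<inter> cut en {v})))"

definition is_edge :: "'v set \<Rightarrow> bool" where
  "is_edge p \<longleftrightarrow> (\<exists>a b. p = {a, b})"

lemma even_card_sym_diff:
  assumes "finite A" "finite B"
  shows "even (card (sym_diff A B)) \<longleftrightarrow> (even (card A) \<longleftrightarrow> even (card B))"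
proof -
  have "card A = card (A - B) + card (A \<inter> B)" "card B = card (B - A) + card (A \<inter> B)"
    using assms by (metis card_Int_Diff add.commute Int_commute)+
  moreover have "card (sym_diff A B) = card (A - B) + card (B - A)"
    using assms by (intro card_Un_disjoint) auto
  ultimately show ?thesis by auto
qed

lemma even_set_sym_diff:
  assumes "even_set en A" "even_set en B"
  shows "even_set en (sym_diff A B)"
proof -
  have "sym_diff A B \<inter> C = sym_diff (A \<inter> C) (B \<inter> C)" for C by auto
  then show ?thesis using assms by (auto simp: even_set_def even_card_sym_diff)
qed

lemma cut_insert_iff:
  assumes "is_edge (en e)" "v \<notin> X"
  shows "e \<in> cut en (insert v X) \<longleftrightarrow> (e \<in> cut en X \<longleftrightarrow> e \<notin> cut en {v})"
  using assms by (auto simp: is_edge_def cut_def)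

text \<open>Modulo two the cut of \<open>X\<close> is the sum of the stars of its vertices, since an
  edge inside \<open>X\<close> cancels.\<close>

lemma odd_cut_parity:
  assumes "finite T" "finite X" "\<And>e. e \<in> T \<Longrightarrow> is_edge (en e)"
  shows "even (card (T \<inter> cut en X)) \<longleftrightarrow> even (card {v\<in>X. odd (card (T \<inter> cut en {v}))})"
  using assms(2)
proof (induction X)
  case empty
  then show ?case by (simp add: cut_def)
next
  case (insert v X)
  have "T \<inter> cut en (insert v X) = sym_diff (T \<inter> cut en X) (T \<inter> cut en {v})"
    using cut_insert_iff[where en=en, of _ v X] assms(3) insert(2) by auto
  then have 1: "even (card (T \<inter> cut en (insert v X))) \<longleftrightarrow>
      (even (card (T \<inter> cut en X)) \<longleftrightarrow> even (card (T \<inter> cut en {v})))"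
    using assms(1) by (simp add: even_card_sym_diff)
  have 2: "{u\<in>insert v X. odd (card (T \<inter> cut en {u}))} =
      (if odd (card (T \<inter> cut en {v})) then insert v {u\<in>X. odd (card (T \<inter> cut en {u}))}
       else {u\<in>X. odd (card (T \<inter> cut en {u}))})" by auto
  show ?case unfolding 1 2 using insert by auto
qed

lemma even_set_cut:
  assumes "even_set en T" "finite X" "\<And>e. e \<in> T \<Longrightarrow> is_edge (en e)"
  shows "even (card (T \<inter> cut en X))"
  using odd_cut_parity[of T X en] assms by (auto simp: even_set_def)

text \<open>Dimension counting by pigeonhole: there are more subsets of \<open>S\<close> than parity
  patterns on \<open>W - {w}\<close>, and two subsets with the same pattern have a symmetric
  difference that is even off \<open>w\<close>. The parity at the omitted vertex \<open>w\<close> is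
  then forced, because no edge leaves \<open>W\<close>.\<close>

lemma even_subset_exists:
  assumes fin: "finite S" "finite W" and ends: "\<And>e. e \<in> S \<Longrightarrow> is_edge (en e) \<and> en e \<subseteq> W"
    and card: "card W \<le> card S" "S \<noteq> {}"
  shows "\<exists>T\<subseteq>S. T \<noteq> {} \<and> even_set en T"
proof -
  obtain w where w: "w \<in> W" using ends card(2) by (fastforce simp: is_edge_def)
  define f where "f T = {v\<in>W - {w}. odd (card (T \<inter> cut en {v}))}" for T
  have "\<not> inj_on f (Pow S)"
  proof
    assume "inj_on f (Pow S)"
    then have "card (Pow S) \<le> card (Pow (W - {w}))"
      using fin by (intro card_inj_on_le) (auto simp: f_def)
    then have "card S \<le> card (W - {w})" using fin by (simp add: card_Pow)
    then show False using w fin card card_Diff1_less[OF fin(2) w] by linarith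
  qed
  then obtain A B where AB: "A \<subseteq> S" "B \<subseteq> S" "A \<noteq> B" "f A = f B" by (auto simp: inj_on_def)
  define T where "T = sym_diff A B"
  have T: "T \<subseteq> S" "T \<noteq> {}" using AB by (auto simp: T_def)
  have finT: "finite T" "finite A" "finite B" using T AB fin finite_subset by blast+
  have off: "even (card (T \<inter> cut en {v}))" if "v \<noteq> w" for v
  proof (cases "v \<in> W")
    case True
    have "T \<inter> cut en {v} = sym_diff (A \<inter> cut en {v}) (B \<inter> cut en {v})" by (auto simp: T_def)
    moreover have "odd (card (A \<inter> cut en {v})) \<longleftrightarrow> odd (card (B \<inter> cut en {v}))"
      using AB(4) True that by (auto simp: f_def set_eq_iff)
    ultimately show ?thesis using finT by (simp add: even_card_sym_diff)
  next
    case False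
    then have "T \<inter> cut en {v} = {}" using ends T by (auto simp: cut_def)
    then show ?thesis by simp
  qed
  have "T \<inter> cut en W = {}" using ends T by (auto simp: cut_def)
  then have ev: "even (card {v\<in>W. odd (card (T \<inter> cut en {v}))})"
    using odd_cut_parity[of T W en] finT fin ends T by auto
  have "even (card (T \<inter> cut en {w}))"
  proof (rule ccontr)
    assume "odd (card (T \<inter> cut en {w}))"
    then have "{v\<in>W. odd (card (T \<inter> cut en {v}))} = {w}" using off w by auto
    then show False using ev by simp
  qed
  then have "even (card (T \<inter> cut en {v}))" for v using off by (cases "v = w") auto
  then have "even_set en T" using finT by (auto simp: even_set_def)
  then show ?thesis using T by blast
qed

text \<open>Two distinct nonzero vectors over the two-element field are independent, so this is a
  cycle space of dimension at least two.\<close>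

definition bicyclic :: "('e \<Rightarrow> 'v set) \<Rightarrow> 'e set \<Rightarrow> bool" where
  "bicyclic en S \<longleftrightarrow> (\<exists>X Y. X \<subseteq> S \<and> Y \<subseteq> S \<and> X \<noteq> {} \<and> Y \<noteq> {} \<and> X \<noteq> Y \<and> even_set en X \<and> even_set en Y)"

text \<open>One edge of a first even set can be spared; the rest still contains an even set, which
  differs because it misses that edge.\<close>

lemma bicyclic_if_many_edges:
  assumes fin: "finite S" "finite W" and ends: "\<And>e. e \<in> S \<Longrightarrow> is_edge (en e) \<and> en e \<subseteq> W"
    and card: "card W < card S"
  shows "bicyclic en S"
proof -
  have "\<exists>X\<subseteq>S. X \<noteq> {} \<and> even_set en X"
    by (rule even_subset_exists[OF fin]) (use ends card in force)+
  then obtain X where X: "X \<subseteq> S" "X \<noteq> {}" "even_set en X" by blast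
  obtain e where e: "e \<in> X" using X by blast
  have "card W \<noteq> 0" using ends[of e] e X fin by (auto simp: is_edge_def)
  moreover have "card (S - {e}) = card S - 1" using e X by (simp add: subset_iff)
  ultimately have "card (S - {e}) \<noteq> 0" "card W \<le> card (S - {e})" using card by linarith+
  then have "S - {e} \<noteq> {}" "card W \<le> card (S - {e})" by (metis card.empty, simp)
  then have "\<exists>Y\<subseteq>S - {e}. Y \<noteq> {} \<and> even_set en Y"
    by (intro even_subset_exists[of _ W]) (use fin ends in auto)
  then obtain Y where Y: "Y \<subseteq> S - {e}" "Y \<noteq> {}" "even_set en Y" by blast
  then show ?thesis using X e unfolding bicyclic_def by (intro exI[of _ X] exI[of _ Y]) auto
qed

text \<open>A vertex of the cycle meets exactly the edge leaving it and the edge entering it. These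
  differ once the length is at least two; a loop meets no cut and is separated off as
  \<open>k = 1\<close>.\<close>

lemma cycle_edges_even:
  assumes "cycle_edges G C"
  shows "C \<noteq> {} \<and> even_set (ends G) C"
proof -
  obtain vs es where c: "es \<noteq> []" "length vs = length es" "distinct vs" "distinct es" "set es = C"
    "\<And>i. i < length es \<Longrightarrow> ends G (es ! i) = {vs ! i, vs ! (Suc i mod length es)}"
    using assms by (auto simp: cycle_edges_def)
  define k where "k = length es"
  have k0: "k > 0" using c(1) by (simp add: k_def)
  have "even (card (C \<inter> cut (ends G) {v}))" for v
  proof (cases "v \<in> set vs \<and> k \<noteq> 1")
    case False
    have "C \<inter> cut (ends G) {v} = {}"
    proof (rule ccontr)
      assume "C \<inter> cut (ends G) {v} \<noteq> {}"
      then obtain i where i: "i < k" "es ! i \<in> cut (ends G) {v}" using c(5) by (auto simp: in_set_conv_nth k_def)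
      then have "{vs ! i, vs ! (Suc i mod k)} \<inter> {v} \<noteq> {}" "\<not> {vs ! i, vs ! (Suc i mod k)} \<subseteq> {v}"
        using c(6)[of i] by (auto simp: cut_def k_def)
      moreover have "vs ! i \<in> set vs" "vs ! (Suc i mod k) \<in> set vs"
        using i c(2) k0 by (auto simp: k_def)
      ultimately show False using False i by auto
    qed
    then show ?thesis by simp
  next
    case True
    then obtain j where j: "j < k" "vs ! j = v" using c(2) by (auto simp: in_set_conv_nth k_def)
    have k2: "k \<ge> 2" using True k0 by linarith
    \<comment> \<open>The cyclic predecessor of \<open>j\<close>, the index of the edge entering
      \<open>v\<close>.\<close>
    define p where "p = (if j = 0 then k - 1 else j - 1)"
    have p: "p < k" "p \<noteq> j" "Suc p mod k = j" using j k2 by (auto simp: p_def)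
    have uniq: "i = p" if "i < k" "Suc i mod k = j" for i
      using that p by (metis Suc_inject mod_less mod_self not_less_less_Suc_eq Suc_leI le_neq_implies_less nat.distinct(1) less_irrefl p_def diff_Suc_1)
    have "C \<inter> cut (ends G) {v} = {es ! j, es ! p}"
    proof (intro equalityI subsetI)
      fix e assume e: "e \<in> C \<inter> cut (ends G) {v}"
      then obtain i where i: "i < k" "e = es ! i" using c(5) by (auto simp: in_set_conv_nth k_def)
      have "vs ! i = v \<or> vs ! (Suc i mod k) = v" using e i c(6)[of i] by (auto simp: cut_def k_def)
      then have "i = j \<or> Suc i mod k = j"
        using j i c(2,3) k0 nth_eq_iff_index_eq[OF c(3)] by (auto simp: k_def)
      then show "e \<in> {es ! j, es ! p}" using uniq i by auto
    next
      have ne: "vs ! i \<noteq> vs ! (Suc i mod k)" if "i < k" for i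
      proof -
        have "i \<noteq> Suc i mod k" using that k2 by (cases "Suc i = k") auto
        then show ?thesis using that c(2,3) k0 by (auto simp: nth_eq_iff_index_eq k_def)
      qed
      fix e assume "e \<in> {es ! j, es ! p}"
      then show "e \<in> C \<inter> cut (ends G) {v}"
        using c(5) c(6)[of j] c(6)[of p] j p ne[of j] ne[of p] by (auto simp: cut_def k_def)
    qed
    moreover have "es ! j \<noteq> es ! p" using j p c(4) by (auto simp: nth_eq_iff_index_eq k_def)
    ultimately show ?thesis by simp
  qed
  then show ?thesis using c by (auto simp: even_set_def)
qed

text \<open>A longest path works: even degree gives its last vertex a second edge in
  \<open>T\<close>, and maximality sends the other end back onto the path.\<close>

lemma even_set_contains_cycle_edges:
  assumes G: "multigraph G" and T: "T \<subseteq> edges G" "T \<noteq> {}" "even_set (ends G) T"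
  shows "\<exists>C\<subseteq>T. cycle_edges G C"
proof (cases "\<exists>e\<in>T. card (ends G e) = 1")
  case True
  then obtain e v where "e \<in> T" "ends G e = {v}" by (auto simp: card_1_singleton_iff)
  then have "cycle_edges G {e}" using T unfolding cycle_edges_def
    by (intro exI[of _ "[v]"] exI[of _ "[e]"]) auto
  then show ?thesis using \<open>e \<in> T\<close> by blast
next
  case False
  interpret multigraph G by (rule G)
  have two: "card (ends G e) = 2" if "e \<in> T" for e using False card_ends that T by blast
  define path where "path vs es \<longleftrightarrow> length vs = Suc (length es) \<and> distinct vs \<and> set vs \<subseteq> vertices G \<and>
    set es \<subseteq> T \<and> (\<forall>i<length es. ends G (es ! i) = {vs ! i, vs ! Suc i})" for vs es
  define P where "P k \<longleftrightarrow> (\<exists>vs es. path vs es \<and> length es = k)" for k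
  obtain e0 where e0: "e0 \<in> T" using T by blast
  obtain a b where ab: "ends G e0 = {a, b}" "a \<noteq> b" using two[OF e0] by (auto simp: card_2_iff)
  have "path [a, b] [e0]" using e0 ab ends_subset[of e0] T by (auto simp: path_def)
  then have P1: "P 1" unfolding P_def by force
  have bound: "k \<le> card (vertices G)" if Pk: "P k" for k
  proof -
    obtain vs es where "path vs es" "length es = k" using Pk by (auto simp: P_def)
    then have "card (set vs) = Suc k" "set vs \<subseteq> vertices G" by (auto simp: path_def distinct_card)
    then show ?thesis using card_mono[OF finite_vertices, of "set vs"] by simp
  qed
  define k where "k = (GREATEST k. P k)"
  have Pk: "P k" unfolding k_def by (rule GreatestI_nat[where P=P and k=1 and b="card (vertices G)"]) (use P1 bound in auto)
  have kmax: "k' \<le> k" if "P k'" for k' unfolding k_def by (rule Greatest_le_nat[where P=P and b="card (vertices G)"]) (use that bound in auto)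
  have k1: "k \<ge> 1" using kmax[OF P1] .
  obtain vs es where p: "path vs es" "length es = k" using Pk by (auto simp: P_def)
  have lv: "length vs = Suc k" "distinct vs" and es: "set es \<subseteq> T"
    and en: "\<And>i. i < k \<Longrightarrow> ends G (es ! i) = {vs ! i, vs ! Suc i}"
    using p by (auto simp: path_def)
  define u where "u = vs ! k"
  define f where "f = es ! (k - 1)"
  have f: "f \<in> T" using es p k1 by (auto simp: f_def)
  have "ends G f = {vs ! (k - 1), u}" using en[of "k - 1"] k1 by (auto simp: f_def u_def)
  then have fc: "f \<in> T \<inter> cut (ends G) {u}" using two[OF f] f by (auto simp: cut_def card_2_iff doubleton_eq_iff)
  have "T \<inter> cut (ends G) {u} \<noteq> {f}" using T(3) by (auto simp: even_set_def dest: spec[of _ u])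
  then obtain e where e: "e \<in> T" "e \<in> cut (ends G) {u}" "e \<noteq> f" using fc by auto
  have "u \<in> ends G e" using e(2) by (auto simp: cut_def)
  then obtain x where x: "ends G e = {u, x}" "x \<noteq> u"
    using two[OF e(1)] by (metis card_2_iff insert_commute insertE singletonD)
  have xV: "x \<in> vertices G" using x ends_subset[of e] e T by auto
  have "x \<in> set vs"
  proof (rule ccontr)
    assume nx: "x \<notin> set vs"
    have "path (vs @ [x]) (es @ [e])"
      using p nx xV e x lv by (auto simp: path_def nth_append u_def less_Suc_eq)
    then have "P (Suc k)" unfolding P_def using p by (intro exI[of _ "vs @ [x]"] exI[of _ "es @ [e]"]) auto
    then show False using kmax by force
  qed
  then obtain j where j: "j < Suc k" "vs ! j = x" using lv by (auto simp: in_set_conv_nth)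
  have jk: "j < k" using j x by (cases "j = k") (auto simp: u_def)
  \<comment> \<open>Among the path edges only the last one, \<open>f\<close>, is incident with the
    end \<open>u\<close>.\<close>
  have e_new: "e \<noteq> es ! i" if "i < k" for i
  proof
    assume eq: "e = es ! i"
    then have "u = vs ! i \<or> u = vs ! Suc i" using en[OF that] x by auto
    then have "i = k \<or> Suc i = k" using that lv by (auto simp: u_def nth_eq_iff_index_eq)
    then have "i = k - 1" using that by auto
    then show False using eq e(3) by (simp add: f_def)
  qed
  have des: "distinct es"
  proof (rule distinct_conv_nth[THEN iffD2], intro allI impI)
    fix i i' assume i: "i < length es" "i' < length es" "i \<noteq> i'"
    have "{vs ! i, vs ! Suc i} \<noteq> {vs ! i', vs ! Suc i'}"
      using i p lv by (auto simp: doubleton_eq_iff nth_eq_iff_index_eq)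
    then show "es ! i \<noteq> es ! i'" using en[of i] en[of i'] i p by auto
  qed
  define es' where "es' = drop j es @ [e]"
  define vs' where "vs' = drop j vs"
  have len: "length es' = Suc (k - j)" "length vs' = Suc (k - j)" using p lv jk by (auto simp: es'_def vs'_def)
  have "cycle_edges G (set es')" unfolding cycle_edges_def
  proof (intro exI[of _ vs'] exI[of _ es'] conjI)
    show "es' \<noteq> []" by (simp add: es'_def)
    show "length vs' = length es'" using len by simp
    show "distinct vs'" using lv by (simp add: vs'_def)
    have "e \<notin> set es" using e_new p by (auto simp: in_set_conv_nth)
    then show "distinct es'" using des by (auto simp: es'_def dest: in_set_dropD)
    show "set es' \<subseteq> edges G" using es e T by (auto simp: es'_def dest!: in_set_dropD)
    show "\<forall>i<length es'. ends G (es' ! i) = {vs' ! i, vs' ! (Suc i mod length es')}"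
    proof (intro allI impI)
      fix i assume i: "i < length es'"
      show "ends G (es' ! i) = {vs' ! i, vs' ! (Suc i mod length es')}"
      proof (cases "i = k - j")
        case True
        then show ?thesis using x j jk p lv len by (auto simp: es'_def vs'_def nth_append u_def)
      next
        case False
        then show ?thesis using en[of "j + i"] i len jk p lv by (auto simp: es'_def vs'_def nth_append)
      qed
    qed
  qed simp
  moreover have "set es' \<subseteq> T" using es e by (auto simp: es'_def dest!: in_set_dropD)
  ultimately show ?thesis by blast
qed

section \<open>Matroids represented by graphs\<close>

context matroid
begin

lemma finite_indep: "I \<in> indeps M \<Longrightarrow> finite I"
  using finite_ground indep_subset_ground finite_subset by blast

lemma finite_indeps: "finite (indeps M)"
  using finite_ground indep_subset_ground by (meson Pow_iff finite_Pow_iff finite_subset subsetI)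

lemma card_indep_le_rank: "I \<in> indeps M \<Longrightarrow> card I \<le> matroid_rank M"
  unfolding matroid_rank_def rank_of_def
  using finite_indeps indep_subset_ground by (intro Max_ge) auto

lemma max_indep_exists: "\<exists>B\<in>indeps M. card B = matroid_rank M"
proof -
  have "card ` {I \<in> indeps M. I \<subseteq> ground M} \<noteq> {}" using indep_empty by auto
  then have "matroid_rank M \<in> card ` {I \<in> indeps M. I \<subseteq> ground M}"
    unfolding matroid_rank_def rank_of_def using finite_indeps by (intro Max_in) auto
  then show ?thesis by auto
qed

lemma card_basis: "basis M B \<Longrightarrow> card B = matroid_rank M"
proof -
  assume B: "basis M B"
  obtain J where J: "J \<in> indeps M" "card J = matroid_rank M" using max_indep_exists by blast
  have "\<not> card B < card J"
    using indep_augment[of B J] B J by (auto simp: basis_def)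
  then show ?thesis using card_indep_le_rank[of B] B J by (simp add: basis_def)
qed

lemma indep_extends_to_basis:
  assumes "I \<in> indeps M"
  shows "\<exists>B. basis M B \<and> I \<subseteq> B"
proof -
  let ?S = "{B \<in> indeps M. I \<subseteq> B}"
  have "\<exists>B\<in>?S. \<forall>J\<in>?S. B \<subseteq> J \<longrightarrow> B = J"
    by (rule finite_has_maximal) (use finite_indeps assms in auto)
  then obtain B where B: "B \<in> ?S" "\<forall>J\<in>?S. B \<subseteq> J \<longrightarrow> B = J" by blast
  then have "basis M B" by (auto simp: basis_def)
  then show ?thesis using B by auto
qed

lemma circuit_within_dependent:
  assumes "D \<subseteq> ground M" "D \<notin> indeps M"
  shows "\<exists>C\<subseteq>D. circuit M C"
proof -
  let ?S = "{C. C \<subseteq> D \<and> C \<notin> indeps M}"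
  have "finite ?S" using assms finite_ground finite_subset by (metis (no_types, lifting) Collect_mono Pow_def finite_Pow_iff)
  then have "\<exists>C\<in>?S. \<forall>J\<in>?S. J \<subseteq> C \<longrightarrow> C = J"
    by (rule finite_has_minimal) (use assms in auto)
  then obtain C where C: "C \<in> ?S" "\<forall>J\<in>?S. J \<subseteq> C \<longrightarrow> C = J" by blast
  then have "circuit M C" using assms by (auto simp: circuit_def)
  then show ?thesis using C by auto
qed

text \<open>Passing to circuits inside the given sets only decreases lengths and multiplicities and
  keeps \<open>c\<close> injective, so no construction below has to produce actual circuits.\<close>

lemma short_tuple_from_dependent_sets:
  assumes F: "\<And>i. i \<in> {1..4} \<Longrightarrow> F i \<subseteq> ground M \<and> F i \<notin> indeps M \<and> inj_on c (F i)"
    and sum: "(\<Sum>i = 1..4. card (F i)) \<le> 2 * matroid_rank M + 4"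
    and cover: "\<And>e. e \<in> ground M \<Longrightarrow> card {i \<in> {1..4::nat}. e \<in> F i} \<le> 2"
  shows "\<exists>C. short_rainbow_circuit_4_tuple M c C"
proof -
  have "\<exists>C. C \<subseteq> F i \<and> circuit M C" if "i \<in> {1..4}" for i
    using circuit_within_dependent[of "F i"] F[OF that] by auto
  then obtain C where C: "\<And>i. i \<in> {1..4} \<Longrightarrow> C i \<subseteq> F i \<and> circuit M (C i)" by metis
  have finF: "finite (F i)" if "i \<in> {1..4}" for i using F[OF that] finite_ground finite_subset by blast
  have "(\<Sum>i = 1..4. card (C i)) \<le> (\<Sum>i = 1..4. card (F i))"
    using C finF by (intro sum_mono card_mono) blast+
  moreover have "card {i \<in> {1..4::nat}. e \<in> C i} \<le> 2" if "e \<in> ground M" for e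
  proof -
    have "card {i \<in> {1..4::nat}. e \<in> C i} \<le> card {i \<in> {1..4}. e \<in> F i}"
      using C by (intro card_mono) auto
    then show ?thesis using cover[OF that] by linarith
  qed
  moreover have "rainbow_circuit M c (C i)" if "i \<in> {1..4}" for i
    using C[OF that] F[OF that] by (auto simp: rainbow_circuit_def intro: inj_on_subset)
  ultimately show ?thesis using sum unfolding short_rainbow_circuit_4_tuple_def
    by (intro exI[of _ C]) (auto simp del: One_nat_def)
qed

lemma simple_small_indep:
  assumes "simple_matroid M" "D \<subseteq> ground M" "card D \<le> 2"
  shows "D \<in> indeps M"
proof (rule ccontr)
  assume "D \<notin> indeps M"
  then obtain C where C: "C \<subseteq> D" "circuit M C" using circuit_within_dependent assms by blast
  have "finite D" using assms finite_ground finite_subset by blast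
  then have "card C \<le> 2" using C assms card_mono[of D C] by linarith
  moreover have "C \<noteq> {}" using C indep_empty by (auto simp: circuit_def)
  moreover have "finite C" using C \<open>finite D\<close> finite_subset by blast
  ultimately consider "card C = 1" | "card C = 2" by (metis card_0_eq le_SucE le_zero_eq numeral_2_eq_2 One_nat_def)
  then show False
  proof cases
    case 1 then show False using C assms by (auto simp: card_1_singleton_iff simple_matroid_def loop_def)
  next
    case 2 then show False using C assms by (auto simp: card_2_iff simple_matroid_def parallel_def)
  qed
qed

end

text \<open>Independence is phrased with even sets instead of \<open>cycle_edges\<close>, a linear
  condition that is easy to follow when vertices are identified. With \<open>V\<close> nonempty, an
  independent set is smaller than \<open>V\<close> even if it is empty.\<close>

definition represents :: "'a pre_matroid \<Rightarrow> 'v set \<Rightarrow> ('a \<Rightarrow> 'v set) \<Rightarrow> bool" where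
  "represents M V en \<longleftrightarrow> finite V \<and> V \<noteq> {} \<and> (\<forall>e\<in>ground M. is_edge (en e) \<and> en e \<subseteq> V) \<and>
    (\<forall>I. I \<subseteq> ground M \<longrightarrow> (I \<in> indeps M \<longleftrightarrow> (\<forall>T\<subseteq>I. even_set en T \<longrightarrow> T = {})))"

lemma graphic_represents:
  assumes "graphic M"
  shows "\<exists>(V :: nat set) en. represents M V en"
proof -
  obtain G :: "(nat, nat) pre_multigraph" and f where G: "multigraph G"
    and f: "bij_betw f (ground M) (edges G)"
    and ind: "\<And>I. I \<subseteq> ground M \<Longrightarrow> I \<in> indeps M \<longleftrightarrow> f ` I \<in> indeps (cycle_matroid G)"
    using assms by (auto simp: graphic_def isomorphic_def cycle_matroid_def)
  interpret multigraph G by (rule G)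
  define en where "en e = ends G (f e)" for e
  have fE: "f e \<in> edges G" if "e \<in> ground M" for e using f that by (auto simp: bij_betw_def)
  have inj: "inj_on f (ground M)" using f by (auto simp: bij_betw_def)
  have ev: "even_set en T \<longleftrightarrow> even_set (ends G) (f ` T)" if T: "T \<subseteq> ground M" for T
  proof -
    have injT: "inj_on f T" using inj T inj_on_subset by blast
    have "card (f ` T \<inter> cut (ends G) {v}) = card (T \<inter> cut en {v})" for v
    proof -
      have "f ` T \<inter> cut (ends G) {v} = f ` (T \<inter> cut en {v})" by (auto simp: cut_def en_def)
      then show ?thesis using card_image[of f "T \<inter> cut en {v}"] injT inj_on_subset by (metis Int_lower1)
    qed
    then show ?thesis using injT by (auto simp: even_set_def finite_image_iff)
  qed
  have "I \<in> indeps M \<longleftrightarrow> (\<forall>T\<subseteq>I. even_set en T \<longrightarrow> T = {})" if I: "I \<subseteq> ground M" for I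
  proof -
    have fI: "f ` I \<subseteq> edges G" using I fE by auto
    have "f ` I \<in> indeps (cycle_matroid G) \<longleftrightarrow> (\<nexists>C. cycle_edges G C \<and> C \<subseteq> f ` I)"
      using fI by (simp add: cycle_matroid_def)
    also have "\<dots> \<longleftrightarrow> (\<forall>T\<subseteq>I. even_set en T \<longrightarrow> T = {})"
    proof
      assume no: "\<nexists>C. cycle_edges G C \<and> C \<subseteq> f ` I"
      show "\<forall>T\<subseteq>I. even_set en T \<longrightarrow> T = {}"
      proof (intro allI impI, rule ccontr)
        fix T assume T: "T \<subseteq> I" "even_set en T" "T \<noteq> {}"
        then have "even_set (ends G) (f ` T)" using ev I by blast
        moreover have "f ` T \<subseteq> edges G" "f ` T \<noteq> {}" using T fI by auto
        ultimately obtain C where "C \<subseteq> f ` T" "cycle_edges G C" using even_set_contains_cycle_edges[OF G] by blast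
        then show False using no T by blast
      qed
    next
      assume ev0: "\<forall>T\<subseteq>I. even_set en T \<longrightarrow> T = {}"
      show "\<nexists>C. cycle_edges G C \<and> C \<subseteq> f ` I"
      proof
        assume "\<exists>C. cycle_edges G C \<and> C \<subseteq> f ` I"
        then obtain C where C: "cycle_edges G C" "C \<subseteq> f ` I" by blast
        then obtain T where T: "T \<subseteq> I" "C = f ` T" by (auto simp: subset_image_iff)
        have "even_set en T" using ev[of T] T I cycle_edges_even[OF C(1)] by auto
        then show False using ev0 T cycle_edges_even[OF C(1)] by auto
      qed
    qed
    finally show ?thesis using ind[OF I] by simp
  qed
  moreover have "is_edge (en e) \<and> en e \<subseteq> insert 0 (vertices G)" if "e \<in> ground M" for e
    using card_ends[OF fE[OF that]] ends_subset[OF fE[OF that]]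
    by (auto simp: en_def is_edge_def card_1_singleton_iff card_2_iff)
  \<comment> \<open>Adding the vertex 0, possibly isolated, makes the vertex set nonempty.\<close>
  ultimately have "represents M (insert 0 (vertices G)) en" using finite_vertices by (auto simp: represents_def)
  then show ?thesis by blast
qed

text \<open>Identifying two vertices in different components does not change the cycle space.\<close>

lemma represents_glue:
  assumes rep: "represents M V en" and X: "X \<subseteq> V" "X \<noteq> {}" "X \<noteq> V" and no: "cut en X \<inter> ground M = {}"
    and fin: "finite (ground M)"
  shows "\<exists>V' en'. represents M (V' :: 'v set) en' \<and> card V' < card (V :: 'v set)"
proof -
  obtain x x' where x: "x \<in> X" and x': "x' \<in> V" "x' \<notin> X" using X by blast
  have xx': "x \<noteq> x'" using x x' by auto
  define g where "g v = (if v = x' then x else v)" for v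
  define en' where "en' e = g ` en e" for e
  have finV: "finite V" and finX: "finite X" using rep X finite_subset by (auto simp: represents_def)
  have edge: "is_edge (en e) \<and> en e \<subseteq> V" if "e \<in> ground M" for e using rep that by (auto simp: represents_def)
  have edge': "is_edge (en' e) \<and> en' e \<subseteq> V - {x'}" if e: "e \<in> ground M" for e
  proof -
    obtain a b where ab: "en e = {a, b}" using edge[OF e] by (auto simp: is_edge_def)
    then have "en' e = {g a, g b}" by (simp add: en'_def)
    then have "is_edge (en' e)" by (auto simp: is_edge_def)
    moreover have "en' e \<subseteq> V - {x'}" using edge[OF e] x x' X by (auto simp: en'_def g_def)
    ultimately show ?thesis by simp
  qed
  have ev: "even_set en T \<longleftrightarrow> even_set en' T" if T: "T \<subseteq> ground M" for T
  proof -
    have finT: "finite T" using T fin finite_subset by blast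
    have edT: "\<And>e. e \<in> T \<Longrightarrow> is_edge (en e)" using edge T by blast
    \<comment> \<open>No edge joins \<open>x\<close> and \<open>x'\<close>, as it would cross
      \<open>X\<close>; the star of the glued vertex is therefore the cut of the pair.\<close>
    have cx: "T \<inter> cut en' {x} = T \<inter> cut en {x, x'}"
    proof -
      have "e \<in> cut en' {x} \<longleftrightarrow> e \<in> cut en {x, x'}" if "e \<in> T" for e
      proof -
        have e: "e \<in> ground M" using that T by blast
        obtain a b where ab: "en e = {a, b}" using edge[OF e] by (auto simp: is_edge_def)
        have "e \<notin> cut en X" using no e by blast
        then have "a \<in> X \<longleftrightarrow> b \<in> X" using ab by (auto simp: cut_def)
        then show ?thesis using ab x x' by (auto simp: cut_def en'_def g_def)
      qed
      then show ?thesis by blast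
    qed
    have cv: "T \<inter> cut en' {v} = T \<inter> cut en {v}" if "v \<noteq> x" "v \<noteq> x'" for v
      using that by (auto simp: cut_def en'_def g_def)
    have cx': "T \<inter> cut en' {x'} = {}" using xx' by (auto simp: cut_def en'_def g_def split: if_splits)
    show ?thesis
    proof
      assume T': "even_set en T"
      have "even (card (T \<inter> cut en' {v}))" for v
      proof -
        consider "v = x" | "v = x'" | "v \<noteq> x" "v \<noteq> x'" by blast
        then show ?thesis
        proof cases
          case 1 then show ?thesis using cx even_set_cut[of en T "{x, x'}", OF T' _ edT] by simp
        next
          case 2 then show ?thesis using cx' by simp
        next
          case 3 then show ?thesis using cv[OF 3] T' by (simp add: even_set_def)
        qed
      qed
      then show "even_set en' T" using finT by (simp add: even_set_def)
    next
      assume T': "even_set en' T"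
      have ev_other: "even (card (T \<inter> cut en {v}))" if "v \<noteq> x" "v \<noteq> x'" for v
        using cv[OF that] T' unfolding even_set_def by metis
      \<comment> \<open>Off \<open>x\<close> and \<open>x'\<close> all parities are even. As
        \<open>X\<close> contains only \<open>x\<close> of the two, its empty cut settles
        \<open>x\<close>, and the glued star then settles \<open>x'\<close>.\<close>
      have "T \<inter> cut en X = {}" using no T by blast
      then have e1: "even (card {v\<in>X. odd (card (T \<inter> cut en {v}))})"
        using odd_cut_parity[of T X en, OF finT finX edT] by simp
      have evx: "even (card (T \<inter> cut en {x}))"
      proof (rule ccontr)
        assume "odd (card (T \<inter> cut en {x}))"
        then have "{v\<in>X. odd (card (T \<inter> cut en {v}))} = {x}" using x x' ev_other by auto
        then show False using e1 by simp
      qed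
      have "even (card (T \<inter> cut en {x, x'}))" using T' cx by (metis even_set_def)
      then have e2: "even (card {v\<in>{x, x'}. odd (card (T \<inter> cut en {v}))})"
        using odd_cut_parity[of T "{x, x'}" en, OF finT _ edT] by simp
      have evx': "even (card (T \<inter> cut en {x'}))"
      proof (rule ccontr)
        assume "odd (card (T \<inter> cut en {x'}))"
        then have "{v\<in>{x, x'}. odd (card (T \<inter> cut en {v}))} = {x'}" using evx by auto
        then show False using e2 by simp
      qed
      have "even (card (T \<inter> cut en {v}))" for v
        using ev_other[of v] evx evx' by (cases "v = x"; cases "v = x'") auto
      then show "even_set en T" using finT by (simp add: even_set_def)
    qed
  qed
  have "I \<in> indeps M \<longleftrightarrow> (\<forall>T\<subseteq>I. even_set en' T \<longrightarrow> T = {})" if "I \<subseteq> ground M" for I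
  proof -
    have "I \<in> indeps M \<longleftrightarrow> (\<forall>T\<subseteq>I. even_set en T \<longrightarrow> T = {})" using rep that by (auto simp: represents_def)
    then show ?thesis using ev that by (meson subset_trans)
  qed
  moreover have "finite (V - {x'})" "V - {x'} \<noteq> {}" using finV x X xx' by auto
  ultimately have "represents M (V - {x'}) en'" using edge' by (auto simp: represents_def)
  moreover have "card (V - {x'}) < card V" using finV x' by (intro card_Diff1_less) auto
  ultimately show ?thesis by blast
qed

lemma connected_representation:
  assumes "graphic M" "finite (ground M)"
  shows "\<exists>(V :: nat set) en. represents M V en \<and> (\<forall>X\<subseteq>V. X \<noteq> {} \<longrightarrow> X \<noteq> V \<longrightarrow> cut en X \<inter> ground M \<noteq> {})"
proof -
  define P where "P V \<longleftrightarrow> (\<exists>en. represents M V en)" for V :: "nat set"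
  obtain V0 where "P V0" using graphic_represents[OF assms(1)] by (auto simp: P_def)
  then obtain V where V: "P V" "\<And>V'. P V' \<Longrightarrow> card V \<le> card V'" using ex_has_least_nat[of P V0 card] by blast
  obtain en where en: "represents M V en" using V by (auto simp: P_def)
  have "cut en X \<inter> ground M \<noteq> {}" if X: "X \<subseteq> V" "X \<noteq> {}" "X \<noteq> V" for X
  proof
    assume "cut en X \<inter> ground M = {}"
    then obtain V' en' where "represents M (V' :: nat set) en'" "card V' < card V"
      using represents_glue[OF en X _ assms(2)] by blast
    then show False using V(2)[of V'] by (auto simp: P_def)
  qed
  then show ?thesis using en by blast
qed

lemma represents_card_indep_less:
  assumes rep: "represents M V en" and I: "I \<in> indeps M" "I \<subseteq> ground M" "finite I"
  shows "card I < card V"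
proof (rule ccontr)
  assume "\<not> ?thesis"
  then have c: "card V \<le> card I" by simp
  have V: "finite V" "V \<noteq> {}" using rep by (auto simp: represents_def)
  then have "card V \<noteq> 0" by simp
  then have ne: "I \<noteq> {}" using c by auto
  have "\<exists>T\<subseteq>I. T \<noteq> {} \<and> even_set en T"
    by (rule even_subset_exists[OF I(3) V(1) _ c ne]) (use rep I in \<open>auto simp: represents_def\<close>)
  then show False using rep I by (auto simp: represents_def)
qed

text \<open>With too many vertices, two vertex sets avoiding \<open>w\<close> have the same cut
  within \<open>B\<close> by pigeonhole, so \<open>B\<close> misses the cut of their symmetric
  difference \<open>Y\<close>. An edge crossing \<open>Y\<close> exists by connectivity and can be
  added to \<open>B\<close>, since an even set through it would cross \<open>Y\<close> exactly
  once.\<close>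

lemma connected_card_le:
  assumes rep: "represents M V en" and conn: "\<forall>X\<subseteq>V. X \<noteq> {} \<longrightarrow> X \<noteq> V \<longrightarrow> cut en X \<inter> ground M \<noteq> {}"
    and B: "B \<in> indeps M" "B \<subseteq> ground M" "finite B" and max: "\<And>I. I \<in> indeps M \<Longrightarrow> card I \<le> card B"
  shows "card V \<le> card B + 1"
proof (rule ccontr)
  assume neg: "\<not> ?thesis"
  have V: "finite V" "V \<noteq> {}" using rep by (auto simp: represents_def)
  have edge: "is_edge (en e) \<and> en e \<subseteq> V" if "e \<in> ground M" for e using rep that by (auto simp: represents_def)
  obtain w where w: "w \<in> V" using V by blast
  define f where "f X = B \<inter> cut en X" for X
  have "\<not> inj_on f (Pow (V - {w}))"
  proof
    assume "inj_on f (Pow (V - {w}))"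
    then have "card (Pow (V - {w})) \<le> card (Pow B)"
      using B by (intro card_inj_on_le) (auto simp: f_def)
    then have "card (V - {w}) \<le> card B" using B V by (simp add: card_Pow)
    then show False using w V neg by simp
  qed
  then obtain X X' where X: "X \<subseteq> V - {w}" "X' \<subseteq> V - {w}" "X \<noteq> X'" "f X = f X'" by (auto simp: inj_on_def)
  define Y where "Y = sym_diff X X'"
  have Y: "Y \<subseteq> V" "Y \<noteq> {}" "Y \<noteq> V" using X w by (auto simp: Y_def)
  have BY: "B \<inter> cut en Y = {}"
  proof -
    have "e \<notin> cut en Y" if e: "e \<in> B" for e
    proof -
      obtain a b where ab: "en e = {a, b}" using edge[of e] e B by (auto simp: is_edge_def)
      have "e \<in> cut en X \<longleftrightarrow> e \<in> cut en X'" using X(4) e by (auto simp: f_def)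
      then show ?thesis using ab by (auto simp: cut_def Y_def)
    qed
    then show ?thesis by blast
  qed
  obtain e where e: "e \<in> cut en Y" "e \<in> ground M" using conn Y by blast
  have eB: "e \<notin> B" using BY e by blast
  have "insert e B \<in> indeps M"
  proof (rule ccontr)
    assume "insert e B \<notin> indeps M"
    then obtain T where T: "T \<subseteq> insert e B" "even_set en T" "T \<noteq> {}" using rep e B by (auto simp: represents_def)
    have "e \<in> T" using T rep B by (auto simp: represents_def)
    then have "T \<inter> cut en Y = {e}" using T BY e by auto
    moreover have "even (card (T \<inter> cut en Y))"
      by (rule even_set_cut[OF T(2) finite_subset[OF Y(1) V(1)]]) (use T B e edge in auto)
    ultimately show False by simp
  qed
  then show False using max[of "insert e B"] eB B by simp
qed

text \<open>Even sets meet cuts evenly. If the cut lay in a basis \<open>B\<close>, one of its edges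
  could be added to the dual basis \<open>ground M - B\<close>: a new even set would meet the cut in
  that edge alone.\<close>

lemma (in matroid) dual_cut_dependent:
  assumes rep: "represents (dual M) V en" and X: "X \<subseteq> V" and ne: "cut en X \<inter> ground M \<noteq> {}"
  shows "cut en X \<inter> ground M \<notin> indeps M"
proof
  assume "cut en X \<inter> ground M \<in> indeps M"
  then obtain B where B: "basis M B" "cut en X \<inter> ground M \<subseteq> B" using indep_extends_to_basis by blast
  obtain e where e: "e \<in> cut en X" "e \<in> ground M" using ne by blast
  have BE: "B \<subseteq> ground M" using B indep_subset_ground by (auto simp: basis_def)
  let ?I = "ground M - B"
  have I: "?I \<in> indeps (dual M)" using B by (auto simp: dual_def)
  have gr: "ground (dual M) = ground M" by (simp add: dual_def)
  have edge: "is_edge (en e) \<and> en e \<subseteq> V" if "e \<in> ground M" for e using rep that by (auto simp: represents_def gr)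
  have repI: "I \<in> indeps (dual M) \<longleftrightarrow> (\<forall>T\<subseteq>I. even_set en T \<longrightarrow> T = {})" if "I \<subseteq> ground M" for I
    using rep that by (simp add: represents_def gr)
  have "insert e ?I \<in> indeps (dual M)"
  proof (rule ccontr)
    assume "insert e ?I \<notin> indeps (dual M)"
    then obtain T where T: "T \<subseteq> insert e ?I" "even_set en T" "T \<noteq> {}"
      using repI[of "insert e ?I"] e by auto
    have "e \<in> T"
    proof (rule ccontr)
      assume "e \<notin> T"
      then have "T \<subseteq> ?I" using T by auto
      then show False using T I repI[of ?I] by auto
    qed
    then have "T \<inter> cut en X = {e}" using T B e by auto
    moreover have "even (card (T \<inter> cut en X))"
      by (rule even_set_cut[OF T(2) finite_subset[OF X]]) (use T e edge rep in \<open>auto simp: represents_def\<close>)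
    ultimately show False by simp
  qed
  then obtain B' where B': "basis M B'" "insert e ?I \<subseteq> ground M - B'" by (auto simp: dual_def)
  have "B' \<subseteq> ground M" using B' indep_subset_ground by (auto simp: basis_def)
  then have "B' \<subseteq> B" "e \<notin> B'" using B' by auto
  moreover have "e \<in> B" using B e by auto
  ultimately show False using B B' by (auto simp: basis_def)
qed

lemma (in matroid) dual_indep_card:
  shows "\<exists>I\<in>indeps (dual M). I \<subseteq> ground M \<and> card I = card (ground M) - matroid_rank M"
    and "I \<in> indeps (dual M) \<Longrightarrow> card I \<le> card (ground M) - matroid_rank M"
proof -
  have c: "card (ground M - B) = card (ground M) - matroid_rank M" if "basis M B" for B
  proof -
    have "B \<subseteq> ground M" using that indep_subset_ground by (auto simp: basis_def)
    then show ?thesis using card_basis[OF that] finite_ground by (metis card_Diff_subset finite_subset)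
  qed
  obtain B where "basis M B" using indep_extends_to_basis[OF indep_empty] by blast
  then show "\<exists>I\<in>indeps (dual M). I \<subseteq> ground M \<and> card I = card (ground M) - matroid_rank M"
    using c by (intro bexI[of _ "ground M - B"]) (auto simp: dual_def)
  show "card I \<le> card (ground M) - matroid_rank M" if I: "I \<in> indeps (dual M)"
  proof -
    obtain B' where "basis M B'" "I \<subseteq> ground M - B'" using I by (auto simp: dual_def)
    then show ?thesis using c[of B'] card_mono[of "ground M - B'" I] finite_ground by auto
  qed
qed

lemma card_two_uniform:
  assumes col: "colouring M k c" and two: "two_uniform M k c" and fin: "finite (ground M)"
  shows "card (ground M) = 2 * k"
proof -
  have "card (ground M) = (\<Sum>s\<in>{1..k}. card {e \<in> ground M. c e = s})"
    using sum.group[of "ground M" "{1..k}" c "\<lambda>_. 1::nat"] funcset_image[of c "ground M" "{1..k}"] col fin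
    by (simp add: colouring_def)
  also have "\<dots> = (\<Sum>s\<in>{1..k}. 2)" using two by (intro sum.cong) (auto simp: two_uniform_def)
  finally show ?thesis by simp
qed

section \<open>Cographic matroids\<close>

text \<open>Sums of indicators count repeated sets with multiplicity and reduce the covering
  condition to a case distinction on membership.\<close>

lemma (in matroid) short_tuple_from_four_sets:
  assumes ABCD: "\<And>X. X \<in> {A1, A2, A3, A4} \<Longrightarrow> X \<subseteq> ground M \<and> X \<notin> indeps M \<and> inj_on c X"
    and sum: "card A1 + card A2 + card A3 + card A4 \<le> 2 * matroid_rank M + 4"
    and cover: "\<And>e. e \<in> ground M \<Longrightarrow>
      of_bool (e \<in> A1) + of_bool (e \<in> A2) + of_bool (e \<in> A3) + of_bool (e \<in> A4) \<le> (2 :: nat)"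
  shows "\<exists>C. short_rainbow_circuit_4_tuple M c C"
proof -
  define F where "F i = (if i = 1 then A1 else if i = 2 then A2 else if i = 3 then A3 else A4)" for i :: nat
  have I4: "{1..4} = {1, 2, 3, 4 :: nat}" by auto
  show ?thesis
  proof (rule short_tuple_from_dependent_sets[of F])
    show "F i \<subseteq> ground M \<and> F i \<notin> indeps M \<and> inj_on c (F i)" for i
      by (rule ABCD) (auto simp: F_def)
    show "(\<Sum>i = 1..4. card (F i)) \<le> 2 * matroid_rank M + 4"
      using sum unfolding I4 by (simp add: F_def)
    fix e assume e: "e \<in> ground M"
    have "card {i \<in> {1..4::nat}. e \<in> F i} = (\<Sum>i\<in>{1..4::nat}. of_bool (e \<in> F i))"
      by (simp add: of_bool_def sum.If_cases Int_def)
    also have "\<dots> = of_bool (e \<in> A1) + of_bool (e \<in> A2) + of_bool (e \<in> A3) + of_bool (e \<in> A4)"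
      unfolding I4 by (simp add: F_def)
    finally show "card {i \<in> {1..4::nat}. e \<in> F i} \<le> 2" using cover[OF e] by simp
  qed
qed

lemma cut_Un_subset: "cut en (X \<union> Y) \<subseteq> cut en X \<union> cut en Y"
  by (auto simp: cut_def)

text \<open>A colour repeated in a non-rainbow cut belongs to that block alone and joins no two
  rainbow blocks. Since blocks outnumber live colours by two, the rainbow blocks outnumber by two
  the colours of edges between them. This forces either four rainbow blocks or a nonadjacent
  pair.\<close>

lemma (in matroid) cographic_short_tuple:
  fixes V :: "'v set"
  assumes simple: "simple_matroid M" and rep: "represents (dual M) V en"
    and conn: "\<forall>X\<subseteq>V. X \<noteq> {} \<longrightarrow> X \<noteq> V \<longrightarrow> cut en X \<inter> ground M \<noteq> {}"
    and col: "colouring M (matroid_rank M + 1) c" and two: "two_uniform M (matroid_rank M + 1) c"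
    and cardV: "card V = matroid_rank M + 3"
  shows "\<exists>C. short_rainbow_circuit_4_tuple M c C"
proof -
  define E where "E = ground M"
  define r where "r = matroid_rank M"
  define \<delta> where "\<delta> P = cut en P \<inter> E" for P
  have finE: "finite E" using finite_ground by (simp add: E_def)
  have finV: "finite V" using rep by (simp add: represents_def)
  have edge: "is_edge (en e)" "en e \<subseteq> V" if "e \<in> E" for e
    using rep that by (auto simp: represents_def dual_def E_def)
  have cE: "c e \<in> {1..r+1}" if "e \<in> E" for e using col that by (auto simp: colouring_def E_def r_def)
  have class2: "card {e\<in>E. c e = s} = 2" if "s \<in> {1..r+1}" for s
    using two that by (auto simp: two_uniform_def E_def r_def)
  have class_two: "g = e \<or> g = f" if "e \<in> E" "f \<in> E" "g \<in> E" "c f = c e" "c g = c e" "e \<noteq> f" for e f g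
  proof -
    have "card {x\<in>E. c x = c e} = 2" using class2 cE that(1) by blast
    moreover have "{e, f} \<subseteq> {x\<in>E. c x = c e}" using that by auto
    ultimately have "{e, f} = {x\<in>E. c x = c e}" using that finE by (intro card_subset_eq) auto
    then show ?thesis using that by blast
  qed
  define part where "part \<P> \<longleftrightarrow> \<Union>\<P> = V \<and> {} \<notin> \<P> \<and> (\<forall>P\<in>\<P>. \<forall>Q\<in>\<P>. P \<noteq> Q \<longrightarrow> P \<inter> Q = {})" for \<P> :: "'v set set"
  define live where "live \<P> = {c e | e. e \<in> E \<and> (\<exists>P\<in>\<P>. e \<in> cut en P)}" for \<P> :: "'v set set"
  have finlive: "finite (live \<P>)" for \<P> using finE by (simp add: live_def)
  have live_sub: "live \<P> \<subseteq> {1..r+1}" for \<P> using cE by (auto simp: live_def)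
  \<comment> \<open>The invariant of merging. A colour is live if one of its edges joins different
    blocks; at the start there are r+3 blocks and at most r+1 colours.\<close>
  define ok where "ok \<P> \<longleftrightarrow> part \<P> \<and> card (live \<P>) + 2 \<le> card \<P>" for \<P>
  define \<P>0 where "\<P>0 = (\<lambda>v. {v}) ` V"
  have c0: "card \<P>0 = r + 3" using cardV by (simp add: \<P>0_def card_image r_def)
  have "card (live \<P>0) \<le> r + 1" using card_mono[OF _ live_sub] by fastforce
  then have "ok \<P>0" using c0 by (auto simp: ok_def part_def \<P>0_def)
  then obtain \<P> where P: "ok \<P>" and Pmin: "\<And>\<P>'. ok \<P>' \<Longrightarrow> card \<P> \<le> card \<P>'" 
    using ex_has_least_nat[of ok \<P>0 card] by blast
  define N where "N = card \<P>"
  define L where "L = card (live \<P>)"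
  have part: "\<Union>\<P> = V" "{} \<notin> \<P>" and disj: "\<And>P Q. P \<in> \<P> \<Longrightarrow> Q \<in> \<P> \<Longrightarrow> P \<noteq> Q \<Longrightarrow> P \<inter> Q = {}"
    using P by (auto simp: ok_def part_def)
  have LN: "L + 2 \<le> N" using P by (simp add: ok_def L_def N_def)
  have finP: "finite \<P>" using part finV finite_UnionD by metis
  have Nr: "N \<le> r + 3" using Pmin[OF \<open>ok \<P>0\<close>] c0 by (simp add: N_def)
  have ends_in: "\<exists>a b. en e = {a, b} \<and> a \<in> P \<and> b \<notin> P" if e: "e \<in> E" "e \<in> cut en P" for e P
  proof -
    obtain a b where "en e = {a, b}" using edge[OF e(1)] by (auto simp: is_edge_def)
    then show ?thesis using e(2) by (auto simp: cut_def insert_commute)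
  qed
  have cut2: "en e \<subseteq> P \<union> Q" if e: "e \<in> E" "e \<in> cut en P" "e \<in> cut en Q" and PQ: "P \<in> \<P>" "Q \<in> \<P>" "P \<noteq> Q" for e P Q
    using ends_in[OF e(1,2)] ends_in[OF e(1,3)] disj[OF PQ] by (auto simp: doubleton_eq_iff)
  have cut3: "R = P \<or> R = Q" if e: "e \<in> E" "e \<in> cut en P" "e \<in> cut en Q" "e \<in> cut en R"
    and PQ: "P \<in> \<P>" "Q \<in> \<P>" "P \<noteq> Q" "R \<in> \<P>" for e P Q R
    using cut2[OF e(1,2,3) PQ(1,2,3)] e(4) disj[of R P] disj[of R Q] PQ by (auto simp: cut_def)
  \<comment> \<open>Joining \<open>P\<close> and \<open>Q\<close> costs one block but also kills the
    colour of \<open>e\<close> and \<open>f\<close>, so the surplus survives, against the choice of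
    the smallest partition.\<close>
  have merge: False if ef: "e \<in> E" "f \<in> E" "e \<noteq> f" "c f = c e" and PQ: "P \<in> \<P>" "Q \<in> \<P>" "P \<noteq> Q"
    and cuts: "e \<in> cut en P" "e \<in> cut en Q" "f \<in> cut en P" "f \<in> cut en Q" for e f P Q
  proof -
    define \<P>' where "\<P>' = insert (P \<union> Q) (\<P> - {P, Q})"
    have "P \<union> Q \<notin> \<P> - {P, Q}"
    proof
      assume "P \<union> Q \<in> \<P> - {P, Q}"
      then have "(P \<union> Q) \<inter> P = {}" using disj[of "P \<union> Q" P] PQ by auto
      then show False using PQ part by auto
    qed
    then have c': "card \<P>' = N - 1"
      using PQ finP card_mono[OF finP, of "{P, Q}"] by (simp add: \<P>'_def N_def card_Diff_subset)
    have part': "part \<P>'" using part disj PQ by (auto simp: part_def \<P>'_def)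
    have "live \<P>' \<subseteq> live \<P> - {c e}"
    proof
      fix s assume "s \<in> live \<P>'"
      then obtain g R where g: "g \<in> E" "s = c g" "R \<in> \<P>'" "g \<in> cut en R" by (auto simp: live_def)
      have "\<exists>R\<in>\<P>. g \<in> cut en R" using g cut_Un_subset[of en P Q] PQ by (auto simp: \<P>'_def)
      then have "s \<in> live \<P>" using g by (auto simp: live_def)
      moreover have "s \<noteq> c e"
      proof
        assume "s = c e"
        then have "g = e \<or> g = f" using class_two[of e f g] ef g by auto
        then have gc: "g \<in> cut en P" "g \<in> cut en Q" using cuts by auto
        then have "en g \<subseteq> P \<union> Q" using cut2 g PQ by blast
        then have "R \<noteq> P \<union> Q" using g by (auto simp: cut_def)
        then have "R \<in> \<P> - {P, Q}" using g by (auto simp: \<P>'_def)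
        then show False using cut3[of g P Q R] g gc PQ by auto
      qed
      ultimately show "s \<in> live \<P> - {c e}" by blast
    qed
    then have "card (live \<P>') \<le> card (live \<P> - {c e})" using finlive by (intro card_mono) auto
    moreover have "c e \<in> live \<P>" using ef PQ cuts by (auto simp: live_def)
    then have "card (live \<P> - {c e}) < L" using finlive by (metis L_def card_Diff1_less)
    ultimately have "card (live \<P>') + 1 \<le> L" by simp
    then have "ok \<P>'" using c' LN part' by (auto simp: ok_def)
    then show False using Pmin[of \<P>'] c' LN by (simp add: N_def)
  qed
  have proper: "P \<subseteq> V" "P \<noteq> {}" "P \<noteq> V" if P: "P \<in> \<P>" for P
  proof -
    show "P \<subseteq> V" "P \<noteq> {}" using P part by auto
    show "P \<noteq> V"
    proof
      assume "P = V"
      have "\<P> \<subseteq> {P}"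
      proof
        fix Q assume Q: "Q \<in> \<P>"
        then have "Q \<noteq> {}" "Q \<subseteq> P" using part \<open>P = V\<close> by auto
        then have "P \<inter> Q \<noteq> {}" by auto
        then show "Q \<in> {P}" using disj[OF P Q] by auto
      qed
      then have "N \<le> 1" using card_mono[of "{P}" \<P>] by (simp add: N_def)
      then show False using LN by simp
    qed
  qed
  have dep: "\<delta> P \<subseteq> ground M" "\<delta> P \<notin> indeps M" if P: "P \<in> \<P>" for P
    using dual_cut_dependent[OF rep proper(1)[OF P]] conn proper[OF P] by (auto simp: \<delta>_def E_def)
  have ge3: "3 \<le> card (\<delta> P)" if P: "P \<in> \<P>" for P
    using simple_small_indep[OF simple dep(1)[OF P]] dep(2)[OF P] by linarith
  have le2: "card {P\<in>\<P>. e \<in> cut en P} \<le> 2" if e: "e \<in> E" for e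
  proof (rule ccontr)
    assume "\<not> ?thesis"
    then have "3 \<le> card {P\<in>\<P>. e \<in> cut en P}" by simp
    then obtain B where B: "B \<subseteq> {P\<in>\<P>. e \<in> cut en P}" "card B = 3" by (rule obtain_subset_with_card_n)
    then obtain P Q R where "B = {P, Q, R}" "P \<noteq> Q" "R \<noteq> P" "R \<noteq> Q" by (auto simp: card_3_iff)
    then show False using cut3[of e P Q R] e B by auto
  qed
  \<comment> \<open>A live colour has two edges, each in at most two of the cuts, which gives 4L,
    and L is at most N-2.\<close>
  have total: "(\<Sum>P\<in>\<P>. card (\<delta> P)) \<le> 4 * N - 8"
  proof -
    have "(\<Sum>P\<in>\<P>. card (\<delta> P)) = (\<Sum>P\<in>\<P>. \<Sum>e\<in>E. of_bool (e \<in> cut en P))"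
      using finE by (intro sum.cong refl) (simp add: \<delta>_def Int_commute Collect_mem_eq sum.If_cases of_bool_def)
    also have "\<dots> = (\<Sum>e\<in>E. \<Sum>P\<in>\<P>. of_bool (e \<in> cut en P))" by (rule sum.swap)
    also have "\<dots> = (\<Sum>e\<in>E. card {P\<in>\<P>. e \<in> cut en P})"
      using finP by (intro sum.cong refl) (simp add: sum.If_cases of_bool_def Int_def)
    also have "\<dots> \<le> (\<Sum>e\<in>E. if c e \<in> live \<P> then 2 else 0)"
    proof (rule sum_mono)
      fix e assume e: "e \<in> E"
      have "card {P\<in>\<P>. e \<in> cut en P} = 0" if "c e \<notin> live \<P>"
      proof -
        have "{P\<in>\<P>. e \<in> cut en P} = {}" using that e by (auto simp: live_def)
        then show ?thesis by (metis card.empty)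
      qed
      then show "card {P\<in>\<P>. e \<in> cut en P} \<le> (if c e \<in> live \<P> then 2 else 0)" using le2[OF e] by auto
    qed
    also have "\<dots> = (\<Sum>s\<in>live \<P>. \<Sum>e\<in>{e\<in>E. c e = s}. 2)"
    proof -
      have "(\<Sum>s\<in>live \<P>. \<Sum>e\<in>{e\<in>{e\<in>E. c e \<in> live \<P>}. c e = s}. 2) = (\<Sum>e\<in>{e\<in>E. c e \<in> live \<P>}. 2::nat)"
        using finE finlive by (intro sum.group) auto
      moreover have "(\<Sum>e\<in>E. if c e \<in> live \<P> then 2 else 0) = (\<Sum>e\<in>{e\<in>E. c e \<in> live \<P>}. 2::nat)"
        using finE by (simp add: sum.If_cases Int_def)
      moreover have "(\<Sum>s\<in>live \<P>. \<Sum>e\<in>{e\<in>{e\<in>E. c e \<in> live \<P>}. c e = s}. 2) = (\<Sum>s\<in>live \<P>. \<Sum>e\<in>{e\<in>E. c e = s}. 2::nat)"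
        by (intro sum.cong) auto
      ultimately show ?thesis by simp
    qed
    also have "\<dots> = (\<Sum>s\<in>live \<P>. 4)"
    proof (rule sum.cong[OF refl])
      fix s assume "s \<in> live \<P>"
      then have "card {e\<in>E. c e = s} = 2" using class2 live_sub by blast
      then show "(\<Sum>e\<in>{e\<in>E. c e = s}. 2) = (4::nat)" by simp
    qed
    finally have "(\<Sum>P\<in>\<P>. card (\<delta> P)) \<le> 4 * L" by (simp add: L_def)
    then show ?thesis using LN by linarith
  qed
  \<comment> \<open>The blocks outside \<open>Q\<close> take at least three edges each from the
    total.\<close>
  have rest: "(\<Sum>P\<in>Q. card (\<delta> P)) + 3 * (N - card Q) \<le> 4 * N - 8" if Q: "Q \<subseteq> \<P>" for Q
  proof -
    have "(\<Sum>P\<in>\<P> - Q. 3) \<le> (\<Sum>P\<in>\<P> - Q. card (\<delta> P))" using ge3 by (intro sum_mono) auto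
    moreover have "card (\<P> - Q) = N - card Q" using Q finP by (metis N_def card_Diff_subset finite_subset)
    moreover have "(\<Sum>P\<in>\<P>. card (\<delta> P)) = (\<Sum>P\<in>\<P> - Q. card (\<delta> P)) + (\<Sum>P\<in>Q. card (\<delta> P))"
      using Q finP by (rule sum.subset_diff)
    ultimately show ?thesis using total by simp
  qed
  have N8: "8 \<le> N" using rest[of "{}"] LN by simp
  define RR where "RR = {P\<in>\<P>. inj_on c (\<delta> P)}"
  \<comment> \<open>The colours occurring on edges between two rainbow blocks.\<close>
  define U where "U = {c e | e P Q. e \<in> E \<and> P \<in> RR \<and> Q \<in> RR \<and> P \<noteq> Q \<and> e \<in> cut en P \<and> e \<in> cut en Q}"
  have RP: "RR \<subseteq> \<P>" by (auto simp: RR_def)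
  have Ulive: "U \<subseteq> live \<P>" using RP by (auto simp: U_def live_def)
  have "\<exists>s. \<exists>e\<in>\<delta> P. \<exists>f\<in>\<delta> P. e \<noteq> f \<and> c e = s \<and> c f = s" if "P \<in> \<P> - RR" for P
    using that by (auto simp: RR_def inj_on_def)
  then obtain \<kappa> where \<kappa>: "\<And>P. P \<in> \<P> - RR \<Longrightarrow> \<exists>e\<in>\<delta> P. \<exists>f\<in>\<delta> P. e \<noteq> f \<and> c e = \<kappa> P \<and> c f = \<kappa> P" by metis
  have \<kappa>all: "g \<in> cut en P" if P: "P \<in> \<P> - RR" and g: "g \<in> E" "c g = \<kappa> P" for P g
  proof -
    obtain e f where ef: "e \<in> \<delta> P" "f \<in> \<delta> P" "e \<noteq> f" "c e = \<kappa> P" "c f = \<kappa> P" using \<kappa>[OF P] by blast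
    then have "g = e \<or> g = f" using class_two[of e f g] g by (auto simp: \<delta>_def)
    then show ?thesis using ef by (auto simp: \<delta>_def)
  qed
  \<comment> \<open>Both edges of the colour \<open>\<kappa> P\<close> lie in the cut of
    \<open>P\<close>; if two blocks shared such a colour, they could be merged.\<close>
  have "inj_on \<kappa> (\<P> - RR)"
  proof (rule inj_onI, rule ccontr)
    fix P Q assume PQ: "P \<in> \<P> - RR" "Q \<in> \<P> - RR" "\<kappa> P = \<kappa> Q" "P \<noteq> Q"
    obtain e f where ef: "e \<in> \<delta> P" "f \<in> \<delta> P" "e \<noteq> f" "c e = \<kappa> P" "c f = \<kappa> P" using \<kappa>[OF PQ(1)] by blast
    then have "e \<in> cut en Q" "f \<in> cut en Q" using \<kappa>all[OF PQ(2)] PQ(3) by (auto simp: \<delta>_def)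
    then show False using merge[of e f P Q] ef PQ by (auto simp: \<delta>_def)
  qed
  moreover have "\<kappa> ` (\<P> - RR) \<subseteq> live \<P> - U"
  proof (intro image_subsetI DiffI)
    fix B assume B: "B \<in> \<P> - RR"
    obtain e where "e \<in> \<delta> B" "\<kappa> B = c e" using \<kappa>[OF B] by metis
    then show "\<kappa> B \<in> live \<P>" using B unfolding live_def \<delta>_def by blast
    show "\<kappa> B \<notin> U"
    proof
      assume "\<kappa> B \<in> U"
      then obtain e P Q where e: "e \<in> E" "\<kappa> B = c e" "P \<in> RR" "Q \<in> RR" "P \<noteq> Q" "e \<in> cut en P" "e \<in> cut en Q"
        by (auto simp: U_def)
      then have "e \<in> cut en B" using \<kappa>all[OF B] by auto
      then have "B = P \<or> B = Q" using cut3[of e P Q B] e B RP by auto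
      then show False using B e by auto
    qed
  qed
  ultimately have "card (\<P> - RR) \<le> card (live \<P> - U)" using finlive by (intro card_inj_on_le) auto
  moreover have "card (\<P> - RR) = N - card RR" using RP finP by (metis N_def card_Diff_subset finite_subset)
  moreover have "card (live \<P> - U) = L - card U" using Ulive finlive by (metis L_def card_Diff_subset finite_subset)
  moreover have "card U \<le> L" using Ulive finlive by (simp add: L_def card_mono)
  moreover have "card RR \<le> N" using RP finP by (simp add: N_def card_mono)
  ultimately have k: "card U + 2 \<le> card RR" using LN by linarith
  have finU: "finite U" using Ulive finlive finite_subset by blast
  have finR: "finite RR" using RP finP finite_subset by blast
  have Rok: "X \<subseteq> ground M \<and> X \<notin> indeps M \<and> inj_on c X" if "X \<in> \<delta> ` RR" for X
    using that dep RP by (auto simp: RR_def)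
  have budget: "2 * N - 2 \<le> 2 * matroid_rank M + 4" using Nr by (simp add: r_def)
  show ?thesis
  proof (cases "4 \<le> card RR")
    case True
    then obtain Q where Q: "Q \<subseteq> RR" "card Q = 4" by (rule obtain_subset_with_card_n)
    have "card Q = Suc (Suc (Suc (Suc 0)))" using Q by simp
    then obtain P1 P2 P3 P4 where P4: "Q = {P1, P2, P3, P4}" "P1 \<noteq> P2" "P1 \<noteq> P3" "P1 \<noteq> P4" "P2 \<noteq> P3" "P2 \<noteq> P4" "P3 \<noteq> P4"
      unfolding card_Suc_eq by auto
    have "(\<Sum>P\<in>Q. card (\<delta> P)) + 3 * (N - 4) \<le> 4 * N - 8" using rest[of Q] Q RP by auto
    moreover have "(\<Sum>P\<in>Q. card (\<delta> P)) = card (\<delta> P1) + card (\<delta> P2) + card (\<delta> P3) + card (\<delta> P4)"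
      using P4 by simp
    ultimately have s: "card (\<delta> P1) + card (\<delta> P2) + card (\<delta> P3) + card (\<delta> P4) \<le> 2 * matroid_rank M + 4"
      using N8 budget by linarith
    show ?thesis
    proof (rule short_tuple_from_four_sets[OF _ s])
      show "X \<subseteq> ground M \<and> X \<notin> indeps M \<and> inj_on c X" if "X \<in> {\<delta> P1, \<delta> P2, \<delta> P3, \<delta> P4}" for X
      proof -
        have "X \<in> \<delta> ` RR" using that P4(1) Q(1) by blast
        then show ?thesis by (rule Rok)
      qed
      fix e assume e: "e \<in> ground M"
      have "of_bool (e \<in> \<delta> P1) + of_bool (e \<in> \<delta> P2) + of_bool (e \<in> \<delta> P3) + of_bool (e \<in> \<delta> P4) =
          (\<Sum>P\<in>Q. of_bool (e \<in> cut en P) :: nat)" using P4 e by (simp add: \<delta>_def E_def)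
      also have "\<dots> = card {P\<in>Q. e \<in> cut en P}" using Q by (simp add: sum.If_cases of_bool_def Int_def finite_subset[OF _ finR])
      also have "\<dots> \<le> card {P\<in>\<P>. e \<in> cut en P}" using Q RP finP by (intro card_mono) auto
      finally show "of_bool (e \<in> \<delta> P1) + of_bool (e \<in> \<delta> P2) + of_bool (e \<in> \<delta> P3) + of_bool (e \<in> \<delta> P4) \<le> (2::nat)"
        using le2[of e] e by (simp add: E_def)
    qed
  next
    case False
    have inU: "c e \<in> U" if "e \<in> \<delta> P" "e \<in> \<delta> Q" "P \<in> RR" "Q \<in> RR" "P \<noteq> Q" for e P Q
      using that by (auto simp: U_def \<delta>_def)
    \<comment> \<open>With two rainbow blocks \<open>U\<close> is empty. With three it has at most
      one colour, while pairwise adjacency would need three distinct edges of that colour.\<close>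
    have "\<exists>P\<in>RR. \<exists>Q\<in>RR. P \<noteq> Q \<and> \<delta> P \<inter> \<delta> Q = {}"
    proof (rule ccontr)
      assume no: "\<not> ?thesis"
      have "card RR = 2 \<or> card RR = 3" using False k by linarith
      then show False
      proof
        assume "card RR = 2"
        then obtain P Q where PQ: "RR = {P, Q}" "P \<noteq> Q" by (auto simp: card_2_iff)
        then have "\<delta> P \<inter> \<delta> Q \<noteq> {}" using no by auto
        then obtain e where "e \<in> \<delta> P" "e \<in> \<delta> Q" by auto
        then have "c e \<in> U" using inU[of e P Q] PQ by auto
        then have "U \<noteq> {}" by auto
        then show False using k \<open>card RR = 2\<close> finU by simp
      next
        assume c3: "card RR = 3"
        then obtain P Q R where R: "RR = {P, Q, R}" "P \<noteq> Q" "P \<noteq> R" "Q \<noteq> R" by (auto simp: card_3_iff)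
        have "\<delta> P \<inter> \<delta> Q \<noteq> {}" "\<delta> P \<inter> \<delta> R \<noteq> {}" "\<delta> Q \<inter> \<delta> R \<noteq> {}" using no R by auto
        then obtain e1 e2 e3 where e: "e1 \<in> \<delta> P" "e1 \<in> \<delta> Q" "e2 \<in> \<delta> P" "e2 \<in> \<delta> R" "e3 \<in> \<delta> Q" "e3 \<in> \<delta> R"
          by auto
        have PQR: "P \<in> \<P>" "Q \<in> \<P>" "R \<in> \<P>" using R RP by auto
        have eE: "e1 \<in> E" "e2 \<in> E" "e3 \<in> E" using e by (auto simp: \<delta>_def)
        have ne: "e1 \<noteq> e2" "e1 \<noteq> e3" "e2 \<noteq> e3"
          using cut3[of e1 P Q R] cut3[of e2 P R Q] cut3[of e3 Q R P] e PQR R by (auto simp: \<delta>_def)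
        have "c e1 \<in> U" "c e2 \<in> U" "c e3 \<in> U" using inU[of e1 P Q] inU[of e2 P R] inU[of e3 Q R] e R by auto
        moreover have "card U \<le> 1" using k c3 by simp
        ultimately have "c e2 = c e1" "c e3 = c e1" using finU by (metis card_le_Suc0_iff_eq One_nat_def)+
        then show False using class_two[of e1 e2 e3] eE ne by auto
      qed
    qed
    then obtain P Q where PQ: "P \<in> RR" "Q \<in> RR" "P \<noteq> Q" "\<delta> P \<inter> \<delta> Q = {}" by blast
    have "(\<Sum>P\<in>{P, Q}. card (\<delta> P)) + 3 * (N - card {P, Q}) \<le> 4 * N - 8" using rest[of "{P, Q}"] PQ RP by auto
    then have "card (\<delta> P) + card (\<delta> Q) + 3 * (N - 2) \<le> 4 * N - 8" using PQ by simp
    then have s: "card (\<delta> P) + card (\<delta> P) + card (\<delta> Q) + card (\<delta> Q) \<le> 2 * matroid_rank M + 4"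
      using N8 budget by linarith
    show ?thesis
    proof (rule short_tuple_from_four_sets[OF _ s])
      show "X \<subseteq> ground M \<and> X \<notin> indeps M \<and> inj_on c X" if "X \<in> {\<delta> P, \<delta> P, \<delta> Q, \<delta> Q}" for X
      proof -
        have "X \<in> \<delta> ` RR" using that PQ(1,2) by blast
        then show ?thesis by (rule Rok)
      qed
      fix e assume "e \<in> ground M"
      show "of_bool (e \<in> \<delta> P) + of_bool (e \<in> \<delta> P) + of_bool (e \<in> \<delta> Q) + of_bool (e \<in> \<delta> Q) \<le> (2::nat)"
        using PQ(4) by auto
    qed
  qed
qed

section \<open>Graphic matroids\<close>

text \<open>Simplicity of the matroid becomes \<open>card_en\<close> and \<open>inj_en\<close>. The
  number \<open>m\<close> is r(M)+1, and \<open>card_V\<close> is what a connected representation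
  provides.\<close>

locale coloured_graph =
  fixes V :: "'v set" and E :: "'e set" and en :: "'e \<Rightarrow> 'v set" and c :: "'e \<Rightarrow> nat" and m :: nat
  assumes finV: "finite V" and finE: "finite E"
    and card_en: "e \<in> E \<Longrightarrow> card (en e) = 2" and en_V: "e \<in> E \<Longrightarrow> en e \<subseteq> V"
    and inj_en: "inj_on en E"
    and c_range: "e \<in> E \<Longrightarrow> c e \<in> {1..m}"
    and card_class: "s \<in> {1..m} \<Longrightarrow> card {e\<in>E. c e = s} = 2"
    and card_V: "card V \<le> m"
begin

text \<open>The bound is 2r(M)+4 written with \<open>m = r(M)+1\<close>; nonempty even sets stand
  for dependent sets.\<close>

definition four_tuple :: bool where
  "four_tuple \<longleftrightarrow> (\<exists>A1 A2 A3 A4. (\<forall>X\<in>{A1, A2, A3, A4}. X \<subseteq> E \<and> X \<noteq> {} \<and> even_set en X \<and> inj_on c X) \<and>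
     card A1 + card A2 + card A3 + card A4 \<le> 2 * m + 2 \<and>
     (\<forall>e. of_bool (e \<in> A1) + of_bool (e \<in> A2) + of_bool (e \<in> A3) + of_bool (e \<in> A4) \<le> (2 :: nat)))"

lemma four_tupleI:
  assumes "\<And>X. X \<in> {A1, A2, A3, A4} \<Longrightarrow> X \<subseteq> E \<and> X \<noteq> {} \<and> even_set en X \<and> inj_on c X"
    and "card A1 + card A2 + card A3 + card A4 \<le> 2 * m + 2"
    and "\<And>e. of_bool (e \<in> A1) + of_bool (e \<in> A2) + of_bool (e \<in> A3) + of_bool (e \<in> A4) \<le> (2 :: nat)"
  shows four_tuple
  unfolding four_tuple_def
  by (rule exI[of _ A1], rule exI[of _ A2], rule exI[of _ A3], rule exI[of _ A4], intro conjI ballI allI)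
    (use assms in \<open>blast+\<close>)

lemma four_tuple_if_disjoint_pair:
  assumes "A \<subseteq> E" "A \<noteq> {}" "even_set en A" "inj_on c A" "B \<subseteq> E" "B \<noteq> {}" "even_set en B" "inj_on c B"
    and "A \<inter> B = {}" "card A + card B \<le> m + 1"
  shows four_tuple
  by (rule four_tupleI[of A A B B]) (use assms in auto)

lemma is_edge_en: "e \<in> E \<Longrightarrow> is_edge (en e)"
  using card_en[of e] by (auto simp: is_edge_def card_2_iff)

lemma finite_edges: "T \<subseteq> E \<Longrightarrow> finite T"
  using finE finite_subset by blast

section \<open>Degrees and supports in a simple graph\<close>

definition deg :: "'e set \<Rightarrow> 'v \<Rightarrow> nat" where
  "deg T v = card {e\<in>T. v \<in> en e}"

definition supp :: "'e set \<Rightarrow> 'v set" where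
  "supp T = (\<Union>e\<in>T. en e)"

lemma Int_cut: "T \<subseteq> E \<Longrightarrow> T \<inter> cut en {v} = {e\<in>T. v \<in> en e}"
  using card_en by (fastforce simp: cut_def card_2_iff)

lemma even_set_iff: "T \<subseteq> E \<Longrightarrow> even_set en T \<longleftrightarrow> (\<forall>v. even (deg T v))"
  using finite_edges by (auto simp: even_set_def deg_def Int_cut)

lemma supp_V: "T \<subseteq> E \<Longrightarrow> supp T \<subseteq> V"
  using en_V by (auto simp: supp_def)

lemma finite_supp: "T \<subseteq> E \<Longrightarrow> finite (supp T)"
  using supp_V finV finite_subset by metis

lemma handshake:
  assumes T: "T \<subseteq> E" and W: "supp T \<subseteq> W" "finite W"
  shows "(\<Sum>v\<in>W. deg T v) = 2 * card T"
proof -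
  have "(\<Sum>v\<in>W. deg T v) = (\<Sum>v\<in>W. \<Sum>e\<in>T. of_bool (v \<in> en e))"
    using finite_edges[OF T] by (intro sum.cong refl) (simp add: deg_def of_bool_def sum.If_cases Int_def)
  also have "\<dots> = (\<Sum>e\<in>T. \<Sum>v\<in>W. of_bool (v \<in> en e))" by (rule sum.swap)
  also have "\<dots> = (\<Sum>e\<in>T. 2)"
  proof (rule sum.cong[OF refl])
    fix e assume e: "e \<in> T"
    have "W \<inter> {v. v \<in> en e} = en e" using e W by (auto simp: supp_def)
    then show "(\<Sum>v\<in>W. of_bool (v \<in> en e)) = (2::nat)"
      using card_en[of e] e T W(2) by (simp add: of_bool_def sum.If_cases subset_iff)
  qed
  finally show ?thesis by simp
qed

lemma deg_pos_iff: "T \<subseteq> E \<Longrightarrow> deg T v > 0 \<longleftrightarrow> v \<in> supp T"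
  using finite_edges by (auto simp: deg_def supp_def card_gt_0_iff)

lemma deg_mono: "T \<subseteq> U \<Longrightarrow> U \<subseteq> E \<Longrightarrow> deg T v \<le> deg U v"
  using finite_edges unfolding deg_def by (intro card_mono) auto

lemma even_deg_ge2:
  assumes "T \<subseteq> E" "even_set en T" "v \<in> supp T"
  shows "2 \<le> deg T v"
proof -
  have "deg T v > 0" "even (deg T v)" using assms deg_pos_iff even_set_iff by auto
  then show ?thesis by (metis One_nat_def Suc_leI even_Suc le_neq_implies_less less_2_cases_iff not_less odd_one)
qed

lemma card_supp_le:
  assumes "T \<subseteq> E" "\<And>v. v \<in> supp T \<Longrightarrow> 2 \<le> deg T v"
  shows "card (supp T) \<le> card T"
proof -
  have "(\<Sum>v\<in>supp T. 2) \<le> (\<Sum>v\<in>supp T. deg T v)" using assms by (intro sum_mono) auto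
  then show ?thesis using handshake[OF assms(1) subset_refl finite_supp[OF assms(1)]] by simp
qed

lemma card_supp_even_le: "T \<subseteq> E \<Longrightarrow> even_set en T \<Longrightarrow> card (supp T) \<le> card T"
  using card_supp_le even_deg_ge2 by blast

lemma edges_eq: "e \<in> E \<Longrightarrow> f \<in> E \<Longrightarrow> en e = en f \<Longrightarrow> e = f"
  using inj_en by (auto dest: inj_onD)

lemma en_other: "e \<in> E \<Longrightarrow> v \<in> en e \<Longrightarrow> \<exists>u. en e = {v, u} \<and> u \<noteq> v"
  using card_en[of e] by (auto simp: card_2_iff)

text \<open>Two edges at a vertex have different other ends in a simple graph, so the support has at
  least three vertices.\<close>

lemma even_card_ge3:
  assumes T: "T \<subseteq> E" "even_set en T" "T \<noteq> {}"
  shows "3 \<le> card T"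
proof -
  obtain e where e: "e \<in> T" using T by blast
  then obtain a b where ab: "en e = {a, b}" "a \<noteq> b" using card_en[of e] T by (auto simp: card_2_iff)
  have "a \<in> supp T" using e ab by (auto simp: supp_def)
  then have "2 \<le> card {f\<in>T. a \<in> en f}" using even_deg_ge2[OF T(1,2)] by (auto simp: deg_def)
  then have "\<not> {f\<in>T. a \<in> en f} \<subseteq> {e}" using card_mono[of "{e}" "{f\<in>T. a \<in> en f}"] by fastforce
  then obtain f where f: "f \<in> T" "a \<in> en f" "f \<noteq> e" by blast
  then obtain x where x: "en f = {a, x}" "x \<noteq> a" using en_other[of f a] T by auto
  have "x \<noteq> b" using edges_eq[of e f] x ab f e T by auto
  then have "card {a, b, x} = 3" using ab x by simp
  moreover have "{a, b, x} \<subseteq> supp T" using x ab e f by (auto simp: supp_def)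
  ultimately have "3 \<le> card (supp T)" using card_mono[OF finite_supp[OF T(1)], of "{a, b, x}"] by simp
  then show ?thesis using card_supp_even_le[OF T(1,2)] by simp
qed

section \<open>Cycles as minimal nonempty even sets\<close>

definition irreducible_cycle :: "'e set \<Rightarrow> bool" where
  "irreducible_cycle T \<longleftrightarrow> T \<subseteq> E \<and> even_set en T \<and> T \<noteq> {} \<and> (\<forall>U\<subseteq>T. even_set en U \<longrightarrow> U = {} \<or> U = T)"

lemma irreducible_cycle_exists:
  assumes "T \<subseteq> E" "even_set en T" "T \<noteq> {}"
  shows "\<exists>C\<subseteq>T. irreducible_cycle C"
proof -
  let ?S = "{C. C \<subseteq> T \<and> even_set en C \<and> C \<noteq> {}}"
  have "finite ?S" using finite_edges[OF assms(1)] by (rule finite_subset[rotated, OF finite_Pow_iff[THEN iffD2]]) auto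
  then have "\<exists>C\<in>?S. \<forall>J\<in>?S. J \<subseteq> C \<longrightarrow> C = J"
    by (rule finite_has_minimal) (use assms in auto)
  then obtain C where C: "C \<in> ?S" "\<forall>J\<in>?S. J \<subseteq> C \<longrightarrow> C = J" by blast
  then have "irreducible_cycle C" using assms unfolding irreducible_cycle_def by blast
  then show ?thesis using C by auto
qed

lemma bicyclicI: "S \<subseteq> E \<Longrightarrow> supp S \<subseteq> W \<Longrightarrow> finite W \<Longrightarrow> card W < card S \<Longrightarrow> bicyclic en S"
  using finite_edges is_edge_en by (intro bicyclic_if_many_edges[of S W]) (auto simp: supp_def)

lemma even_subsetI: "S \<subseteq> E \<Longrightarrow> supp S \<subseteq> W \<Longrightarrow> finite W \<Longrightarrow> card W \<le> card S \<Longrightarrow> S \<noteq> {} \<Longrightarrow>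
    \<exists>T\<subseteq>S. T \<noteq> {} \<and> even_set en T"
  using finite_edges is_edge_en by (intro even_subset_exists[of S W]) (auto simp: supp_def)

text \<open>A vertex of higher degree would give \<open>T\<close> more edges than vertices, hence
  two different nonempty even subsets, one of them proper.\<close>

lemma irreducible_deg_le2:
  assumes "irreducible_cycle T"
  shows "deg T v \<le> 2"
proof (rule ccontr)
  assume neg: "\<not> ?thesis"
  have T: "T \<subseteq> E" "even_set en T" and irr: "\<And>U. U \<subseteq> T \<Longrightarrow> even_set en U \<Longrightarrow> U = {} \<or> U = T"
    using assms by (auto simp: irreducible_cycle_def)
  have fs: "finite (supp T)" using finite_supp T by blast
  have v: "v \<in> supp T" using neg deg_pos_iff[OF T(1), of v] by simp
  have "(\<Sum>u\<in>supp T. 2) < (\<Sum>u\<in>supp T. deg T u)"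
    by (rule sum_strict_mono_ex1[OF fs]) (use even_deg_ge2[OF T] v neg in \<open>auto intro!: bexI[of _ v]\<close>)
  then have "card (supp T) < card T" using handshake[OF T(1) subset_refl fs] by simp
  then have "bicyclic en T" using bicyclicI[OF T(1) subset_refl fs] by blast
  then show False using irr unfolding bicyclic_def by blast
qed

lemma partner_exists:
  assumes "e \<in> E"
  shows "\<exists>f\<in>E. f \<noteq> e \<and> c f = c e \<and> (\<forall>g\<in>E. c g = c e \<longrightarrow> g = e \<or> g = f)"
proof -
  have "card {x\<in>E. c x = c e} = 2" using card_class c_range[OF assms] by blast
  then obtain a b where ab: "{x\<in>E. c x = c e} = {a, b}" "a \<noteq> b" by (auto simp: card_2_iff)
  then have "e = a \<or> e = b" using assms by blast
  then show ?thesis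
  proof
    assume "e = a" then show ?thesis using ab by (intro bexI[of _ b]) blast+
  next
    assume "e = b" then show ?thesis using ab by (intro bexI[of _ a]) blast+
  qed
qed

definition partner :: "'e \<Rightarrow> 'e" where
  "partner e = (SOME f. f \<in> E \<and> f \<noteq> e \<and> c f = c e \<and> (\<forall>g\<in>E. c g = c e \<longrightarrow> g = e \<or> g = f))"

lemma partner:
  assumes "e \<in> E"
  shows "partner e \<in> E" "partner e \<noteq> e" "c (partner e) = c e"
    "\<And>g. g \<in> E \<Longrightarrow> c g = c e \<Longrightarrow> g = e \<or> g = partner e"
proof -
  have "partner e \<in> E \<and> partner e \<noteq> e \<and> c (partner e) = c e \<and> (\<forall>g\<in>E. c g = c e \<longrightarrow> g = e \<or> g = partner e)"
    unfolding partner_def by (rule someI_ex) (use partner_exists[OF assms] in blast)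
  then show "partner e \<in> E" "partner e \<noteq> e" "c (partner e) = c e"
    "\<And>g. g \<in> E \<Longrightarrow> c g = c e \<Longrightarrow> g = e \<or> g = partner e" by blast+
qed

lemma four_tuple_no_rainbow_bicyclic:
  assumes none: "\<And>S. S \<subseteq> E \<Longrightarrow> inj_on c S \<Longrightarrow> \<not> bicyclic en S" and ne: "V \<noteq> {}"
  shows four_tuple
proof -
  \<comment> \<open>Otherwise one edge of each colour avoiding \<open>v\<close> would give
    \<open>m\<close> rainbow edges on fewer than \<open>m\<close> vertices.\<close>
  have center: "\<exists>s\<in>{1..m}. \<forall>e\<in>E. c e = s \<longrightarrow> v \<in> en e" if v: "v \<in> V" for v
  proof (rule ccontr)
    assume "\<not> ?thesis"
    then have "\<forall>s\<in>{1..m}. \<exists>e. e \<in> E \<and> c e = s \<and> v \<notin> en e" by blast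
    then obtain f where f: "\<And>s. s \<in> {1..m} \<Longrightarrow> f s \<in> E \<and> c (f s) = s \<and> v \<notin> en (f s)" by metis
    let ?S = "f ` {1..m}"
    have S: "?S \<subseteq> E" "inj_on c ?S" using f by (auto simp: inj_on_def)
    have "inj_on f {1..m}" using f by (metis inj_onI)
    then have "card ?S = m" by (simp add: card_image)
    moreover have "card (V - {v}) < m" using v finV card_V card_Diff1_less[OF finV v] by linarith
    moreover have "supp ?S \<subseteq> V - {v}" using f en_V by (fastforce simp: supp_def)
    ultimately have "bicyclic en ?S" using S finV by (intro bicyclicI[of _ "V - {v}"]) auto
    then show False using none S by blast
  qed
  then obtain \<kappa> where \<kappa>: "\<And>v. v \<in> V \<Longrightarrow> \<kappa> v \<in> {1..m} \<and> (\<forall>e\<in>E. c e = \<kappa> v \<longrightarrow> v \<in> en e)" by metis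
  \<comment> \<open>The arcs at \<open>v\<close> go to the other ends of the two edges of the colour
    centred at \<open>v\<close>.\<close>
  define N where "N v = {u. \<exists>e\<in>E. c e = \<kappa> v \<and> en e = {v, u} \<and> u \<noteq> v}" for v
  have N2: "2 \<le> card (N v)" if v: "v \<in> V" for v
  proof -
    have "card {e\<in>E. c e = \<kappa> v} = 2" using card_class \<kappa>[OF v] by blast
    then obtain e f where ef: "{e\<in>E. c e = \<kappa> v} = {e, f}" "e \<noteq> f" by (auto simp: card_2_iff)
    then have ef': "e \<in> E" "c e = \<kappa> v" "f \<in> E" "c f = \<kappa> v" by blast+
    obtain a b where ab: "en e = {v, a}" "a \<noteq> v" "en f = {v, b}" "b \<noteq> v"
      using en_other[of e v] en_other[of f v] \<kappa>[OF v] ef' by blast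
    have "a \<noteq> b" using edges_eq[of e f] ef ef' ab by auto
    moreover have "{a, b} \<subseteq> N v" using ab ef' by (auto simp: N_def)
    moreover have "finite (N v)" using en_V finV by (intro finite_subset[of "N v" V]) (auto simp: N_def)
    ultimately show ?thesis using card_mono[of "N v" "{a, b}"] by simp
  qed
  have NV: "N v \<subseteq> V - {v}" if "v \<in> V" for v using en_V by (auto simp: N_def)
  obtain K1 K2 where K: "K1 \<subseteq> V" "K2 \<subseteq> V" "K1 \<noteq> {}" "K2 \<noteq> {}" "card (K1 \<inter> K2) \<le> 1"
    "\<forall>x\<in>K1. N x \<inter> K1 \<noteq> {}" "\<forall>x\<in>K2. N x \<inter> K2 \<noteq> {}"
    using almost_disjoint_closed_sets[OF finV ne NV N2] by blast
  \<comment> \<open>A colour centred at two vertices would consist of two parallel edges.\<close>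
  have \<kappa>inj: "u = v" if "u \<in> V" "v \<in> V" "\<kappa> u = \<kappa> v" for u v
  proof (rule ccontr)
    assume ne: "u \<noteq> v"
    have "card {e\<in>E. c e = \<kappa> v} = 2" using card_class \<kappa>[OF that(2)] by blast
    then obtain e f where ef: "{e\<in>E. c e = \<kappa> v} = {e, f}" "e \<noteq> f" by (auto simp: card_2_iff)
    then have ef': "e \<in> E" "c e = \<kappa> v" "f \<in> E" "c f = \<kappa> v" by blast+
    then have "u \<in> en e" "v \<in> en e" "u \<in> en f" "v \<in> en f" using \<kappa> that by metis+
    then have "en e = {u, v}" "en f = {u, v}" using en_other[of e u] en_other[of f u] ef' ne by auto
    then show False using edges_eq[of e f] ef ef' by auto
  qed
  \<comment> \<open>One arc inside \<open>K\<close> per vertex gives |K| edges on |K| vertices,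
    rainbow because different vertices have different colours.\<close>
  have cyc: "\<exists>F\<subseteq>E. F \<noteq> {} \<and> even_set en F \<and> inj_on c F \<and> card F \<le> card K \<and> supp F \<subseteq> K"
    if K: "K \<subseteq> V" "K \<noteq> {}" "\<forall>x\<in>K. N x \<inter> K \<noteq> {}" for K
  proof -
    have "\<exists>e. e \<in> E \<and> c e = \<kappa> v \<and> en e \<subseteq> K" if v: "v \<in> K" for v
    proof -
      obtain u where "u \<in> N v" "u \<in> K" using K(3) v by blast
      then show ?thesis using v by (auto simp: N_def)
    qed
    then obtain g where g: "\<And>v. v \<in> K \<Longrightarrow> g v \<in> E \<and> c (g v) = \<kappa> v \<and> en (g v) \<subseteq> K" by metis
    have finK: "finite K" using K finV finite_subset by blast
    have inj: "inj_on g K" "inj_on c (g ` K)" using g \<kappa>inj K(1) by (auto simp: inj_on_def subset_iff) metis+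
    have cg: "card (g ` K) = card K" using inj by (simp add: card_image)
    have gE: "g ` K \<subseteq> E" and gK: "supp (g ` K) \<subseteq> K" using g by (auto simp: supp_def)
    obtain F where F: "F \<subseteq> g ` K" "F \<noteq> {}" "even_set en F"
      using even_subsetI[OF gE gK finK] cg K by auto
    have "card F \<le> card K" using cg F finK by (metis card_mono finite_imageI)
    moreover have "supp F \<subseteq> K" using F gK by (auto simp: supp_def)
    ultimately show ?thesis using F gE inj inj_on_subset by (intro exI[of _ F]) blast
  qed
  obtain F1 where F1: "F1 \<subseteq> E" "F1 \<noteq> {}" "even_set en F1" "inj_on c F1" "card F1 \<le> card K1" "supp F1 \<subseteq> K1"
    using cyc[OF K(1,3,6)] by blast
  obtain F2 where F2: "F2 \<subseteq> E" "F2 \<noteq> {}" "even_set en F2" "inj_on c F2" "card F2 \<le> card K2" "supp F2 \<subseteq> K2"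
    using cyc[OF K(2,4,7)] by blast
  have fK: "finite K1" "finite K2" using K finV finite_subset by blast+
  \<comment> \<open>A common edge would have both its ends in \<open>K1 \<inter> K2\<close>, which
    has at most one element.\<close>
  have "F1 \<inter> F2 = {}"
  proof (rule ccontr)
    assume "F1 \<inter> F2 \<noteq> {}"
    then obtain e where e: "e \<in> F1" "e \<in> F2" by blast
    then have "en e \<subseteq> K1 \<inter> K2" using F1(6) F2(6) by (auto simp: supp_def)
    then have "card (en e) \<le> 1" using K(5) card_mono[of "K1 \<inter> K2" "en e"] fK by simp
    then show False using card_en[of e] e F1 by auto
  qed
  moreover have "card F1 + card F2 \<le> m + 1"
  proof -
    have "card K1 + card K2 = card (K1 \<union> K2) + card (K1 \<inter> K2)" using fK by (rule card_Un_Int)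
    moreover have "card (K1 \<union> K2) \<le> card V" using K finV by (intro card_mono) auto
    ultimately show ?thesis using K(5) F1(5) F2(5) card_V by linarith
  qed
  ultimately show ?thesis using F1 F2 by (intro four_tuple_if_disjoint_pair[of F1 F2]) auto
qed

end

section \<open>Chords and shortcuts of a cycle\<close>

context coloured_graph
begin

text \<open>With the chord there are more edges than vertices, hence two different nonempty even
  sets; within \<open>X\<close> there is only \<open>X\<close> itself, so one of them uses
  \<open>h\<close>.\<close>

lemma chord_cycle:
  assumes X: "irreducible_cycle X" and h: "h \<in> E" "h \<notin> X" "en h \<subseteq> supp X"
  shows "\<exists>T. even_set en T \<and> h \<in> T \<and> T \<subseteq> insert h X"
proof -
  have XE: "X \<subseteq> E" and irr: "\<And>U. U \<subseteq> X \<Longrightarrow> even_set en U \<Longrightarrow> U = {} \<or> U = X"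
    using X by (auto simp: irreducible_cycle_def)
  have "card (supp X) \<le> card X" using X card_supp_even_le by (auto simp: irreducible_cycle_def)
  moreover have "card (insert h X) = Suc (card X)" using h finite_edges[OF XE] by simp
  ultimately have "bicyclic en (insert h X)"
    using h XE finite_supp[OF XE] by (intro bicyclicI[of _ "supp X"]) (auto simp: supp_def)
  then obtain P Q where PQ: "P \<subseteq> insert h X" "Q \<subseteq> insert h X" "P \<noteq> {}" "Q \<noteq> {}" "P \<noteq> Q" "even_set en P" "even_set en Q"
    by (auto simp: bicyclic_def)
  have "h \<in> P \<or> h \<in> Q"
  proof (rule ccontr)
    assume "\<not> ?thesis"
    then have "P \<subseteq> X" "Q \<subseteq> X" using PQ by auto
    then show False using irr PQ by metis
  qed
  then show ?thesis using PQ by blast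
qed

text \<open>The chord splits \<open>X\<close> into two arcs; if \<open>T\<close> uses the wrong one,
  adding \<open>X\<close> switches to the other.\<close>

lemma chord_cycle_through:
  assumes X: "irreducible_cycle X" and h: "h \<in> E" "h \<notin> X" "en h \<subseteq> supp X" and z: "z \<in> X"
  shows "\<exists>T. even_set en T \<and> h \<in> T \<and> z \<in> T \<and> T \<subseteq> insert h X"
proof -
  obtain T where T: "even_set en T" "h \<in> T" "T \<subseteq> insert h X" using chord_cycle[OF X h] by blast
  show ?thesis
  proof (cases "z \<in> T")
    case True then show ?thesis using T by blast
  next
    case False
    have "even_set en (sym_diff T X)" using T X by (intro even_set_sym_diff) (auto simp: irreducible_cycle_def)
    then show ?thesis using False T h z by (intro exI[of _ "sym_diff T X"]) auto
  qed
qed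

text \<open>Each edge of \<open>X\<close> lies in exactly one of the two sets and \<open>h\<close>
  in both, which accounts for the 2.\<close>

lemma card_shortcut:
  assumes "finite X" "h \<notin> X" "h \<in> T" "T \<subseteq> insert h X"
  shows "card (sym_diff X T) + card T = card X + 2"
proof -
  define T' where "T' = T - {h}"
  have T': "T' \<subseteq> X" "h \<notin> T'" "T = insert h T'" using assms by (auto simp: T'_def)
  have fin: "finite T'" using T' assms finite_subset by blast
  have "sym_diff X T = insert h (X - T')" using assms T' by auto
  then have "card (sym_diff X T) = Suc (card X - card T')" using assms T' fin by (simp add: card_Diff_subset)
  moreover have "card T = Suc (card T')" using T' fin by simp
  moreover have "card T' \<le> card X" using T' assms by (intro card_mono)
  ultimately show ?thesis by simp
qed

end

text \<open>The theta graph in algebraic form: \<open>twice\<close> makes \<open>S\<close> the union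
  of the three cycles and each of them the symmetric difference of the other two, and
  \<open>cross\<close> excludes disjoint cycles. Minimality is among all rainbow bicyclic sets, not
  only subsets of \<open>S\<close>, because later arguments exchange edges of \<open>S\<close> for
  chords.\<close>

locale minimal_rainbow_bicyclic = coloured_graph +
  fixes S X1 X2 X3
  assumes SE: "S \<subseteq> E" and Sinj: "inj_on c S"
    and Smin: "\<And>Q. Q \<subseteq> E \<Longrightarrow> inj_on c Q \<Longrightarrow> bicyclic en Q \<Longrightarrow> card S \<le> card Q"
    and irr: "irreducible_cycle X1" "irreducible_cycle X2" "irreducible_cycle X3"
    and ne: "X1 \<noteq> X2" "X1 \<noteq> X3" "X2 \<noteq> X3"
    and cross: "X1 \<inter> X2 \<noteq> {}"
    and twice: "\<And>e. of_bool (e \<in> X1) + of_bool (e \<in> X2) + of_bool (e \<in> X3) = (if e \<in> S then 2 else (0 :: nat))"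
begin

text \<open>A form closed under permutation, so that any one of the three cycles can be singled
  out.\<close>

definition tri :: "'b set \<Rightarrow> 'b set \<Rightarrow> 'b set \<Rightarrow> bool" where
  "tri X Y Z \<longleftrightarrow> irreducible_cycle X \<and> irreducible_cycle Y \<and> irreducible_cycle Z \<and>
    (\<forall>e. of_bool (e \<in> X) + of_bool (e \<in> Y) + of_bool (e \<in> Z) = (if e \<in> S then 2 else (0 :: nat)))"

lemma tri123: "tri X1 X2 X3" using irr twice by (simp add: tri_def)

lemma tri_perms: "tri X Y Z \<Longrightarrow> tri Y X Z" "tri X Y Z \<Longrightarrow> tri X Z Y"
  by (simp_all add: tri_def add.commute add.left_commute)

lemma tri_ex:
  assumes "A \<in> {X1, X2, X3}" "B \<in> {X1, X2, X3}" "A \<noteq> B"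
  shows "\<exists>C. tri A B C"
  using assms tri123 tri_perms by (elim insertE emptyE) blast+

lemma tri_ex1:
  assumes "A \<in> {X1, X2, X3}"
  shows "\<exists>B C. tri A B C"
  using assms ne tri_ex[of A X1] tri_ex[of A X2] by blast

lemma tri_sub:
  assumes "tri X Y Z"
  shows "X \<subseteq> S" "Y \<subseteq> S" "Z \<subseteq> S"
proof -
  have *: "of_bool (e \<in> X) + of_bool (e \<in> Y) + of_bool (e \<in> Z) = (if e \<in> S then 2 else (0 :: nat))" for e
    using assms by (simp add: tri_def)
  have "(e \<in> X \<longrightarrow> e \<in> S) \<and> (e \<in> Y \<longrightarrow> e \<in> S) \<and> (e \<in> Z \<longrightarrow> e \<in> S)" for e
    using *[of e] by (auto simp: of_bool_def split: if_splits)
  then show "X \<subseteq> S" "Y \<subseteq> S" "Z \<subseteq> S" by blast+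
qed

lemma finS: "finite S" using SE finite_edges by blast

lemma card_tri:
  assumes "tri X Y Z"
  shows "card X + card Y + card Z = 2 * card S"
proof -
  have c: "card A = (\<Sum>e\<in>S. of_bool (e \<in> A))" if "A \<subseteq> S" for A
    using that finS by (simp add: of_bool_def sum.If_cases Int_absorb1)
  have "card X + card Y + card Z = (\<Sum>e\<in>S. of_bool (e \<in> X) + of_bool (e \<in> Y) + of_bool (e \<in> Z))"
    using tri_sub[OF assms] by (simp add: c sum.distrib)
  also have "\<dots> = (\<Sum>e\<in>S. 2)" using assms by (intro sum.cong) (auto simp: tri_def)
  finally show ?thesis by simp
qed

lemma deg_tri:
  assumes "tri X Y Z"
  shows "deg X v + deg Y v + deg Z v = 2 * deg S v"
proof -
  have c: "deg A v = (\<Sum>e\<in>{e\<in>S. v \<in> en e}. of_bool (e \<in> A))" if A: "A \<subseteq> S" for A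
  proof -
    have "{e\<in>A. v \<in> en e} = {e\<in>S. v \<in> en e} \<inter> {e. e \<in> A}" using A by auto
    then show ?thesis using finS by (simp add: deg_def of_bool_def sum.If_cases)
  qed
  have "deg X v + deg Y v + deg Z v = (\<Sum>e\<in>{e\<in>S. v \<in> en e}. of_bool (e \<in> X) + of_bool (e \<in> Y) + of_bool (e \<in> Z))"
    using tri_sub[OF assms] by (simp add: c sum.distrib)
  also have "\<dots> = (\<Sum>e\<in>{e\<in>S. v \<in> en e}. 2)" using assms by (intro sum.cong) (auto simp: tri_def)
  finally show ?thesis by (simp add: deg_def)
qed

lemma irr_deg:
  assumes "irreducible_cycle X"
  shows "deg X v = (if v \<in> supp X then 2 else 0)"
proof -
  have X: "X \<subseteq> E" "even_set en X" using assms by (auto simp: irreducible_cycle_def)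
  show ?thesis
    using even_deg_ge2[OF X, of v] irreducible_deg_le2[OF assms, of v] deg_pos_iff[OF X(1), of v] by auto
qed

abbreviation VS where "VS \<equiv> supp S"

lemma finY: "finite VS" using SE finite_supp by blast

text \<open>Each cycle has degree 2 or 0 at \<open>v\<close>, so the degree in \<open>S\<close> is
  the number of the three cycles through \<open>v\<close>.\<close>

lemma supp_count:
  assumes "tri X VS' Z"
  shows "of_bool (v \<in> supp X) + of_bool (v \<in> supp VS') + of_bool (v \<in> supp Z) = deg S v"
  using deg_tri[OF assms, of v] assms by (auto simp: tri_def irr_deg split: if_splits)

lemma deg_S:
  shows "deg S v \<le> 3" and "v \<in> VS \<Longrightarrow> 2 \<le> deg S v"
proof -
  show "deg S v \<le> 3" using supp_count[OF tri123, of v] by (auto simp: of_bool_def split: if_splits)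
  show "2 \<le> deg S v" if v: "v \<in> VS"
  proof -
    obtain e where e: "e \<in> S" "v \<in> en e" using v by (auto simp: supp_def)
    have "of_bool (e \<in> X1) + of_bool (e \<in> X2) + of_bool (e \<in> X3) = (2 :: nat)" using twice[of e] e by simp
    then obtain X where X: "X \<in> {X1, X2, X3}" "e \<in> X" by (auto simp: of_bool_def split: if_splits)
    have "irreducible_cycle X" "X \<subseteq> S" using X irr tri_sub[OF tri123] by auto
    then have "2 \<le> deg X v" using irr_deg[of X v] X e by (auto simp: supp_def)
    then show ?thesis using deg_mono[OF \<open>X \<subseteq> S\<close> SE, of v] by simp
  qed
qed

lemma no_smaller: "Q \<subseteq> E \<Longrightarrow> inj_on c Q \<Longrightarrow> card Q < card S \<Longrightarrow> supp Q \<subseteq> W \<Longrightarrow> finite W \<Longrightarrow> card Q \<le> card W"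
  using Smin[of Q] bicyclicI[of Q W] by force

text \<open>More edges would leave a bicyclic set after deleting one. With only as many edges as
  vertices all degrees would be two, so that cycles sharing a vertex share both edges there; then
  \<open>X1 \<inter> X2\<close> would be even and \<open>X1 = X2\<close>.\<close>

lemma card_S: "card S = card VS + 1"
proof (rule antisym)
  show "card S \<le> card VS + 1"
  proof (rule ccontr)
    assume a: "\<not> ?thesis"
    then obtain e where e: "e \<in> S" by fastforce
    have lt: "card (S - {e}) < card S" using finS e by (rule card_Diff1_less)
    have "supp (S - {e}) \<subseteq> VS" "inj_on c (S - {e})" "S - {e} \<subseteq> E"
      using SE Sinj by (auto simp: supp_def intro: inj_on_subset)
    then have "card (S - {e}) \<le> card VS" using no_smaller lt finY by blast
    then show False using a e finS by simp
  qed
  have "card VS \<le> card S" using card_supp_le[OF SE] deg_S(2) by blast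
  moreover have "card VS \<noteq> card S"
  proof
    assume eq: "card VS = card S"
    have s: "(\<Sum>v\<in>VS. deg S v) = 2 * card S" using handshake[OF SE subset_refl finY] .
    have d2: "deg S v = 2" if v: "v \<in> VS" for v
    proof (rule ccontr)
      assume "deg S v \<noteq> 2"
      then have "(\<Sum>v\<in>VS. 2) < (\<Sum>v\<in>VS. deg S v)"
        using deg_S(2) v by (intro sum_strict_mono_ex1[OF finY]) (auto intro!: bexI[of _ v] simp: le_neq_implies_less)
      then show False using s eq by simp
    qed
    have full: "{e\<in>X. v \<in> en e} = {e\<in>S. v \<in> en e}" if "irreducible_cycle X" "X \<subseteq> S" "v \<in> supp X" for X v
    proof (rule card_subset_eq)
      have "v \<in> VS" using that by (auto simp: supp_def)
      then show "card {e\<in>X. v \<in> en e} = card {e\<in>S. v \<in> en e}" using d2 irr_deg[of X v] that by (simp add: deg_def)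
    qed (use finS that in auto)
    have X12: "X1 \<subseteq> S" "X2 \<subseteq> S" using tri_sub[OF tri123] by auto
    have "even (deg (X1 \<inter> X2) v)" for v
    proof (cases "v \<in> supp X1 \<and> v \<in> supp X2")
      case True
      then have "{e\<in>X1 \<inter> X2. v \<in> en e} = {e\<in>X1. v \<in> en e}" using full[of X1 v] full[of X2 v] irr X12 by blast
      then have "deg (X1 \<inter> X2) v = deg X1 v" by (simp add: deg_def)
      then show ?thesis using irr_deg[OF irr(1), of v] by simp
    next
      case False
      then have none: "{e\<in>X1 \<inter> X2. v \<in> en e} = {}" by (auto simp: supp_def)
      show ?thesis unfolding deg_def none by simp
    qed
    then have ev: "even_set en (X1 \<inter> X2)" using even_set_iff[of "X1 \<inter> X2"] X12 SE by auto
    have i1: "\<And>U. U \<subseteq> X1 \<Longrightarrow> even_set en U \<Longrightarrow> U = {} \<or> U = X1" and i2: "\<And>U. U \<subseteq> X2 \<Longrightarrow> even_set en U \<Longrightarrow> U = {} \<or> U = X2"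
      using irr by (auto simp: irreducible_cycle_def)
    have "X1 \<inter> X2 = X1" using i1[OF Int_lower1 ev] cross by blast
    moreover have "X1 \<inter> X2 = X2" using i2[OF Int_lower2 ev] cross by blast
    ultimately show False using ne by auto
  qed
  ultimately show "card VS + 1 \<le> card S" by simp
qed

lemma card_S_le: "card S \<le> m"
proof -
  have "card (c ` S) \<le> card {1..m}" using SE c_range by (intro card_mono) auto
  then show ?thesis using Sinj by (simp add: card_image)
qed

text \<open>This is the length budget: doubled, it leaves room for the three cycles and two edges at
  every vertex off \<open>S\<close>.\<close>

lemma card_off: "card (V - VS) + card S \<le> m + 1"
proof -
  have "VS \<subseteq> V" using supp_V SE by blast
  then have "card (V - VS) = card V - card VS" "card VS \<le> card V" using finY finV by (auto simp: card_Diff_subset card_mono)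
  then show ?thesis using card_S card_V by linarith
qed

text \<open>Otherwise \<open>insert e S\<close> would have minimum degree three by minimality of \<open>S\<close>, hence be a complete
  graph on four vertices, leaving no room for the partner of \<open>e\<close>.\<close>

lemma colour_leaves_support:
  assumes e: "e \<in> E" "c e \<notin> c ` S"
  shows "\<not> (en e \<subseteq> VS \<and> en (partner e) \<subseteq> VS)"
proof
  assume in_Y: "en e \<subseteq> VS \<and> en (partner e) \<subseteq> VS"
  define Q where "Q = insert e S"
  have eS: "e \<notin> S" "partner e \<notin> S" using e partner[OF e(1)] by (metis imageI)+
  have QE: "Q \<subseteq> E" and Qinj: "inj_on c Q" using e SE Sinj eS by (auto simp: Q_def)
  have finQ: "finite Q" using QE finite_edges by blast
  have cQ: "card Q = card S + 1" using eS finS by (simp add: Q_def)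
  have suppQ: "supp Q \<subseteq> VS" using in_Y by (auto simp: Q_def supp_def)
  have d3: "3 \<le> deg Q v" if v: "v \<in> VS" for v
  proof (rule ccontr)
    assume "\<not> ?thesis"
    then have le: "deg Q v \<le> 2" by simp
    have ge: "2 \<le> deg Q v" using deg_S(2)[OF v] deg_mono[of S Q v] QE unfolding Q_def by (meson subset_insertI order_trans)
    \<comment> \<open>Here \<open>v\<close> has degree exactly two in \<open>Q\<close>, so deleting
      it leaves |S|-1 = |VS| edges on |VS|-1 vertices.\<close>
    define Q' where "Q' = {g\<in>Q. v \<notin> en g}"
    have "Q' = Q - {g\<in>Q. v \<in> en g}" by (auto simp: Q'_def)
    then have cQ': "card Q' = card Q - deg Q v" using finQ by (simp add: deg_def card_Diff_subset)
    have "supp Q' \<subseteq> VS - {v}" "Q' \<subseteq> E" "inj_on c Q'" using suppQ QE Qinj by (auto simp: Q'_def supp_def intro: inj_on_subset)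
    moreover have "card Q' < card S" using cQ' cQ ge card_S by linarith
    ultimately have "card Q' \<le> card (VS - {v})" using no_smaller finY by blast
    moreover have "card (VS - {v}) < card VS" using finY v by (rule card_Diff1_less)
    ultimately show False using cQ' cQ le card_S by linarith
  qed
  have "(\<Sum>v\<in>VS. 3) \<le> (\<Sum>v\<in>VS. deg Q v)" using d3 by (rule sum_mono)
  then have "3 * card VS \<le> 2 * (card VS + 2)" using handshake[OF QE suppQ finY] cQ card_S by simp
  then have Y4: "card VS \<le> 4" by simp
  let ?Q = "insert (partner e) Q"
  have "card ?Q = card VS + 3" using partner[OF e(1)] eS finQ cQ card_S by (simp add: Q_def)
  moreover have "card (en ` ?Q) = card ?Q"
    using QE partner(1)[OF e(1)] by (intro card_image inj_on_subset[OF inj_en]) auto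
  moreover have "card (en ` ?Q) \<le> card {B. B \<subseteq> VS \<and> card B = 2}"
  proof (rule card_mono)
    show "finite {B. B \<subseteq> VS \<and> card B = 2}" using finY by simp
    have "en g \<subseteq> VS \<and> card (en g) = 2" if "g \<in> ?Q" for g
      using that in_Y suppQ card_en[of g] QE partner(1)[OF e(1)] by (auto simp: supp_def)
    then show "en ` ?Q \<subseteq> {B. B \<subseteq> VS \<and> card B = 2}" by blast
  qed
  \<comment> \<open>The vertex pairs are too few: on four vertices there are 6, but |VS|+3 = 7
    edges, and fewer vertices are worse.\<close>
  ultimately have "card VS + 3 \<le> card VS choose 2" using n_subsets[OF finY, of 2] by simp
  moreover have "card VS = 0 \<or> card VS = 1 \<or> card VS = 2 \<or> card VS = 3 \<or> card VS = 4" using Y4 by linarith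
  ultimately show False by (auto simp: choose_two)
qed

text \<open>The edges of \<open>S\<close> at \<open>v\<close> that can be exchanged for a chord avoiding \<open>v\<close>. If all but one edge at \<open>v\<close>
  were of this kind, exchanging them would give a smaller bicyclic rainbow set missing \<open>v\<close>.\<close>

definition J where "J v = {z\<in>S. v \<in> en z \<and> en (partner z) \<subseteq> VS \<and> v \<notin> en (partner z)}"

lemma partner_notin: "z \<in> S \<Longrightarrow> partner z \<notin> S"
  using partner[of z] SE Sinj by (metis inj_onD subsetD)

lemma partner_inj: "z \<in> E \<Longrightarrow> y \<in> E \<Longrightarrow> partner z = partner y \<Longrightarrow> z = y"
  using partner[of z] partner[of y] by metis

lemma card_J: assumes v: "v \<in> VS" shows "card (J v) + 2 \<le> deg S v"
proof (rule ccontr)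
  assume a: "\<not> ?thesis"
  define P where "P = {x\<in>S. v \<notin> en x}"
  define Q where "Q = P \<union> partner ` J v"
  have JS: "J v \<subseteq> {x\<in>S. v \<in> en x}" by (auto simp: J_def)
  have finJ: "finite (J v)" using finS by (simp add: J_def)
  have "P = S - {x\<in>S. v \<in> en x}" by (auto simp: P_def)
  then have cP: "card P = card S - deg S v" using finS by (simp add: deg_def card_Diff_subset)
  have dle: "deg S v \<le> card S" using finS unfolding deg_def by (intro card_mono) auto
  have "inj_on partner (J v)" using partner_inj JS SE by (auto simp: inj_on_def subset_iff)
  then have cJ: "card (partner ` J v) = card (J v)" by (rule card_image)
  have "P \<inter> partner ` J v = {}" using partner_notin by (auto simp: P_def J_def)
  then have cQ: "card Q = card P + card (J v)" using finS finJ cJ by (simp add: Q_def P_def card_Un_disjoint)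
  have QE: "Q \<subseteq> E" using SE partner(1) JS by (auto simp: Q_def P_def J_def subset_iff)
  have "inj_on c Q"
  proof -
    have col: "\<exists>x\<in>S. c x = c a \<and> (a \<in> P \<longleftrightarrow> x \<in> P) \<and> (a \<in> P \<longrightarrow> a = x) \<and> (a \<notin> P \<longrightarrow> a = partner x)" if aQ: "a \<in> Q" for a
    proof (cases "a \<in> P")
      case True then show ?thesis by (intro bexI[of _ a]) (auto simp: P_def)
    next
      case False
      then obtain x where x: "x \<in> J v" "a = partner x" using aQ by (auto simp: Q_def)
      then show ?thesis using False partner(3)[of x] SE by (intro bexI[of _ x]) (auto simp: J_def P_def)
    qed
    show ?thesis
    proof (rule inj_onI)
      fix a b assume ab: "a \<in> Q" "b \<in> Q" "c a = c b"
      obtain x where x: "x \<in> S" "c x = c a" "a \<in> P \<longleftrightarrow> x \<in> P" "a \<in> P \<Longrightarrow> a = x" "a \<notin> P \<Longrightarrow> a = partner x" using col[OF ab(1)] by blast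
      obtain y where y: "y \<in> S" "c y = c b" "b \<in> P \<longleftrightarrow> y \<in> P" "b \<in> P \<Longrightarrow> b = y" "b \<notin> P \<Longrightarrow> b = partner y" using col[OF ab(2)] by blast
      have "x = y" using x y ab Sinj by (metis inj_onD)
      then show "a = b" using x y by metis
    qed
  qed
  have sQ: "supp Q \<subseteq> VS - {v}" by (auto simp: Q_def P_def J_def supp_def)
  have "card VS \<le> card Q" using a cQ cP card_S dle by linarith
  \<comment> \<open>\<open>Q\<close> may be as large as \<open>S\<close>; |VS| of its edges on
    |VS|-1 vertices are still bicyclic and fewer than |S|.\<close>
  then obtain Q' where Q': "Q' \<subseteq> Q" "card Q' = card VS" "finite Q'" by (rule obtain_subset_with_card_n)
  have "supp Q' \<subseteq> VS - {v}" using sQ Q' by (auto simp: supp_def)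
  moreover have "Q' \<subseteq> E" "inj_on c Q'" using Q' QE \<open>inj_on c Q\<close> inj_on_subset by blast+
  moreover have "card Q' < card S" using Q' card_S by simp
  ultimately have "card Q' \<le> card (VS - {v})" using no_smaller finY by blast
  then show False using Q' card_Diff1_less[OF finY v] by simp
qed

text \<open>Degrees are at most three, so \<open>card_J\<close> leaves at most one exchangeable edge
  at a vertex, and only at a branch vertex.\<close>

lemma J_deg: "z \<in> J v \<Longrightarrow> deg S v = 3"
  and J_unique: "z \<in> J v \<Longrightarrow> y \<in> J v \<Longrightarrow> z = y"
proof -
  have fin: "finite (J v)" using finS by (simp add: J_def)
  have le: "card (J v) \<le> 1" if "z \<in> J v" for z
  proof -
    have "v \<in> VS" using that by (auto simp: J_def supp_def)
    then show ?thesis using card_J[of v] deg_S(1)[of v] by linarith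
  qed
  show "deg S v = 3" if z: "z \<in> J v"
  proof -
    have "card (J v) \<noteq> 0" using z fin by auto
    moreover have "v \<in> VS" using z by (auto simp: J_def supp_def)
    ultimately show ?thesis using card_J[of v] deg_S(1)[of v] by linarith
  qed
  show "z = y" if "z \<in> J v" "y \<in> J v" using le[OF that(1)] that fin by (metis One_nat_def card_le_Suc0_iff_eq)
qed

text \<open>The two branch vertices of the theta graph: degrees are 2 or 3 and the number of edges
  exceeds that of vertices by one.\<close>

lemma card_deg3: "card {v\<in>VS. deg S v = 3} = 2"
proof -
  have "(\<Sum>v\<in>VS. deg S v) = (\<Sum>v\<in>VS. 2 + of_bool (deg S v = 3))"
  proof (rule sum.cong[OF refl])
    fix v assume "v \<in> VS" then show "deg S v = 2 + of_bool (deg S v = 3)" using deg_S[of v] by auto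
  qed
  also have "\<dots> = 2 * card VS + card {v\<in>VS. deg S v = 3}"
    unfolding sum.distrib using finY by (simp add: of_bool_def sum.If_cases Int_def)
  finally show ?thesis using handshake[OF SE subset_refl finY] card_S by simp
qed

text \<open>Parallel edges are excluded, so \<open>z\<close> has an end that its partner
  lacks.\<close>

lemma J_of_chord:
  assumes z: "z \<in> S" "en (partner z) \<subseteq> VS"
  shows "\<exists>v. z \<in> J v"
proof -
  have p: "z \<in> E" "partner z \<in> E" "partner z \<noteq> z" using z SE partner[of z] by auto
  have "\<not> en z \<subseteq> en (partner z)"
  proof
    assume "en z \<subseteq> en (partner z)"
    then have "en z = en (partner z)" using card_en p by (intro card_subset_eq) (auto intro: card_ge_0_finite)
    then show False using edges_eq p by metis
  qed
  then show ?thesis using z by (auto simp: J_def)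
qed

lemma two_supports:
  assumes "v \<in> VS"
  shows "of_bool (v \<in> supp X1) + of_bool (v \<in> supp X2) + of_bool (v \<in> supp X3) \<ge> (2::nat)"
  using supp_count[OF tri123, of v] deg_S(2)[OF assms] by simp

lemma all_supports:
  assumes "deg S v = 3" "X \<in> {X1, X2, X3}"
  shows "v \<in> supp X"
  using supp_count[OF tri123, of v] assms by (auto simp: of_bool_def split: if_splits)

end

section \<open>Chords of the theta graph and the choice of the four cycles\<close>

context minimal_rainbow_bicyclic
begin

lemma inj_on_chord:
  assumes "A \<subseteq> insert h X" "X \<subseteq> S" "h \<in> E" "partner h \<notin> A"
  shows "inj_on c A"
proof (rule inj_onI)
  fix a b assume ab: "a \<in> A" "b \<in> A" "c a = c b"
  have hx: "x = h" if "x \<in> A" "c x = c h" for x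
    using partner(4)[OF assms(3), of x] assms that SE by blast
  show "a = b"
  proof (cases "a = h \<or> b = h")
    case True then show ?thesis using hx ab by metis
  next
    case False
    then show ?thesis using assms ab Sinj by (meson inj_onD insertE subsetD)
  qed
qed

text \<open>The chord cuts the cycle \<open>X\<close> into two cycles, both rainbow because they avoid the partner of
  the chord; with the other two cycles they cover \<open>insert h S\<close> exactly twice.\<close>

lemma four_tuple_if_free_chord:
  assumes t: "tri X Y Z" and h: "h \<in> E" "h \<notin> S" "en h \<subseteq> supp X" "partner h \<notin> X"
  shows four_tuple
proof -
  have X: "irreducible_cycle X" "irreducible_cycle Y" "irreducible_cycle Z" using t by (auto simp: tri_def)
  note sub = tri_sub[OF t]
  have hX: "h \<notin> X" using h sub by auto
  obtain T where T: "even_set en T" "h \<in> T" "T \<subseteq> insert h X" using chord_cycle[OF X(1) h(1) hX h(3)] by blast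
  define T' where "T' = sym_diff X T"
  have T': "even_set en T'" "h \<in> T'" "T' \<subseteq> insert h X"
    using T X(1) hX by (auto simp: T'_def irreducible_cycle_def intro!: even_set_sym_diff)
  have finX: "finite X" using sub finS finite_subset by blast
  have cT: "card T' + card T = card X + 2" unfolding T'_def by (rule card_shortcut[OF finX hX T(2,3)])
  have pn: "partner h \<notin> insert h X" using h partner(2)[OF h(1)] by auto
  have inj: "inj_on c T" "inj_on c T'" using inj_on_chord[OF _ sub(1) h(1)] T T' pn by blast+
  have injYZ: "inj_on c Y" "inj_on c Z" using sub Sinj inj_on_subset by blast+
  have XE: "insert h X \<subseteq> E" using h sub SE by auto
  show ?thesis
  proof (rule four_tupleI[of T T' Y Z])
    show "A \<subseteq> E \<and> A \<noteq> {} \<and> even_set en A \<and> inj_on c A" if "A \<in> {T, T', Y, Z}" for A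
      using that T T' inj injYZ X XE by (auto simp: irreducible_cycle_def)
    show "card T + card T' + card Y + card Z \<le> 2 * m + 2" using cT card_tri[OF t] card_S_le by linarith
    fix e
    have e: "of_bool (e \<in> X) + of_bool (e \<in> Y) + of_bool (e \<in> Z) = (if e \<in> S then 2 else (0 :: nat))"
      using t by (simp add: tri_def)
    have "e \<in> T' \<longleftrightarrow> (e \<in> X \<longleftrightarrow> e \<notin> T)" by (auto simp: T'_def)
    then show "of_bool (e \<in> T) + of_bool (e \<in> T') + of_bool (e \<in> Y) + of_bool (e \<in> Z) \<le> (2::nat)"
      using e T hX h sub by (cases "e = h") (auto simp: of_bool_def split: if_splits)
  qed
qed

text \<open>With the partner on \<open>X\<close>, only the side of the chord avoiding it is rainbow.
  \<open>T\<close> is the other side, and the rainbow side is shorter than \<open>X\<close> by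
  \<open>card T - 2\<close>, at least one.\<close>

lemma shortcut:
  assumes t: "tri X Y Z" and h: "h \<in> E" "h \<notin> S" "en h \<subseteq> supp X" "partner h \<in> X"
  shows "\<exists>T. even_set en T \<and> h \<in> T \<and> partner h \<in> T \<and> T \<subseteq> insert h X \<and> 3 \<le> card T \<and>
    sym_diff X T \<subseteq> insert h X \<and> h \<in> sym_diff X T \<and> even_set en (sym_diff X T) \<and> inj_on c (sym_diff X T) \<and>
    card (sym_diff X T) + card T = card X + 2"
proof -
  have X: "irreducible_cycle X" using t by (auto simp: tri_def)
  note sub = tri_sub[OF t]
  have hX: "h \<notin> X" using h sub by auto
  have finX: "finite X" using sub finS finite_subset by blast
  obtain T where T: "even_set en T" "h \<in> T" "partner h \<in> T" "T \<subseteq> insert h X"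
    using chord_cycle_through[OF X h(1) hX h(3,4)] by blast
  have "insert h X \<subseteq> E" using h sub SE by auto
  then have "3 \<le> card T" using T by (intro even_card_ge3) auto
  moreover have "even_set en (sym_diff X T)" using T X by (intro even_set_sym_diff) (auto simp: irreducible_cycle_def)
  moreover have "sym_diff X T \<subseteq> insert h X" "h \<in> sym_diff X T" using T hX by auto
  moreover have "inj_on c (sym_diff X T)"
    by (rule inj_on_chord[OF \<open>sym_diff X T \<subseteq> insert h X\<close> sub(1) h(1)]) (use T h in auto)
  ultimately show ?thesis using T card_shortcut[OF finX hX T(2,4)] by (intro exI[of _ T]) blast
qed

text \<open>For a colour of \<open>S\<close> the edge outside \<open>S\<close> is chosen; for any
  other colour some edge leaves the support of \<open>S\<close>, by
  \<open>colour_leaves_support\<close>. Thus chords in \<open>C\<close> are partners of edges of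
  \<open>S\<close>. Every other edge of \<open>C\<close> has an end off the support, where
  \<open>C\<close> has degree at most two.\<close>

lemma rainbow_cycle_outside:
  "\<exists>C. irreducible_cycle C \<and> inj_on c C \<and> C \<inter> S = {} \<and>
    (\<forall>h\<in>C. en h \<subseteq> VS \<longrightarrow> partner h \<in> S) \<and> card C \<le> 2 * card (V - VS) + card {h\<in>C. en h \<subseteq> VS}"
proof -
  have "\<exists>e. e \<in> E \<and> c e = s \<and> e \<notin> S \<and> (en e \<subseteq> VS \<longrightarrow> partner e \<in> S)" if s: "s \<in> {1..m}" for s
  proof (cases "s \<in> c ` S")
    case True
    then obtain z where z: "z \<in> S" "s = c z" by blast
    then have zE: "z \<in> E" using SE by auto
    have "partner (partner z) = z"
      using partner[OF zE] partner(4)[OF partner(1)[OF zE], of z] zE by auto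
    then show ?thesis using z partner[OF zE] partner_notin[OF z(1)] by (intro exI[of _ "partner z"]) auto
  next
    case False
    have "card {e\<in>E. c e = s} = 2" using card_class[OF s] .
    then have "{e\<in>E. c e = s} \<noteq> {}" by (metis card.empty zero_neq_numeral)
    then obtain e where e: "e \<in> E" "c e = s" by blast
    have out: "\<not> (en e \<subseteq> VS \<and> en (partner e) \<subseteq> VS)" using colour_leaves_support[OF e(1)] e False by auto
    have notS: "e \<notin> S" "partner e \<notin> S" using e False partner(3)[OF e(1)] by (metis imageI)+
    show ?thesis
    proof (cases "en e \<subseteq> VS")
      case True then show ?thesis using out notS partner[OF e(1)] e by (intro exI[of _ "partner e"]) auto
    next
      case False then show ?thesis using notS e by blast
    qed
  qed
  then obtain f where f: "\<And>s. s \<in> {1..m} \<Longrightarrow> f s \<in> E \<and> c (f s) = s \<and> f s \<notin> S \<and> (en (f s) \<subseteq> VS \<longrightarrow> partner (f s) \<in> S)"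
    by metis
  let ?R = "f ` {1..m}"
  have R: "?R \<subseteq> E" "inj_on c ?R" "?R \<inter> S = {}" using f by (auto simp: inj_on_def)
  have "inj_on f {1..m}" using f by (metis inj_onI)
  then have cR: "card ?R = m" by (simp add: card_image)
  have "1 \<le> m" using card_S_le card_S by linarith
  then have "?R \<noteq> {}" by auto
  then obtain T where T: "T \<subseteq> ?R" "T \<noteq> {}" "even_set en T"
    using even_subsetI[OF R(1) supp_V[OF R(1)] finV] cR card_V by auto
  then obtain C where C: "C \<subseteq> T" "irreducible_cycle C" using irreducible_cycle_exists[of T] R by blast
  have CR: "C \<subseteq> ?R" using C T by blast
  have finC: "finite C" using CR by (meson finite_imageI finite_atLeastAtMost finite_subset)
  let ?H = "{h\<in>C. en h \<subseteq> VS}"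
  have "C - ?H \<subseteq> (\<Union>v\<in>V - VS. {e\<in>C. v \<in> en e})"
  proof
    fix e assume e: "e \<in> C - ?H"
    then have "en e \<subseteq> V" using CR R en_V by blast
    then show "e \<in> (\<Union>v\<in>V - VS. {e\<in>C. v \<in> en e})" using e by blast
  qed
  then have "card (C - ?H) \<le> card (\<Union>v\<in>V - VS. {e\<in>C. v \<in> en e})" using finC finV by (intro card_mono) auto
  also have "\<dots> \<le> (\<Sum>v\<in>V - VS. card {e\<in>C. v \<in> en e})" using finV by (intro card_UN_le) auto
  also have "\<dots> \<le> (\<Sum>v\<in>V - VS. 2)" using irreducible_deg_le2[OF C(2)] by (intro sum_mono) (simp add: deg_def)
  finally have "card (C - ?H) \<le> 2 * card (V - VS)" by simp
  moreover have "card C = card (C - ?H) + card ?H"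
    using finC by (subst card_Un_disjoint[symmetric]) (auto intro!: arg_cong[where f=card])
  ultimately have "card C \<le> 2 * card (V - VS) + card ?H" by linarith
  moreover have "inj_on c C" using CR R inj_on_subset by blast
  moreover have "C \<inter> S = {}" using CR R by blast
  moreover have "\<forall>h\<in>C. en h \<subseteq> VS \<longrightarrow> partner h \<in> S" using CR f by blast
  ultimately show ?thesis using C(2) by blast
qed

text \<open>Each vertex lies on at least two of the three cycles, so two vertices have one in
  common. For a branch vertex, which lies on all three, there are two choices;
  \<open>two_admissible\<close> uses this.\<close>

lemma admissible_exists:
  assumes "a \<in> VS" "b \<in> VS"
  shows "\<exists>X\<in>{X1, X2, X3}. a \<in> supp X \<and> b \<in> supp X"
  using two_supports[OF assms(1)] two_supports[OF assms(2)] by (auto simp: of_bool_def split: if_splits)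

lemma two_admissible:
  assumes "deg S a = 3" "b \<in> VS"
  shows "\<exists>X\<in>{X1, X2, X3}. X \<noteq> Y \<and> a \<in> supp X \<and> b \<in> supp X"
  using all_supports[OF assms(1)] two_supports[OF assms(2)] ne by (auto simp: of_bool_def split: if_splits)

text \<open>Together with \<open>C\<close> the three cycles exceed the budget by at most the number
  of chords in \<open>H\<close>, and \<open>C\<close> already uses each of these chords once. The
  cycles must therefore be modified so as to save |H| edges in total while using each chord at most
  once.\<close>

lemma four_tuple_holds: four_tuple
proof -
  obtain C where C: "irreducible_cycle C" "inj_on c C" "C \<inter> S = {}" "\<And>h. h \<in> C \<Longrightarrow> en h \<subseteq> VS \<Longrightarrow> partner h \<in> S"
    "card C \<le> 2 * card (V - VS) + card {h\<in>C. en h \<subseteq> VS}" using rainbow_cycle_outside by blast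
  define H where "H = {h\<in>C. en h \<subseteq> VS}"
  have CE: "C \<subseteq> E" "even_set en C" "C \<noteq> {}" using C by (auto simp: irreducible_cycle_def)
  have finC: "finite C" using CE finite_edges by blast
  have finH: "finite H" using finC by (simp add: H_def)
  have H: "h \<in> E" "h \<notin> S" "partner h \<in> S" "partner (partner h) = h" "en h \<subseteq> VS" if "h \<in> H" for h
  proof -
    show hE: "h \<in> E" and "h \<notin> S" "partner h \<in> S" "en h \<subseteq> VS" using that C CE by (auto simp: H_def)
    show "partner (partner h) = h"
      using partner[OF hE] partner(4)[OF partner(1)[OF hE], of h] hE by auto
  qed
  have "\<exists>v. partner h \<in> J v" if "h \<in> H" for h using J_of_chord[of "partner h"] H[OF that] by auto
  \<comment> \<open>\<open>w h\<close> is a branch vertex on the partner of \<open>h\<close> but not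
    on \<open>h\<close>. Different chords receive different branch vertices, of which there are
    two.\<close>
  then obtain w where w: "\<And>h. h \<in> H \<Longrightarrow> partner h \<in> J (w h)" by metis
  have cH: "card H \<le> 2"
  proof -
    have "inj_on w H"
    proof (rule inj_onI)
      fix h k assume hk: "h \<in> H" "k \<in> H" "w h = w k"
      then have "partner h = partner k" using w J_unique by metis
      then show "h = k" using partner_inj H hk by metis
    qed
    moreover have "w ` H \<subseteq> {v\<in>VS. deg S v = 3}"
    proof
      fix v assume "v \<in> w ` H"
      then obtain h where h: "h \<in> H" "v = w h" by blast
      then show "v \<in> {v\<in>VS. deg S v = 3}" using w[OF h(1)] J_deg by (auto simp: J_def supp_def)
    qed
    ultimately have "card H \<le> card {v\<in>VS. deg S v = 3}" using finY by (intro card_inj_on_le) auto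
    then show ?thesis using card_deg3 by simp
  qed
  have finish: four_tuple
    if t: "tri X Y Z" and sub: "X' \<subseteq> X \<union> H" "Y' \<subseteq> Y \<union> H" "Z' \<subseteq> Z \<union> H"
      and ok: "\<And>A. A \<in> {X', Y', Z'} \<Longrightarrow> A \<noteq> {} \<and> even_set en A \<and> inj_on c A"
      and once: "\<And>h. h \<in> H \<Longrightarrow> of_bool (h \<in> X') + of_bool (h \<in> Y') + of_bool (h \<in> Z') \<le> (1::nat)"
      and cards: "card X' + card Y' + card Z' + card H \<le> 2 * card S" for X Y Z X' Y' Z'
  proof (rule four_tupleI[of X' Y' Z' C])
    have "X \<union> H \<subseteq> E" "Y \<union> H \<subseteq> E" "Z \<union> H \<subseteq> E" using tri_sub[OF t] SE H(1) by auto
    then have "A \<subseteq> E" if "A \<in> {X', Y', Z'}" for A using that sub by blast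
    then show "A \<subseteq> E \<and> A \<noteq> {} \<and> even_set en A \<and> inj_on c A" if "A \<in> {X', Y', Z', C}" for A
      using that ok[of A] CE C(2) by blast
    show "card X' + card Y' + card Z' + card C \<le> 2 * m + 2"
      using cards C(5) card_off by (simp add: H_def)
    fix e
    have e: "of_bool (e \<in> X) + of_bool (e \<in> Y) + of_bool (e \<in> Z) = (if e \<in> S then 2 else (0 :: nat))"
      using t by (simp add: tri_def)
    show "of_bool (e \<in> X') + of_bool (e \<in> Y') + of_bool (e \<in> Z') + of_bool (e \<in> C) \<le> (2::nat)"
    proof (cases "e \<in> H")
      case True then show ?thesis using once[OF True] by (simp add: H_def)
    next
      case False
      then have "e \<in> X' \<Longrightarrow> e \<in> X" "e \<in> Y' \<Longrightarrow> e \<in> Y" "e \<in> Z' \<Longrightarrow> e \<in> Z" using sub by auto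
      moreover have "e \<in> S \<Longrightarrow> e \<notin> C" using C(3) by auto
      ultimately show ?thesis using e by (auto simp: of_bool_def split: if_splits)
    qed
  qed
  have ok_tri: "A \<noteq> {} \<and> even_set en A \<and> inj_on c A" if "tri X Y Z" "A \<in> {X, Y, Z}" for X Y Z A
  proof -
    have "irreducible_cycle A" "A \<subseteq> S" using that tri_sub[OF that(1)] by (auto simp: tri_def)
    then show ?thesis using Sinj inj_on_subset by (auto simp: irreducible_cycle_def)
  qed
  have HS: "h \<notin> X" "h \<notin> Y" "h \<notin> Z" if "tri X Y Z" "h \<in> H" for h X Y Z
    using tri_sub[OF that(1)] H(2)[OF that(2)] by auto
  show ?thesis
  proof (cases "\<exists>X\<in>{X1, X2, X3}. \<exists>h\<in>H. en h \<subseteq> supp X \<and> partner h \<notin> X")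
    case True
    then obtain X h where X: "X \<in> {X1, X2, X3}" "h \<in> H" "en h \<subseteq> supp X" "partner h \<notin> X" by blast
    obtain Y Z where "tri X Y Z" using tri_ex1[OF X(1)] by blast
    then show ?thesis using four_tuple_if_free_chord X H by blast
  next
    case False
    then have pin: "partner h \<in> X" if "X \<in> {X1, X2, X3}" "h \<in> H" "en h \<subseteq> supp X" for X h using that by blast
    have sc: "\<exists>T. even_set en T \<and> h \<in> T \<and> partner h \<in> T \<and> T \<subseteq> insert h X \<and> 3 \<le> card T \<and>
        sym_diff X T \<subseteq> insert h X \<and> h \<in> sym_diff X T \<and> even_set en (sym_diff X T) \<and> inj_on c (sym_diff X T) \<and>
        card (sym_diff X T) + card T = card X + 2"
      if "X \<in> {X1, X2, X3}" "h \<in> H" "en h \<subseteq> supp X" "tri X Y Z" for X h Y Z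
      using shortcut[OF that(4) H(1,2)[OF that(2)] that(3) pin[OF that(1-3)]] .
    have adm: "\<exists>X\<in>{X1, X2, X3}. en h \<subseteq> supp X" if h: "h \<in> H" for h
    proof -
      obtain a b where "en h = {a, b}" using is_edge_en[OF H(1)[OF h]] by (auto simp: is_edge_def)
      then show ?thesis using admissible_exists[of a b] H(5)[OF h] by auto
    qed
    \<comment> \<open>A single shortcut saves \<open>card T - 2\<close> edges, which may be enough
      for all chords.\<close>
    have single: four_tuple if X: "X \<in> {X1, X2, X3}" "h \<in> H" "en h \<subseteq> supp X" "tri X Y Z"
      and T: "even_set en (sym_diff X T)" "h \<in> sym_diff X T" "sym_diff X T \<subseteq> insert h X" "inj_on c (sym_diff X T)"
        "card (sym_diff X T) + card T = card X + 2" and big: "card H + 2 \<le> card T" for X h Y Z T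
    proof (rule finish[OF X(4), of "sym_diff X T" Y Z])
      show "A \<noteq> {} \<and> even_set en A \<and> inj_on c A" if "A \<in> {sym_diff X T, Y, Z}" for A
        using that T ok_tri[OF X(4), of A] by blast
      show "of_bool (k \<in> sym_diff X T) + of_bool (k \<in> Y) + of_bool (k \<in> Z) \<le> (1::nat)" if "k \<in> H" for k
        using HS[OF X(4) that] by simp
      show "card (sym_diff X T) + card Y + card Z + card H \<le> 2 * card S"
        using card_tri[OF X(4)] T(5) big by linarith
    qed (use T X in auto)
    consider "H = {}" | h where "H = {h}" | h k where "H = {h, k}" "h \<noteq> k"
    proof -
      have "card H = 0 \<or> card H = 1 \<or> card H = 2" using cH by linarith
      then show ?thesis using that finH by (auto simp: card_1_singleton_iff card_2_iff)
    qed
    then show ?thesis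
    proof cases
      case 1
      show ?thesis by (rule finish[OF tri123, of X1 X2 X3]) (use ok_tri[OF tri123] card_tri[OF tri123] 1 in auto)
    next
      case (2 h)
      obtain X where X: "X \<in> {X1, X2, X3}" "en h \<subseteq> supp X" using adm[of h] 2 by auto
      obtain Y Z where t: "tri X Y Z" using tri_ex1[OF X(1)] by blast
      obtain T where T: "3 \<le> card T" "sym_diff X T \<subseteq> insert h X" "h \<in> sym_diff X T" "even_set en (sym_diff X T)"
          "inj_on c (sym_diff X T)" "card (sym_diff X T) + card T = card X + 2"
        using sc[OF X(1) _ X(2) t] 2 by auto
      show ?thesis by (rule single[OF X(1) _ X(2) t T(4,3,2,5,6)]) (use 2 T in auto)
    next
      case (3 h k)
      have hH: "h \<in> H" "k \<in> H" using 3 by auto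
      have cH2: "card H = 2" using 3 by simp
      show ?thesis
      \<comment> \<open>Chords on different cycles are shortcut independently, each saving one
        edge.\<close>
      proof (cases "\<exists>X\<in>{X1, X2, X3}. \<exists>W\<in>{X1, X2, X3}. X \<noteq> W \<and> en h \<subseteq> supp X \<and> en k \<subseteq> supp W")
        case True
        then obtain X W where XW: "X \<in> {X1, X2, X3}" "W \<in> {X1, X2, X3}" "X \<noteq> W" "en h \<subseteq> supp X" "en k \<subseteq> supp W" by blast
        obtain Z where t: "tri X W Z" using tri_ex[OF XW(1-3)] by blast
        obtain T where T: "3 \<le> card T" "sym_diff X T \<subseteq> insert h X" "h \<in> sym_diff X T" "even_set en (sym_diff X T)"
            "inj_on c (sym_diff X T)" "card (sym_diff X T) + card T = card X + 2"
          using sc[OF XW(1) hH(1) XW(4) t] by blast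
        obtain U where U: "3 \<le> card U" "sym_diff W U \<subseteq> insert k W" "k \<in> sym_diff W U" "even_set en (sym_diff W U)"
            "inj_on c (sym_diff W U)" "card (sym_diff W U) + card U = card W + 2"
          using sc[OF XW(2) hH(2) XW(5) tri_perms(1)[OF t]] by blast
        show ?thesis
        proof (rule finish[OF t, of "sym_diff X T" "sym_diff W U" Z])
          show "A \<noteq> {} \<and> even_set en A \<and> inj_on c A" if "A \<in> {sym_diff X T, sym_diff W U, Z}" for A
            using that T U ok_tri[OF t, of A] by blast
          show "of_bool (g \<in> sym_diff X T) + of_bool (g \<in> sym_diff W U) + of_bool (g \<in> Z) \<le> (1::nat)" if g: "g \<in> H" for g
          proof -
            have "\<not> (g \<in> sym_diff X T \<and> g \<in> sym_diff W U)" using T(2) U(2) HS[OF t g] 3 by blast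
            then show ?thesis using HS(3)[OF t g] by (auto simp: of_bool_def)
          qed
          show "card (sym_diff X T) + card (sym_diff W U) + card Z + card H \<le> 2 * card S"
            using card_tri[OF t] T U cH2 by linarith
        qed (use T U 3 in auto)
      next
        case False
        obtain X where X: "X \<in> {X1, X2, X3}" "en h \<subseteq> supp X" using adm[OF hH(1)] by blast
        have kX: "en k \<subseteq> supp X" using adm[OF hH(2)] False X by metis
        have uniq: "W = X" if "W \<in> {X1, X2, X3}" "en h \<subseteq> supp W" for W using False that kX X(1) by blast
        obtain Y Z where t: "tri X Y Z" using tri_ex1[OF X(1)] by blast
        obtain T where T0: "even_set en T" "h \<in> T" "partner h \<in> T" "T \<subseteq> insert h X"
          and T: "3 \<le> card T" "sym_diff X T \<subseteq> insert h X" "h \<in> sym_diff X T" "even_set en (sym_diff X T)"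
            "inj_on c (sym_diff X T)" "card (sym_diff X T) + card T = card X + 2"
          using sc[OF X(1) hH(1) X(2) t] by blast
        obtain U where U0: "even_set en U" "k \<in> U" "partner k \<in> U" "U \<subseteq> insert k X"
          and U: "3 \<le> card U" "sym_diff X U \<subseteq> insert k X" "k \<in> sym_diff X U" "even_set en (sym_diff X U)"
            "inj_on c (sym_diff X U)" "card (sym_diff X U) + card U = card X + 2"
          using sc[OF X(1) hH(2) kX t] by blast
        have XE: "X \<subseteq> E" using tri_sub[OF t] SE by auto
        show ?thesis
        \<comment> \<open>Both chords lie on \<open>X\<close> alone. A removed side with four or
          more edges saves two at once; otherwise both sides are triangles and both shortcuts must
          be applied to \<open>X\<close>.\<close>
        proof (cases "card T = 3 \<and> card U = 3")
          case False
          then have "4 \<le> card T \<or> 4 \<le> card U" using T(1) U(1) by linarith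
          then show ?thesis
          proof
            assume "4 \<le> card T"
            then show ?thesis using single[OF X(1) hH(1) X(2) t T(4,3,2,5,6)] cH2 by simp
          next
            assume "4 \<le> card U"
            then show ?thesis using single[OF X(1) hH(2) kX t U(4,3,2,5,6)] cH2 by simp
          qed
        next
          case True
          \<comment> \<open>In a triangle containing \<open>g\<close> and its partner, the branch
            vertex \<open>w g\<close> is the corner opposite \<open>g\<close>, hence on both other
            edges.\<close>
          have apex: "w g \<in> en e" "deg S (w g) = 3" "w g \<notin> en g" if g: "g \<in> H" and A: "even_set en A" "partner g \<in> A" "A \<subseteq> insert g X" "card A = 3" "g \<in> A"
            and e: "e \<in> A" "e \<noteq> g" for g A e
          proof -
            have wg: "partner g \<in> J (w g)" using w[OF g] .
            show "deg S (w g) = 3" using J_deg[OF wg] .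
            show wn: "w g \<notin> en g" using wg H(4)[OF g] by (auto simp: J_def)
            have AE: "A \<subseteq> E" using A XE H(1)[OF g] by auto
            have wp: "w g \<in> en (partner g)" using wg by (auto simp: J_def)
            have "w g \<in> supp A" using A(2) wp by (auto simp: supp_def)
            then have d: "2 \<le> deg A (w g)" using even_deg_ge2[OF AE A(1)] by blast
            have finA: "finite A" using AE finite_edges by blast
            have sub: "{x\<in>A. w g \<in> en x} \<subseteq> A - {g}" using wn by auto
            have "card (A - {g}) = 2" using A(4,5) finA by simp
            then have "{x\<in>A. w g \<in> en x} = A - {g}" using d finA by (intro card_seteq[OF _ sub]) (auto simp: deg_def)
            then show "w g \<in> en e" using e by blast
          qed
          \<comment> \<open>A common edge would join the two branch vertices, making
            \<open>w k\<close> an end of \<open>h\<close>. A chord ending in a branch vertex lies on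
            two of the cycles, but \<open>X\<close> is the only one carrying
            \<open>h\<close>.\<close>
          have disj: "T \<inter> U = {}"
          proof (rule ccontr)
            assume "T \<inter> U \<noteq> {}"
            then obtain e where e: "e \<in> T" "e \<in> U" by blast
            have "e \<noteq> h" using e U0(4) HS(1)[OF t hH(1)] 3 by auto
            have "e \<noteq> k" using e T0(4) HS(1)[OF t hH(2)] 3 by auto
            have wh: "w h \<in> en e" "w h \<notin> en h" using apex[OF hH(1) T0(1,3,4) _ T0(2) e(1) \<open>e \<noteq> h\<close>] True by auto
            have wk: "w k \<in> en e" "deg S (w k) = 3" using apex[OF hH(2) U0(1,3,4) _ U0(2) e(2) \<open>e \<noteq> k\<close>] True by auto
            have "w h \<noteq> w k"
            proof
              assume "w h = w k"
              then have "partner h = partner k" using w[OF hH(1)] w[OF hH(2)] J_unique by metis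
              then show False using partner_inj H(1) hH 3 by metis
            qed
            have TE: "T \<subseteq> E" using T0 XE H(1)[OF hH(1)] by auto
            then have eE: "e \<in> E" using e by auto
            have en_e: "en e = {w h, w k}" using en_other[OF eE wh(1)] wk(1) \<open>w h \<noteq> w k\<close> by auto
            have "w k \<in> supp T" using e wk by (auto simp: supp_def)
            then have "2 \<le> card {x\<in>T. w k \<in> en x}" using even_deg_ge2[OF TE T0(1)] by (auto simp: deg_def)
            then have "\<not> {x\<in>T. w k \<in> en x} \<subseteq> {e}" using card_mono[of "{e}" "{x\<in>T. w k \<in> en x}"] by fastforce
            then obtain g where g: "g \<in> T" "w k \<in> en g" "g \<noteq> e" by blast
            have "g = h"
            proof (rule ccontr)
              assume "g \<noteq> h"
              then have "w h \<in> en g" using apex(1)[OF hH(1) T0(1,3,4) _ T0(2) g(1)] True by auto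
              then obtain u where "en g = {w h, u}" using en_other[of g "w h"] g(1) TE by blast
              then have "en g = {w h, w k}" using g(2) \<open>w h \<noteq> w k\<close> by auto
              then show False using edges_eq[of g e] g TE eE en_e by auto
            qed
            then obtain b where b: "en h = {w k, b}" using en_other[of h "w k"] g H(1)[OF hH(1)] by auto
            then have "b \<in> VS" using H(5)[OF hH(1)] by auto
            then obtain W where "W \<in> {X1, X2, X3}" "W \<noteq> X" "w k \<in> supp W" "b \<in> supp W"
              using two_admissible[OF wk(2)] by blast
            then show False using uniq[of W] b by auto
          qed
          \<comment> \<open>The triangles are disjoint, so each shortcut saves one edge and each
            removes the partner of its chord.\<close>
          define X' where "X' = sym_diff (sym_diff X T) U"
          have hk: "h \<notin> X" "k \<notin> X" using HS(1)[OF t] hH by auto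
          have X'sub: "X' \<subseteq> insert h (insert k X)" using T0 U0 by (auto simp: X'_def)
          have "even_set en X'" unfolding X'_def using T(4) U0(1) by (rule even_set_sym_diff)
          moreover have hX': "h \<in> X'" "k \<in> X'" "partner h \<notin> X'" "partner k \<notin> X'"
            using T0 U0 hk disj 3 pin[OF X(1) hH(1) X(2)] pin[OF X(1) hH(2) kX] by (auto simp: X'_def)
          moreover have "inj_on c X'"
          proof (rule inj_onI)
            have XS: "X \<subseteq> S" using tri_sub[OF t] by auto
            fix a b assume ab: "a \<in> X'" "b \<in> X'" "c a = c b"
            have hx: "x = g" if "x \<in> X'" "c x = c g" "g \<in> {h, k}" for x g
            proof -
              have "g \<in> H" "partner g \<notin> X'" using that hH hX' by auto
              moreover have "x \<in> E" using that X'sub XE H(1) hH by auto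
              ultimately show ?thesis using partner(4)[OF H(1)[OF \<open>g \<in> H\<close>], of x] that by auto
            qed
            show "a = b"
            proof (cases "a \<in> {h, k} \<or> b \<in> {h, k}")
              case True then show ?thesis using hx ab by metis
            next
              case False
              then have "a \<in> S" "b \<in> S" using ab X'sub XS by auto
              then show ?thesis using Sinj ab by (auto dest: inj_onD)
            qed
          qed
          moreover have "card X' + 2 = card X"
          proof -
            have finX: "finite X" using XE finite_edges by blast
            have "k \<notin> sym_diff X T" using hk T0 3 by auto
            moreover have "U \<subseteq> insert k (sym_diff X T)" using U0 disj by auto
            moreover have "finite (sym_diff X T)" using finX T0(4) finite_subset by auto
            ultimately have "card X' + card U = card (sym_diff X T) + 2"
              unfolding X'_def using U0(2) by (intro card_shortcut)
            then show ?thesis using T(6) True by simp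
          qed
          ultimately show ?thesis
          proof (intro finish[OF t, of X' Y Z])
            assume *: "even_set en X'" "h \<in> X'" "inj_on c X'" "card X' + 2 = card X"
            show "A \<noteq> {} \<and> even_set en A \<and> inj_on c A" if "A \<in> {X', Y, Z}" for A
              using that * ok_tri[OF t, of A] by blast
            show "of_bool (g \<in> X') + of_bool (g \<in> Y) + of_bool (g \<in> Z) \<le> (1::nat)" if "g \<in> H" for g
              using HS[OF t that] by simp
            show "card X' + card Y + card Z + card H \<le> 2 * card S"
              using card_tri[OF t] * cH2 by linarith
          qed (use X'sub 3 in auto)
        qed
      qed
    qed
  qed
qed

end

section \<open>From a smallest rainbow bicyclic set to a theta graph\<close>

context coloured_graph
begin

lemma four_tuple_rainbow_bicyclic:
  assumes ex: "S0 \<subseteq> E" "inj_on c S0" "bicyclic en S0"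
  shows four_tuple
proof -
  define P where "P S \<longleftrightarrow> S \<subseteq> E \<and> inj_on c S \<and> bicyclic en S" for S
  have "P S0" using ex by (simp add: P_def)
  then obtain S where S: "P S" "\<And>Q. P Q \<Longrightarrow> card S \<le> card Q" using ex_has_least_nat[of P S0 card] by blast
  have SE: "S \<subseteq> E" and Sinj: "inj_on c S" using S by (auto simp: P_def)
  have Smin: "card S \<le> card Q" if "Q \<subseteq> S" "bicyclic en Q" for Q
  proof -
    have "Q \<subseteq> E" "inj_on c Q" using that(1) SE Sinj inj_on_subset by blast+
    then show ?thesis using S(2)[of Q] that(2) by (simp add: P_def)
  qed
  have finS: "finite S" using SE finite_edges by blast
  have cS: "card S \<le> m"
  proof -
    have "card (c ` S) \<le> card {1..m}" using SE c_range by (intro card_mono) auto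
    then show ?thesis using Sinj by (simp add: card_image)
  qed
  obtain X1 X2 where X: "X1 \<subseteq> S" "X2 \<subseteq> S" "X1 \<noteq> {}" "X2 \<noteq> {}" "X1 \<noteq> X2" "even_set en X1" "even_set en X2"
    using S(1) by (auto simp: P_def bicyclic_def)
  have "bicyclic en (X1 \<union> X2)" using X unfolding bicyclic_def by (intro exI[of _ X1] exI[of _ X2]) auto
  then have S_eq: "S = X1 \<union> X2" using Smin[of "X1 \<union> X2"] X card_seteq[OF finS, of "X1 \<union> X2"] by auto
  define X3 where "X3 = sym_diff X1 X2"
  have X3: "even_set en X3" "X3 \<subseteq> S" "X3 \<noteq> {}" using X even_set_sym_diff[of en X1 X2] by (auto simp: X3_def)
  have disjoint: four_tuple if "A \<subseteq> S" "B \<subseteq> S" "A \<noteq> {}" "B \<noteq> {}" "even_set en A" "even_set en B" "A \<inter> B = {}" for A B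
  proof (rule four_tuple_if_disjoint_pair[of A B])
    have "card A + card B = card (A \<union> B)" using that finS by (metis card_Un_disjoint finite_subset)
    also have "\<dots> \<le> card S" using that finS by (intro card_mono) auto
    finally show "card A + card B \<le> m + 1" using cS by simp
  qed (use that SE Sinj inj_on_subset in blast)+
  have span: "U = {} \<or> U = X1 \<or> U = X2 \<or> U = X3" if U: "U \<subseteq> S" "even_set en U" for U
  proof (rule ccontr)
    assume neg: "\<not> ?thesis"
    obtain e where e: "e \<in> X1" using X by blast
    \<comment> \<open>Elimination of the coordinate \<open>e\<close>: a further even set would leave
      two independent ones avoiding \<open>e\<close>, so that \<open>S - {e}\<close> would be a
      smaller bicyclic set.\<close>
    define red where "red A = (if e \<in> A then sym_diff A X1 else A)" for A
    have red: "red A \<subseteq> S - {e}" "even_set en (red A)" if "A \<subseteq> S" "even_set en A" for A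
      using that X e even_set_sym_diff[of en A X1] by (auto simp: red_def)
    have r2: "red X2 \<noteq> {}" "red U \<noteq> {}" "red X2 \<noteq> red U"
      using neg X by (auto simp: red_def X3_def split: if_splits)
    have "bicyclic en (S - {e})" unfolding bicyclic_def
      using red[OF X(2,7)] red[OF U] r2 by blast
    then have "card S \<le> card (S - {e})" using Smin[of "S - {e}"] by blast
    then show False using card_Diff1_less[OF finS, of e] e X by auto
  qed
  show ?thesis
  \<comment> \<open>In the degenerate positions two of the three even sets are disjoint; together
    they have at most |S| \<le> m edges, so each can be taken twice.\<close>
  proof (cases "X1 \<inter> X2 = {} \<or> X1 \<subseteq> X2 \<or> X2 \<subseteq> X1")
    case True
    then consider "X1 \<inter> X2 = {}" | "X1 \<inter> X3 = {}" | "X2 \<inter> X3 = {}" by (auto simp: X3_def)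
    then show ?thesis
    proof cases
      case 1 then show ?thesis using disjoint[of X1 X2] X by blast
    next
      case 2 then show ?thesis using disjoint[of X1 X3] X X3 by blast
    next
      case 3 then show ?thesis using disjoint[of X2 X3] X X3 by blast
    qed
  next
    case False
    have irr: "irreducible_cycle X1" "irreducible_cycle X2" "irreducible_cycle X3"
    proof -
      have n: "\<not> X2 \<subseteq> X1" "\<not> X1 \<subseteq> X2" "\<not> X3 \<subseteq> X1" "\<not> X3 \<subseteq> X2" "\<not> X1 \<subseteq> X3" "\<not> X2 \<subseteq> X3"
        using False by (auto simp: X3_def)
      have i: "irreducible_cycle A" if A: "A \<subseteq> S" "even_set en A" "A \<noteq> {}"
        and o: "\<And>B. B \<in> {X1, X2, X3} \<Longrightarrow> B \<noteq> A \<Longrightarrow> \<not> B \<subseteq> A" for A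
      proof -
        have "U = {} \<or> U = A" if "U \<subseteq> A" "even_set en U" for U
        proof -
          have "U \<subseteq> S" using that A by blast
          then have "U = {} \<or> U \<in> {X1, X2, X3}" using span that(2) by blast
          then show ?thesis using o that(1) by blast
        qed
        then show ?thesis using A SE by (auto simp: irreducible_cycle_def)
      qed
      show "irreducible_cycle X1" by (rule i) (use X n in auto)
      show "irreducible_cycle X2" by (rule i) (use X n in auto)
      show "irreducible_cycle X3" by (rule i) (use X3 n in auto)
    qed
    interpret minimal_rainbow_bicyclic V E en c m S X1 X2 X3
    proof
      show "S \<subseteq> E" "inj_on c S" using SE Sinj .
      show "card S \<le> card Q" if "Q \<subseteq> E" "inj_on c Q" "bicyclic en Q" for Q
        using S(2)[of Q] that by (simp add: P_def)
      show "irreducible_cycle X1" "irreducible_cycle X2" "irreducible_cycle X3" using irr .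
      show "X1 \<noteq> X2" "X1 \<noteq> X3" "X2 \<noteq> X3" "X1 \<inter> X2 \<noteq> {}" using X False by (auto simp: X3_def)
      show "of_bool (e \<in> X1) + of_bool (e \<in> X2) + of_bool (e \<in> X3) = (if e \<in> S then 2 else (0 :: nat))" for e
        by (auto simp: X3_def S_eq)
    qed
    show ?thesis by (rule four_tuple_holds)
  qed
qed

lemma four_tuple_exists: "V \<noteq> {} \<Longrightarrow> four_tuple"
  using four_tuple_rainbow_bicyclic four_tuple_no_rainbow_bicyclic by blast

end

text \<open>A loop or a pair of parallel edges would be a nonempty even set of at most two elements,
  which simplicity forbids; hence the graph is simple.\<close>

lemma (in matroid) graphic_short_tuple:
  assumes simple: "simple_matroid M" and rep: "represents M V en" and cardV: "card V \<le> matroid_rank M + 1"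
    and col: "colouring M (matroid_rank M + 1) c" and two: "two_uniform M (matroid_rank M + 1) c"
  shows "\<exists>C. short_rainbow_circuit_4_tuple M c C"
proof -
  have edge: "is_edge (en e) \<and> en e \<subseteq> V" if "e \<in> ground M" for e using rep that by (auto simp: represents_def)
  have dep: "T = {}" if "T \<subseteq> ground M" "even_set en T" "card T \<le> 2" for T
    using simple_small_indep[OF simple that(1,3)] rep that unfolding represents_def by blast
  have card2: "card (en e) = 2" if e: "e \<in> ground M" for e
  proof (rule ccontr)
    assume "card (en e) \<noteq> 2"
    then obtain a where "en e = {a}" using edge[OF e] by (auto simp: is_edge_def card_insert_if split: if_splits)
    then have none: "{e} \<inter> cut en {v} = {}" for v by (auto simp: cut_def)
    have "even_set en {e}" unfolding even_set_def none by simp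
    then show False using dep[of "{e}"] e by simp
  qed
  have "inj_on en (ground M)"
  proof (rule inj_onI, rule ccontr)
    fix e f assume ef: "e \<in> ground M" "f \<in> ground M" "en e = en f" "e \<noteq> f"
    have "even (card ({e, f} \<inter> cut en {v}))" for v
    proof -
      have "{e, f} \<inter> cut en {v} = (if e \<in> cut en {v} then {e, f} else {})" using ef by (auto simp: cut_def)
      then show ?thesis using ef by simp
    qed
    then have "even_set en {e, f}" by (simp add: even_set_def)
    then show False using dep[of "{e, f}"] ef by simp
  qed
  then interpret coloured_graph V "ground M" en c "matroid_rank M + 1"
  proof (unfold_locales)
    show "finite V" using rep by (simp add: represents_def)
    show "c e \<in> {1..matroid_rank M + 1}" if "e \<in> ground M" for e
      using col that unfolding colouring_def by (rule funcset_mem)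
    show "card {e \<in> ground M. c e = s} = 2" if "s \<in> {1..matroid_rank M + 1}" for s
      using two that unfolding two_uniform_def by blast
  qed (use edge card2 finite_ground cardV in blast)+
  have "V \<noteq> {}" using rep by (simp add: represents_def)
  then have "four_tuple" by (rule four_tuple_exists)
  then obtain A1 A2 A3 A4 where A: "\<forall>X\<in>{A1, A2, A3, A4}. X \<subseteq> ground M \<and> X \<noteq> {} \<and> even_set en X \<and> inj_on c X"
    "card A1 + card A2 + card A3 + card A4 \<le> 2 * (matroid_rank M + 1) + 2"
    "\<forall>e. of_bool (e \<in> A1) + of_bool (e \<in> A2) + of_bool (e \<in> A3) + of_bool (e \<in> A4) \<le> (2 :: nat)"
    unfolding four_tuple_def by (elim exE conjE)
  show ?thesis
  proof (rule short_tuple_from_four_sets[of A1 A2 A3 A4])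
    show "X \<subseteq> ground M \<and> X \<notin> indeps M \<and> inj_on c X" if "X \<in> {A1, A2, A3, A4}" for X
    proof -
      have X: "X \<subseteq> ground M" "X \<noteq> {}" "even_set en X" "inj_on c X" using bspec[OF A(1) that] by auto
      have "X \<notin> indeps M"
      proof
        assume "X \<in> indeps M"
        then have "\<forall>T\<subseteq>X. even_set en T \<longrightarrow> T = {}" using rep X(1) by (simp add: represents_def)
        then show False using X by blast
      qed
      then show ?thesis using X by blast
    qed
  qed (use A(2,3) in auto)
qed

theorem theorem3:
  fixes M :: "'a pre_matroid" and c :: "'a \<Rightarrow> nat"
  assumes "matroid M"
    and "simple_matroid M"
    and "graphic M \<or> cographic M"
    and "colouring M (matroid_rank M + 1) c"
    and "two_uniform M (matroid_rank M + 1) c"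
  shows "\<exists>C. short_rainbow_circuit_4_tuple M c C"
proof -
  interpret matroid M by (rule assms(1))
  have cE: "card (ground M) = 2 * (matroid_rank M + 1)"
    using card_two_uniform[OF assms(4,5) finite_ground] .
  show ?thesis
    using assms(3)
  proof
    assume "graphic M"
    then obtain V :: "nat set" and en where rep: "represents M V en"
      and conn: "\<forall>X\<subseteq>V. X \<noteq> {} \<longrightarrow> X \<noteq> V \<longrightarrow> cut en X \<inter> ground M \<noteq> {}"
      using connected_representation finite_ground by blast
    obtain B where B: "B \<in> indeps M" "card B = matroid_rank M" using max_indep_exists by blast
    have "card V \<le> card B + 1"
      by (rule connected_card_le[OF rep conn B(1) indep_subset_ground[OF B(1)] finite_indep[OF B(1)]])
        (use card_indep_le_rank B in simp)
    then show ?thesis using graphic_short_tuple[OF assms(2) rep _ assms(4,5)] B by simp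
  next
    assume "cographic M"
    have gr: "ground (dual M) = ground M" by (simp add: dual_def)
    obtain V :: "nat set" and en where rep: "represents (dual M) V en"
      and conn: "\<forall>X\<subseteq>V. X \<noteq> {} \<longrightarrow> X \<noteq> V \<longrightarrow> cut en X \<inter> ground M \<noteq> {}"
      using connected_representation[of "dual M"] \<open>cographic M\<close> finite_ground gr unfolding cographic_def by metis
    obtain B where B: "B \<in> indeps (dual M)" "B \<subseteq> ground M" "card B = card (ground M) - matroid_rank M"
      using dual_indep_card(1) by blast
    have finB: "finite B" using B finite_ground finite_subset by blast
    have "card V \<le> card B + 1"
      by (rule connected_card_le[OF rep _ B(1) _ finB]) (use conn gr B dual_indep_card(2) in auto)
    moreover have "card B < card V" by (rule represents_card_indep_less[OF rep B(1) _ finB]) (use B gr in simp)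
    \<comment> \<open>The dual has rank 2(r+1) - r = r+2, and its connected graph has one vertex
      more.\<close>
    ultimately have "card V = matroid_rank M + 3" using B(3) cE by simp
    then show ?thesis by (rule cographic_short_tuple[OF assms(2) rep conn assms(4,5)])
  qed
qed

end
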